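(* Every $4$-edge-connected, essentially $23$-edge-connected graph admits a nowhere-zero $3$-flow.
   Context: Graphs are finite and loopless, but may contain parallel edges. An edge-cut of a graph is an inclusion-minimal set of edges whose removal increases the number of connected components (i.e. a bond). A component is nontrivial if it contains an edge. An edge-cut $F$ of a connected graph $G$ is essential if $G-F$ has at least two nontrivial components. A connected graph $G$ is essentially $t$-edge-connected if it has no essential edge-cut with fewer than $t$ edges; equivalently, deleting any set of at most $t-1$ edges leaves at most one nontrivial component. For an integer $k\ge 2$, a nowhere-zero $k$-flow of $G$ is a pair $(D,f)$ where $D$ is an orientation of $G$ and $f:E(G)\to\{1,2,\ldots,k-1\}$ satisfies $\sum_{e\in E_D^+(v)}f(e)=\sum_{e\in E_D^-(v)}f(e)$ for every $v\in V(G)$, where $E_D^+(v)$ and $E_D^-(v)$ are the sets of edges directed away from and toward $v$ in $D$, respectively. *)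

theory Defs
  imports "Graph_Theory.Digraph"
begin

text \<open>
  Undirected multigraphs: parallel edges are distinct elements of the edge set with the same pair
  of end vertices.
\<close>

record ('v, 'e) pre_multigraph =
  vertices :: "'v set"
  edges :: "'e set"
  ends :: "'e \<Rightarrow> 'v set"

locale loopless_multigraph =
  fixes G :: "('v, 'e) pre_multigraph" (structure)
  assumes finite_vertices: "finite (vertices G)"
    and finite_edges: "finite (edges G)"
    and ends_in_vertices: "e \<in> edges G \<Longrightarrow> ends G e \<subseteq> vertices G"
    and card_ends: "e \<in> edges G \<Longrightarrow> card (ends G e) = 2"

definition delete_edges ::
    "('v, 'e) pre_multigraph \<Rightarrow> 'e set \<Rightarrow> ('v, 'e) pre_multigraph" where
  "delete_edges G F = G\<lparr>edges := edges G - F\<rparr>"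

definition adjacency :: "('v, 'e) pre_multigraph \<Rightarrow> ('v \<times> 'v) set" where
  "adjacency G = {(u, v). \<exists>e \<in> edges G. ends G e = {u, v}}"

text \<open>
  Components are represented by their vertex sets; \<^const>\<open>rtrancl_on\<close> restricts the
  reflexive closure to the vertices of the graph.
\<close>

definition components :: "('v, 'e) pre_multigraph \<Rightarrow> 'v set set" where
  "components G = vertices G // rtrancl_on (vertices G) (adjacency G)"

definition nontrivial_components :: "('v, 'e) pre_multigraph \<Rightarrow> 'v set set" where
  "nontrivial_components G = {C \<in> components G. \<exists>e \<in> edges G. ends G e \<subseteq> C}"

text \<open>The null graph is not connected; the graph with a single vertex is.\<close>

definition connected_multigraph :: "('v, 'e) pre_multigraph \<Rightarrow> bool" where
  "connected_multigraph G \<longleftrightarrow> card (components G) = 1"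

definition separates :: "('v, 'e) pre_multigraph \<Rightarrow> 'e set \<Rightarrow> bool" where
  "separates G F \<longleftrightarrow>
     F \<subseteq> edges G \<and> card (components (delete_edges G F)) > card (components G)"

definition edge_cut :: "('v, 'e) pre_multigraph \<Rightarrow> 'e set \<Rightarrow> bool" where
  "edge_cut G F \<longleftrightarrow> separates G F \<and> (\<forall>F'. F' \<subset> F \<longrightarrow> \<not> separates G F')"

definition essential_edge_cut :: "('v, 'e) pre_multigraph \<Rightarrow> 'e set \<Rightarrow> bool" where
  "essential_edge_cut G F \<longleftrightarrow>
     edge_cut G F \<and> card (nontrivial_components (delete_edges G F)) \<ge> 2"

definition edge_connected :: "nat \<Rightarrow> ('v, 'e) pre_multigraph \<Rightarrow> bool" where
  "edge_connected t G \<longleftrightarrow>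
     connected_multigraph G \<and> (\<nexists>F. edge_cut G F \<and> card F < t)"

definition essentially_edge_connected :: "nat \<Rightarrow> ('v, 'e) pre_multigraph \<Rightarrow> bool" where
  "essentially_edge_connected t G \<longleftrightarrow>
     connected_multigraph G \<and> (\<nexists>F. essential_edge_cut G F \<and> card F < t)"

definition orientation :: "('v, 'e) pre_multigraph \<Rightarrow> ('v, 'e) pre_digraph \<Rightarrow> bool" where
  "orientation G D \<longleftrightarrow>
     verts D = vertices G \<and> arcs D = edges G \<and>
     (\<forall>e \<in> edges G. {tail D e, head D e} = ends G e)"

definition nowhere_zero_flow ::
    "nat \<Rightarrow> ('v, 'e) pre_multigraph \<Rightarrow> ('v, 'e) pre_digraph \<Rightarrow> ('e \<Rightarrow> nat) \<Rightarrow> bool" where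
  "nowhere_zero_flow k G D f \<longleftrightarrow>
     orientation G D \<and>
     (\<forall>e \<in> edges G. f e \<in> {1..k - 1}) \<and>
     (\<forall>v \<in> vertices G. (\<Sum>e \<in> out_arcs D v. f e) = (\<Sum>e \<in> in_arcs D v. f e))"

end

theory Submission
  imports Defs Complex_Main "HOL-Library.Disjoint_Sets"
begin

text \<open>
  A 3-flow comes from arithmetic modulo 3 (Tutte): it is enough to orient the edges so that at
  every vertex the out-degree minus the in-degree is divisible by 3. Give every edge the value 1;
  reversing an edge and giving it the value 2 changes the excess of its two ends by 3. Among all
  such choices one of least total excess is balanced, because otherwise some path from a vertex of
  positive excess to a vertex of negative excess could be flipped (\<open>balanced_exists\<close>).
  So the work is to find orientations whose net outflows have prescribed residues modulo 3.

  The source of such orientations is the theorem of Lovasz, Thomassen, Wu and Zhang: in a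
  6-edge-connected multigraph every prescription with sum 0 modulo 3 is realised
  (\<open>orientable_if_six_edge_connected\<close>). It is proved by induction in a stronger form,
  where the edges at one root vertex are oriented in advance (\<open>orientation_extension\<close>).

  The second step, due to Han, Lai and Li, replaces 6-edge-connectivity by the condition that
  every partition into p parts has at least 4 (p - 1) crossing edges, which by Nash-Williams and
  Tutte means four edge-disjoint spanning trees (\<open>orientable_if_tree_rich\<close>). In a minimal
  counterexample no smaller part satisfies the condition, for it could be contracted. Hence the
  partitions that are neither trivial nor into singletons have a crossing edge to spare, so that,
  by deletion of edges, the graph has at most 4 (n - 1) edges; counting then shows that a cut with
  two vertices on both sides has at least 6 edges. Vertices of degree 4 and 5 can be removed, and
  the graph is 6-edge-connected.

  It remains to reach the partition condition from the cuts of the given graph. A vertex of degree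
  4 is split into two edges: if all three pairings of its edges destroyed the cut condition, three
  cuts with at most 24 edges would uncross into four cuts with at least 21 edges each
  (\<open>good_pairing\<close>). Once all degrees are at least 5, two adjacent parts of a partition with
  a and b boundary edges satisfy, up to degenerate cases, a + b \<ge> 25, and as a, b \<ge> 5 this gives
  1/a + 1/b \<le> 1/4. Summing over the crossing edges, p parts have at least 4 p of them
  (\<open>tree_rich_if_min_degree_5\<close>). The number 23 is exactly what makes a degree 5 and its
  neighbour of degree at least 20 meet this bound.
\<close>

section \<open>Multigraphs as multiplicity functions and orientations modulo 3\<close>

text \<open>
  The residues modulo 3 of sums of \<open>k\<close> signs: what \<open>k\<close> parallel edges can carry in
  total once each of them has received a direction.
\<close>

definition attainable :: "int \<Rightarrow> int \<Rightarrow> bool" where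
  "attainable k r \<longleftrightarrow> (k = 0 \<longrightarrow> 3 dvd r) \<and> (k = 1 \<longrightarrow> \<not> 3 dvd r)"

lemma attainable_add: "0 \<le> k \<Longrightarrow> s = 1 \<or> s = -1 \<Longrightarrow> attainable k r \<Longrightarrow> attainable (k + 1) (r + s)"
  unfolding attainable_def by presburger

lemma attainable_sub: "0 \<le> k \<Longrightarrow> attainable (k + 1) r \<Longrightarrow> \<exists>s. (s = 1 \<or> s = -1) \<and> attainable k (r - s)"
  unfolding attainable_def by presburger

lemma attainable_plus: "0 \<le> k \<Longrightarrow> 0 \<le> l \<Longrightarrow> attainable k r \<Longrightarrow> attainable l s \<Longrightarrow> attainable (k + l) (r + s)"
  unfolding attainable_def by presburger

text \<open>
  A residue attained by several bundles of parallel edges together can be distributed among them;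
  this undoes contractions.
\<close>

lemma attainable_split: "0 \<le> k \<Longrightarrow> 0 \<le> l \<Longrightarrow> attainable (k + l) r \<Longrightarrow>
    \<exists>s. attainable k s \<and> attainable l (r - s)"
  unfolding attainable_def by presburger

lemma attainable_ge2: "2 \<le> k \<Longrightarrow> attainable k r"
  unfolding attainable_def by presburger

lemma attainable_minus [simp]: "attainable k (- r) = attainable k r"
  unfolding attainable_def by presburger

lemma attainable_zero [simp]: "attainable 0 r = (3 dvd r)"
  unfolding attainable_def by presburger

lemma attainable_sum:
  assumes "finite A" "\<And>x. x \<in> A \<Longrightarrow> 0 \<le> k x" "\<And>x. x \<in> A \<Longrightarrow> attainable (k x) (r x)"
  shows "attainable (sum k A) (sum r A)"
  using assms
proof (induction A)
  case empty
  then show ?case by (simp add: attainable_def)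
next
  case (insert x A)
  then show ?case by (simp add: attainable_plus sum_nonneg)
qed

lemma attainable_sum_split:
  assumes "finite A" "\<And>x. x \<in> A \<Longrightarrow> 0 \<le> k x" "attainable (sum k A) r"
  shows "\<exists>g. (\<forall>x\<in>A. attainable (k x) (g x)) \<and> 3 dvd (sum g A - r)"
  using assms
proof (induction A arbitrary: r)
  case empty
  then show ?case by (simp add: attainable_def)
next
  case (insert x A)
  have "attainable (k x + sum k A) r" using insert by simp
  then obtain s where s: "attainable (k x) s" "attainable (sum k A) (r - s)"
    using attainable_split[of "k x" "sum k A" r] insert by (auto simp: sum_nonneg)
  obtain g where g: "\<forall>x\<in>A. attainable (k x) (g x)" "3 dvd (sum g A - (r - s))"
    using insert.IH[OF _ s(2)] insert.prems by auto
  have "sum (g(x := s)) A = sum g A" using insert by (intro sum.cong) auto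
  then have "3 dvd (sum (g(x := s)) (insert x A) - r)"
    using g insert by (simp add: algebra_simps)
  moreover have "\<forall>y\<in>insert x A. attainable (k y) ((g(x := s)) y)" using g s by auto
  ultimately show ?case by blast
qed

definition mult :: "('v \<Rightarrow> 'v \<Rightarrow> int) \<Rightarrow> bool" where
  "mult m \<longleftrightarrow> (\<forall>u v. m u v = m v u \<and> 0 \<le> m u v) \<and> (\<forall>u. m u u = 0)"

definition cut :: "'v set \<Rightarrow> ('v \<Rightarrow> 'v \<Rightarrow> int) \<Rightarrow> 'v set \<Rightarrow> int" where
  "cut V m A = (\<Sum>u\<in>A. \<Sum>v\<in>V - A. m u v)"

text \<open>
  Some orientation has at every \<open>u\<close> a net outflow congruent to \<open>b u\<close>. Only the net
  amounts \<open>f u v\<close> on the bundles of parallel edges are recorded, as integers that matter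
  modulo 3 only.
\<close>

definition orientable :: "'v set \<Rightarrow> ('v \<Rightarrow> 'v \<Rightarrow> int) \<Rightarrow> ('v \<Rightarrow> int) \<Rightarrow> bool" where
  "orientable V m b \<longleftrightarrow> (\<exists>f. (\<forall>u v. f v u = - f u v) \<and> (\<forall>u\<in>V. \<forall>v\<in>V. attainable (m u v) (f u v)) \<and>
     (\<forall>u\<in>V. 3 dvd ((\<Sum>v\<in>V. f u v) - b u)))"

lemma orientableI:
  assumes "\<And>u v. f v u = - f u v" "\<And>u v. u \<in> V \<Longrightarrow> v \<in> V \<Longrightarrow> attainable (m u v) (f u v)"
    "\<And>u. u \<in> V \<Longrightarrow> 3 dvd ((\<Sum>v\<in>V. f u v) - b u)"
  shows "orientable V m b"
proof -
  have "\<forall>u v. f v u = - f u v" by (intro allI) (rule assms(1))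
  then show ?thesis unfolding orientable_def using assms(2,3) by blast
qed

lemma orientableE:
  assumes "orientable V m b"
  obtains f where "\<And>u v. f v u = - f u v" "\<And>u v. u \<in> V \<Longrightarrow> v \<in> V \<Longrightarrow> attainable (m u v) (f u v)"
    "\<And>u. u \<in> V \<Longrightarrow> 3 dvd ((\<Sum>v\<in>V. f u v) - b u)"
proof -
  obtain f where f: "\<forall>u v. f v u = - f u v" "\<forall>u\<in>V. \<forall>v\<in>V. attainable (m u v) (f u v)"
    "\<forall>u\<in>V. 3 dvd ((\<Sum>v\<in>V. f u v) - b u)"
    using assms unfolding orientable_def by blast
  show ?thesis by (rule that[of f]) (use f in blast)+
qed

definition edge :: "'v \<Rightarrow> 'v \<Rightarrow> 'v \<Rightarrow> 'v \<Rightarrow> int" where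
  "edge x y u v = of_bool (u = x \<and> v = y \<or> u = y \<and> v = x)"

definition arc :: "'v \<Rightarrow> 'v \<Rightarrow> 'v \<Rightarrow> int" where
  "arc x y v = of_bool (v = x) - of_bool (v = y)"

lemma multD: "mult m \<Longrightarrow> m u v = m v u" "mult m \<Longrightarrow> 0 \<le> m u v" "mult m \<Longrightarrow> m u u = 0"
  by (auto simp: mult_def)

lemma mult_edge: "mult m \<Longrightarrow> x \<noteq> y \<Longrightarrow> mult (\<lambda>u v. m u v + edge x y u v)"
  by (auto simp: mult_def edge_def)

lemma mult_del: "mult m \<Longrightarrow> x \<noteq> y \<Longrightarrow> 1 \<le> m x y \<Longrightarrow> mult (\<lambda>u v. m u v - edge x y u v)"
  by (auto simp: mult_def edge_def)

lemma arc_sum: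
  assumes "finite V" "x \<in> V" "y \<in> V" "x \<noteq> y"
  shows "(\<Sum>v\<in>V. of_bool (u = x \<and> v = y) - of_bool (u = y \<and> v = x) :: int) = arc x y u"
proof -
  have "(\<Sum>v\<in>V. of_bool (u = x \<and> v = y) :: int) = of_bool (u = x)"
       "(\<Sum>v\<in>V. of_bool (u = y \<and> v = x) :: int) = of_bool (u = y)"
    using assms by (auto simp: of_bool_conj sum_distrib_left[symmetric])
  then show ?thesis by (simp add: sum_subtractf arc_def)
qed

lemma orientable_add_edge:
  assumes "finite V" "mult m" "x \<in> V" "y \<in> V" "x \<noteq> y" "s = 1 \<or> s = -1"
    and sol: "orientable V m (\<lambda>v. b v - s * arc x y v)"
  shows "orientable V (\<lambda>u v. m u v + edge x y u v) b"
proof -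
  obtain f where f: "\<forall>u v. f v u = - f u v" "\<forall>u\<in>V. \<forall>v\<in>V. attainable (m u v) (f u v)"
    "\<forall>u\<in>V. 3 dvd ((\<Sum>v\<in>V. f u v) - (b u - s * arc x y u))"
    using sol unfolding orientable_def by blast
  define D :: "'a \<Rightarrow> 'a \<Rightarrow> int" where
    "D u v = of_bool (u = x \<and> v = y) - of_bool (u = y \<and> v = x)" for u v
  define g where "g u v = f u v + s * D u v" for u v
  have D: "D v u = - D u v" for u v by (simp add: D_def conj_commute)
  have "g v u = - g u v" for u v
  proof -
    have "s * D v u = - (s * D u v)" by (simp add: D[of v u])
    then show ?thesis using f(1)[rule_format, of v u] unfolding g_def by linarith
  qed
  moreover have "attainable (m u v + edge x y u v) (g u v)" if "u \<in> V" "v \<in> V" for u v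
    using f(2) that attainable_add[of "m u v" s "f u v"] attainable_add[of "m u v" "-s"
        "f u v"] assms multD[of m]
    by (auto simp: g_def D_def edge_def)
  moreover have "3 dvd ((\<Sum>v\<in>V. g u v) - b u)" if "u \<in> V" for u
  proof -
    have "(\<Sum>v\<in>V. g u v) = (\<Sum>v\<in>V. f u v) + s * arc x y u"
      unfolding g_def D_def using arc_sum[OF assms(1,3,4,5)]
      by (simp add: sum.distrib sum_distrib_left[symmetric])
    then show ?thesis using f(3) that by (simp add: algebra_simps)
  qed
  ultimately show ?thesis by (rule orientableI)
qed

text \<open>
  The direction of the removed edge cannot be chosen: it is read off from an orientation, and it is
  what a lifted edge hands down to the two edges that it replaced.
\<close>

lemma orientable_remove_edge:
  assumes "finite V" "mult m" "x \<in> V" "y \<in> V" "x \<noteq> y"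
    and sol: "orientable V (\<lambda>u v. m u v + edge x y u v) b"
  shows "\<exists>s. (s = 1 \<or> s = -1) \<and> orientable V m (\<lambda>v. b v - s * arc x y v)"
proof -
  obtain f where f: "\<forall>u v. f v u = - f u v" "\<forall>u\<in>V. \<forall>v\<in>V. attainable (m u v + edge x y u v) (f u v)"
    "\<forall>u\<in>V. 3 dvd ((\<Sum>v\<in>V. f u v) - b u)"
    using sol unfolding orientable_def by blast
  have "attainable (m x y + 1) (f x y)" using f(2) assms by (force simp: edge_def)
  then obtain s where s: "s = 1 \<or> s = -1" "attainable (m x y) (f x y - s)"
    using attainable_sub multD(2)[OF assms(2)] by blast
  have s': "attainable (m y x) (f y x + s)"
  proof -
    have "f y x + s = - (f x y - s)" using f(1)[rule_format, of y x] by linarith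
    then show ?thesis using s(2) multD(1)[OF assms(2), of x y] attainable_minus by metis
  qed
  define D :: "'a \<Rightarrow> 'a \<Rightarrow> int" where
    "D u v = of_bool (u = x \<and> v = y) - of_bool (u = y \<and> v = x)" for u v
  define g where "g u v = f u v - s * D u v" for u v
  have D: "D v u = - D u v" for u v by (simp add: D_def conj_commute)
  have "g v u = - g u v" for u v
  proof -
    have "s * D v u = - (s * D u v)" by (simp add: D[of v u])
    then show ?thesis using f(1)[rule_format, of v u] unfolding g_def by linarith
  qed
  moreover have "attainable (m u v) (g u v)" if "u \<in> V" "v \<in> V" for u v
    using f(2)[rule_format, OF that] s s' assms(5) by (auto simp: g_def D_def edge_def)
  moreover have "3 dvd ((\<Sum>v\<in>V. g u v) - (b u - s * arc x y u))" if "u \<in> V" for u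
  proof -
    have "(\<Sum>v\<in>V. g u v) = (\<Sum>v\<in>V. f u v) - s * arc x y u"
      unfolding g_def D_def using arc_sum[OF assms(1,3,4,5)]
      by (simp add: sum_subtractf sum_distrib_left[symmetric])
    then show ?thesis using f(3) that by (simp add: algebra_simps)
  qed
  ultimately have "orientable V m (\<lambda>v. b v - s * arc x y v)" by (rule orientableI)
  then show ?thesis using s(1) by blast
qed

lemma orientable_add_vertex:
  assumes "finite V" "x \<notin> V" "mult m"
    and sol: "orientable V m (\<lambda>v. b v - g v)"
    and g: "\<And>v. v \<in> V \<Longrightarrow> attainable (m v x) (g v)" "3 dvd (sum g V + b x)"
  shows "orientable (insert x V) m b"
proof -
  obtain f where f: "\<forall>u v. f v u = - f u v" "\<forall>u\<in>V. \<forall>v\<in>V. attainable (m u v) (f u v)"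
    "\<forall>u\<in>V. 3 dvd ((\<Sum>v\<in>V. f u v) - (b u - g u))"
    using sol unfolding orientable_def by blast
  define h where "h u v = (if u = x then (if v = x then 0 else - g v) else if v
      = x then g u else f u v)" for u v
  have "h v u = - h u v" for u v
    by (cases "u = x"; cases "v = x") (simp_all add: h_def f(1)[rule_format, of v u])
  moreover have "attainable (m u v) (h u v)" if "u \<in> insert x V" "v \<in> insert x V" for u v
    using that f(2) g(1) multD(1)[OF assms(3), of x] multD(3)[OF assms(3)]
    by (auto simp: h_def)
  moreover have "3 dvd ((\<Sum>v\<in>insert x V. h u v) - b u)" if "u \<in> insert x V" for u
  proof (cases "u = x")
    case True
    have "(\<Sum>v\<in>V. h x v) = (\<Sum>v\<in>V. - g v)" using assms(2) by (intro sum.cong) (auto simp: h_def)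
    then have "(\<Sum>v\<in>insert x V. h u v) - b u = - (sum g V + b x)"
      using True assms by (simp add: h_def sum_negf)
    then show ?thesis using g(2) by (metis dvd_minus_iff)
  next
    case False
    then have u: "u \<in> V" using that by simp
    have "(\<Sum>v\<in>V. h u v) = (\<Sum>v\<in>V. f u v)" using assms(2) False by (intro sum.cong) (auto simp: h_def)
    then have "(\<Sum>v\<in>insert x V. h u v) - b u = (\<Sum>v\<in>V. f u v) - (b u - g u)"
      using False assms by (simp add: h_def)
    then show ?thesis using f(3) u by metis
  qed
  ultimately show ?thesis by (rule orientableI)
qed

definition contract_mult :: "'v set \<Rightarrow> 'v \<Rightarrow> ('v \<Rightarrow> 'v \<Rightarrow> int) \<Rightarrow> 'v \<Rightarrow> 'v \<Rightarrow> int" where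
  "contract_mult A a m u v = (if u = a then (if v = a then 0 else \<Sum>x\<in>A. m x v)
     else if v = a then (\<Sum>x\<in>A. m u x) else m u v)"

definition contract_sum :: "'v set \<Rightarrow> 'v \<Rightarrow> ('v \<Rightarrow> int) \<Rightarrow> 'v \<Rightarrow> int" where
  "contract_sum A a b u = (if u = a then sum b A else b u)"

lemma mult_contract: "mult m \<Longrightarrow> mult (contract_mult A a m)"
  unfolding mult_def contract_mult_def by (auto intro: sum_nonneg sum.cong)

text \<open>
  After the contraction of \<open>A\<close> the edges between \<open>A\<close> and \<open>B\<close> are oriented
  in accordance with the quotient. How a bundle at the contracted vertex is shared among the
  vertices of \<open>A\<close> is not under control, and therefore the orientation inside
  \<open>A\<close> has to exist for all ways \<open>g\<close> of sharing that leave a balanced prescription.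
\<close>

lemma orientable_contract:
  assumes fin: "finite A" "finite B" and disj: "A \<inter> B = {}" and a: "a \<in> A" and m: "mult m"
    and quot: "orientable (insert a B) (contract_mult A a m) (contract_sum A a b)"
    and inner: "\<And>g. (\<And>x y. x \<in> A \<Longrightarrow> y \<in> B \<Longrightarrow> attainable (m x y) (g x y)) \<Longrightarrow>
        3 dvd (\<Sum>x\<in>A. b x - (\<Sum>y\<in>B. g x y)) \<Longrightarrow> orientable A m (\<lambda>x. b x - (\<Sum>y\<in>B. g x y))"
  shows "orientable (A \<union> B) m b"
proof -
  have aB: "a \<notin> B" using disj a by auto
  obtain f where f: "\<forall>u v. f v u = - f u v"
    "\<forall>u\<in>insert a B. \<forall>v\<in>insert a B. attainable (contract_mult A a m u v) (f u v)"
    "\<forall>u\<in>insert a B. 3 dvd ((\<Sum>v\<in>insert a B. f u v) - contract_sum A a b u)"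
    using quot unfolding orientable_def by blast
  have faa: "f a a = 0" using f(1)[rule_format, of a a] by simp
  have "\<exists>g. (\<forall>x\<in>A. attainable (m x y) (g x)) \<and> 3 dvd (sum g A - f a y)" if "y \<in> B" for y
  proof (rule attainable_sum_split[OF fin(1)])
    show "attainable (\<Sum>x\<in>A. m x y) (f a y)"
      using f(2)[rule_format, of a y] that aB by (auto simp: contract_mult_def split: if_splits)
  qed (simp add: multD[OF m])
  then obtain g' where g': "\<And>y. y \<in> B \<Longrightarrow> (\<forall>x\<in>A. attainable (m x y) (g' y x)) \<and>
      3 dvd (sum (g' y) A - f a y)"
    by metis
  define g where "g x y = g' y x" for x y
  have g: "\<And>x y. x \<in> A \<Longrightarrow> y \<in> B \<Longrightarrow> attainable (m x y) (g x y)"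
    "\<And>y. y \<in> B \<Longrightarrow> 3 dvd ((\<Sum>x\<in>A. g x y) - f a y)"
    using g' by (auto simp: g_def)
  have "3 dvd (\<Sum>y\<in>B. (\<Sum>x\<in>A. g x y) - f a y)" using g(2) by (rule dvd_sum)
  then have d1: "3 dvd ((\<Sum>x\<in>A. \<Sum>y\<in>B. g x y) - (\<Sum>y\<in>B. f a y))"
    by (simp add: sum_subtractf sum.swap[of g B A])
  have d2: "3 dvd ((\<Sum>y\<in>B. f a y) - sum b A)"
    using f(3)[rule_format, of a] aB fin faa by (simp add: contract_sum_def)
  have "(\<Sum>x\<in>A. b x - (\<Sum>y\<in>B. g x y)) =
     - (((\<Sum>x\<in>A. \<Sum>y\<in>B. g x y) - (\<Sum>y\<in>B. f a y)) + ((\<Sum>y\<in>B. f a y) - sum b A))"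
    by (simp add: sum_subtractf)
  also have "3 dvd \<dots>" using d1 d2 by (metis dvd_add dvd_minus_iff)
  finally have "orientable A m (\<lambda>x. b x - (\<Sum>y\<in>B. g x y))" using inner g(1) by blast
  then obtain h where h: "\<forall>u v. h v u = - h u v" "\<forall>u\<in>A. \<forall>v\<in>A. attainable (m u v) (h u v)"
    "\<forall>u\<in>A. 3 dvd ((\<Sum>v\<in>A. h u v) - (b u - (\<Sum>y\<in>B. g u y)))"
    unfolding orientable_def by blast
  define F where "F u v = (if u \<in> A then (if v \<in> A then h u v else g u v)
     else if v \<in> A then - g v u else f u v)" for u v
  have "F v u = - F u v" for u v
    by (cases "u \<in> A"; cases "v \<in> A")
      (simp_all add: F_def f(1)[rule_format, of v u] h(1)[rule_format, of v u])
  moreover have "attainable (m u v) (F u v)" if "u \<in> A \<union> B" "v \<in> A \<union> B" for u v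
  proof -
    have "attainable (m u v) (f u v)" if "u \<in> B" "v \<in> B"
      using f(2)[rule_format, of u v] that aB by (auto simp: contract_mult_def split: if_splits)
    moreover have "attainable (m u v) (g v u)" if "u \<in> B" "v \<in> A"
      using g(1)[of v u] that multD(1)[OF m, of u v] by simp
    ultimately show ?thesis
      using that disj h(2) g(1) by (cases "u \<in> A"; cases "v \<in> A") (auto simp: F_def)
  qed
  moreover have "3 dvd ((\<Sum>v\<in>A\<union>B. F u v) - b u)" if "u \<in> A \<union> B" for u
  proof (cases "u \<in> A")
    case True
    have "(\<Sum>v\<in>A. F u v) = (\<Sum>v\<in>A. h u v)" "(\<Sum>v\<in>B. F u v) = (\<Sum>v\<in>B. g u v)"
      using True disj by (auto simp: F_def intro!: sum.cong)
    then have "(\<Sum>v\<in>A\<union>B. F u v) = (\<Sum>v\<in>A. h u v) + (\<Sum>v\<in>B. g u v)"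
      using fin disj by (simp add: sum.union_disjoint)
    then show ?thesis using h(3) True by (simp add: algebra_simps)
  next
    case False
    then have u: "u \<in> B" using that by simp
    have "(\<Sum>v\<in>A. F u v) = (\<Sum>v\<in>A. - g v u)" "(\<Sum>v\<in>B. F u v) = (\<Sum>v\<in>B. f u v)"
      using False disj by (auto simp: F_def intro!: sum.cong)
    then have eq: "(\<Sum>v\<in>A\<union>B. F u v) = - (\<Sum>v\<in>A. g v u) + (\<Sum>v\<in>B. f u v)"
      using fin disj by (simp add: sum.union_disjoint sum_negf)
    have "3 dvd ((\<Sum>v\<in>A. g v u) - f a u)" using g(2) u by simp
    moreover have "3 dvd (f u a + (\<Sum>v\<in>B. f u v) - b u)"
      using f(3)[rule_format, of u] u aB fin by (auto simp: contract_sum_def split: if_splits)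
    moreover have "f u a = - f a u" using f(1) by blast
    ultimately show ?thesis unfolding eq by presburger
  qed
  ultimately show ?thesis by (rule orientableI)
qed

lemma orientable_empty_or_single:
  assumes "V \<subseteq> {x}" "mult m" "3 dvd sum b V"
  shows "orientable V m b"
proof -
  have "V = {} \<or> V = {x}" using assms by auto
  then show ?thesis
    unfolding orientable_def using assms(2,3)
        by (intro exI[of _ "\<lambda>_ _. 0"]) (auto simp: attainable_def mult_def)
qed

lemma orientable_pair:
  assumes "x \<noteq> y" "mult m" "2 \<le> m x y" "3 dvd (b x + b y)"
  shows "orientable {x, y} m b"
proof (rule orientable_add_vertex[of "{y}" x m b "\<lambda>_. - b x"])
  show "orientable {y} m (\<lambda>v. b v - - b x)"
    by (rule orientable_empty_or_single[of _ y]) (use assms in \<open>auto simp: add.commute\<close>)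
qed (use assms multD(1)[OF assms(2), of x y] in \<open>auto intro: attainable_ge2\<close>)

lemma cut_compl:
  assumes "mult m" "A \<subseteq> V"
  shows "cut V m (V - A) = cut V m A"
proof -
  have "V - (V - A) = A" using assms(2) by auto
  then have "cut V m (V - A) = (\<Sum>u\<in>V-A. \<Sum>v\<in>A. m u v)" by (simp add: cut_def)
  also have "\<dots> = (\<Sum>v\<in>A. \<Sum>u\<in>V-A. m u v)" by (rule sum.swap)
  also have "\<dots> = cut V m A" unfolding cut_def by (intro sum.cong refl multD(1)[OF assms(1)])
  finally show ?thesis .
qed

lemma cut_contract:
  assumes fin: "finite A" "finite B" and disj: "A \<inter> B = {}" and a: "a \<in> A" and m: "mult m"
    and C: "C \<subseteq> insert a B"
  shows "cut (insert a B) (contract_mult A a m) C = cut (A \<union> B) m (if a \<in> C then A \<union> C else C)"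
proof -
  have aB: "a \<notin> B" using disj a by auto
  have *: "cut (insert a B) (contract_mult A a m) D = cut (A \<union> B) m D" if D: "D \<subseteq> B" for D
    unfolding cut_def
  proof (rule sum.cong[OF refl])
    fix u assume u: "u \<in> D"
    have eq: "insert a B - D = insert a (B - D)" "A \<union> B - D = A \<union> (B - D)" using D aB disj by auto
    have "(\<Sum>v\<in>B - D. contract_mult A a m u v) = (\<Sum>v\<in>B - D. m u v)"
      using u D aB by (intro sum.cong) (auto simp: contract_mult_def)
    then show "(\<Sum>v\<in>insert a B - D. contract_mult A a m u v) = (\<Sum>v\<in>A \<union> B - D. m u v)"
      unfolding eq using fin aB disj u D
      by (subst sum.union_disjoint) (auto simp: contract_mult_def)
  qed
  show ?thesis
  proof (cases "a \<in> C")
    case False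
    then show ?thesis using * C by auto
  next
    case True
    have eq: "insert a B - C \<subseteq> B" "A \<union> B - (insert a B - C) = A \<union> C" using True C disj a by auto
    have "cut (insert a B) (contract_mult A a m) C
        = cut (insert a B) (contract_mult A a m) (insert a B - C)"
      using cut_compl[OF mult_contract[OF m] C] by simp
    also have "\<dots> = cut (A \<union> B) m (insert a B - C)" using * eq by simp
    also have "\<dots> = cut (A \<union> B) m (A \<union> B - (insert a B - C))"
      using cut_compl[OF m, of "insert a B - C" "A \<union> B"] eq(1) by (simp add: le_supI2)
    finally show ?thesis using True eq by simp
  qed
qed

lemma sum_contract:
  assumes "finite A" "finite B" "A \<inter> B = {}" "a \<in> A" "C \<subseteq> insert a B"
  shows "sum (contract_sum A a b) C = sum b (if a \<in> C then A \<union> C else C)"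
proof (cases "a \<in> C")
  case False
  then show ?thesis by (auto simp: contract_sum_def intro!: sum.cong)
next
  case True
  then have eq: "C = insert a (C - {a})" by auto
  have d: "A \<inter> (C - {a}) = {}" and u: "A \<union> C = A \<union> (C - {a})" using assms by auto
  have f: "finite C" using assms finite_subset by blast
  have "sum (contract_sum A a b) C = sum b A + sum (contract_sum A a b) (C - {a})"
    using f True by (simp add: sum.remove[of C a] contract_sum_def)
  also have "sum (contract_sum A a b) (C - {a}) = sum b (C - {a})"
    by (intro sum.cong) (auto simp: contract_sum_def)
  also have "sum b A + sum b (C - {a}) = sum b (A \<union> C)"
    unfolding u using assms f d by (simp add: sum.union_disjoint)
  finally show ?thesis using True by simp
qed

section \<open>Extending an orientation at a root: the theorem of Lovasz, Thomassen, Wu and Zhang\<close>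

text \<open>
  Let \<tau> be a number of least absolute value with \<tau> \<equiv> d (mod 2) and
  \<tau> \<equiv> b (mod 3). The condition on a cut with \<open>d\<close> edges and demand \<open>b\<close>
  in the theorem is d \<ge> 4 + |\<tau>|, and this unfolds to the three cases below. A root vertex
  must satisfy d \<le> 4 + |\<tau>|; by parity this is the negation of the condition for
  \<open>d - 2\<close>.
\<close>

definition sufficient :: "int \<Rightarrow> int \<Rightarrow> bool" where
  "sufficient d b \<longleftrightarrow> 6 \<le> d \<or> d = 5 \<and> \<not> 3 dvd b \<or> d = 4 \<and> 3 dvd b"

lemma sufficient_cong: "3 dvd (b - b') \<Longrightarrow> sufficient d b = sufficient d b'"
  unfolding sufficient_def by presburger

lemma sufficient_minus [simp]: "sufficient d (- b) = sufficient d b"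
  unfolding sufficient_def by presburger

lemma cut_add: "cut V (\<lambda>u v. m u v + m' u v) A = cut V m A + cut V m' A"
  by (simp add: cut_def sum.distrib)

lemma cut_diff: "cut V (\<lambda>u v. m u v - m' u v) A = cut V m A - cut V m' A"
  by (simp add: cut_def sum_subtractf)

lemma sum_of_bool_eq:
  assumes "finite A"
  shows "(\<Sum>u\<in>A. of_bool (u = x)) = (of_bool (x \<in> A) :: int)"
  using assms by (auto simp: of_bool_def)

lemma sum_arc: "finite A \<Longrightarrow> sum (arc x y) A = of_bool (x \<in> A) - of_bool (y \<in> A)"
  by (simp add: arc_def sum_subtractf sum_of_bool_eq)

lemma edge_sum:
  assumes "finite B" "x \<noteq> y"
  shows "(\<Sum>v\<in>B. edge x y u v) = of_bool (u = x \<and> y \<in> B) + of_bool (u = y \<and> x \<in> B)"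
proof -
  have "edge x y u v = of_bool (u = x) * of_bool (v = y) + of_bool (u = y) * of_bool (v = x)" for v
    using assms(2) by (auto simp: edge_def)
  then show ?thesis
    using assms(1) by (simp add: sum.distrib sum_distrib_left[symmetric] sum_of_bool_eq of_bool_conj)
qed

lemma edge_sum2:
  assumes "finite A" "finite B" "x \<noteq> y"
  shows "(\<Sum>u\<in>A. \<Sum>v\<in>B. edge x y u v) = of_bool (x \<in> A \<and> y \<in> B) + of_bool (y \<in> A \<and> x \<in> B)"
  using assms
  by (simp add: edge_sum sum.distrib of_bool_conj sum_distrib_right[symmetric] sum_of_bool_eq)

lemma cut_edge:
  assumes "finite V" "A \<subseteq> V" "x \<in> V" "y \<in> V" "x \<noteq> y"
  shows "cut V (edge x y) A = of_bool ((x \<in> A) \<noteq> (y \<in> A))"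
  unfolding cut_def using assms finite_subset[OF assms(2,1)] by (auto simp: edge_sum2)

lemma cut_nonneg: "mult m \<Longrightarrow> 0 \<le> cut V m A"
  unfolding cut_def by (intro sum_nonneg) (auto simp: multD)

text \<open>
  The root lies outside \<open>V\<close>: \<open>k x\<close> is the number of edges between \<open>x\<close> and
  the root, and \<open>c x\<close> is the net flow that these oriented edges take from \<open>x\<close> to
  the root. Thus the edges within \<open>V\<close> have to provide \<open>\<beta> x - c x\<close>, while
  degrees and cuts count the root edges as well.
\<close>

definition extension_data :: "'v set \<Rightarrow> ('v \<Rightarrow> 'v \<Rightarrow> int) \<Rightarrow> ('v \<Rightarrow> int) \<Rightarrow> ('v \<Rightarrow> int) \<Rightarrow> ('v \<Rightarrow> int) \<Rightarrow>
    bool" where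
  "extension_data V m k c \<beta> \<longleftrightarrow> finite V \<and> mult m \<and> (\<forall>x. 0 \<le> k x) \<and> (\<forall>x\<in>V. attainable (k x) (c x)) \<and>
     3 dvd (sum \<beta> V - sum c V) \<and> \<not> sufficient (sum k V - 2) (sum \<beta> V) \<and>
     (\<forall>A. A \<subseteq> V \<longrightarrow> A \<noteq> {} \<longrightarrow> A \<noteq> V \<longrightarrow> sufficient (cut V m A + sum k A) (sum \<beta> A))"

text \<open>
  The number of vertices plus the sum of their degrees, root edges included. A root edge counts once
  and an edge within \<open>V\<close> twice, so replacing an edge within \<open>V\<close> by one root edge is
  a decrease; the last step of the induction needs this.
\<close>

definition weight :: "'v set \<Rightarrow> ('v \<Rightarrow> 'v \<Rightarrow> int) \<Rightarrow> ('v \<Rightarrow> int) \<Rightarrow> int" where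
  "weight V m k = (\<Sum>x\<in>V. 1 + k x + (\<Sum>v\<in>V. m x v))"

lemma weight_eq: "weight V m k = int (card V) + sum k V + (\<Sum>x\<in>V. \<Sum>v\<in>V. m x v)"
  by (simp add: weight_def sum.distrib)

lemma weight_nonneg: "extension_data V m k c \<beta> \<Longrightarrow> 0 \<le> weight V m k"
  unfolding weight_def extension_data_def by (intro sum_nonneg add_nonneg_nonneg) (auto simp: multD)

lemma cut_vertex_removed:
  assumes finV: "finite V" and m: "mult m" and x: "x \<in> V" and A: "A \<subseteq> V - {x}"
  shows "cut V m A = cut (V - {x}) m A + (\<Sum>u\<in>A. m x u)"
proof -
  have "(\<Sum>v\<in>V - A. m u v) = (\<Sum>v\<in>V - {x} - A. m u v) + m x u" for u
  proof -
    have "V - A = insert x (V - {x} - A)" using x A by auto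
    then show ?thesis using finV multD(1)[OF m, of u x] by (simp add: add.commute)
  qed
  then show ?thesis by (simp add: cut_def sum.distrib)
qed

lemma cut_vertex_added:
  assumes finV: "finite V" and x: "x \<in> V" and A: "A \<subseteq> V - {x}"
  shows "cut V m (insert x A) = cut (V - {x}) m A + (\<Sum>u\<in>V - {x} - A. m x u)"
proof -
  have fA: "finite A" "x \<notin> A" using finite_subset[OF A] finV A by auto
  have "V - insert x A = V - {x} - A" using A by auto
  then show ?thesis using fA by (simp add: cut_def add.commute)
qed

lemma sum_vertex_removed:
  assumes finV: "finite V" and m: "mult m" and x: "x \<in> V"
  shows "(\<Sum>u\<in>V. \<Sum>v\<in>V. m u v)
    = (\<Sum>u\<in>V-{x}. \<Sum>v\<in>V-{x}. m u v) + 2 * (\<Sum>v\<in>V-{x}. m x v)"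
proof -
  have "(\<Sum>v\<in>V. m u v) = m x u + (\<Sum>v\<in>V-{x}. m u v)" for u
    using sum.remove[OF finV x, of "m u"] multD(1)[OF m, of u x] by simp
  then show ?thesis
    using sum.remove[OF finV x, of "\<lambda>u. \<Sum>v\<in>V. m u v"] multD(3)[OF m, of x]
    by (simp add: sum.distrib)
qed

lemma weight_contract_less:
  assumes fin: "finite A" "finite B" and disj: "A \<inter> B = {}" and m: "mult m" and a: "a \<in> A"
    and A: "2 \<le> card A"
  shows "weight (insert a B) (contract_mult A a m) (contract_sum A a k) < weight (A \<union> B) m k"
proof -
  define V where "V = A \<union> B"
  have aB: "a \<notin> B" and V: "V = A \<union> B" and finV: "finite V" using a disj fin by (auto simp: V_def)
  have 1: "(\<Sum>v\<in>insert a B. contract_mult A a m a v) = (\<Sum>x\<in>A. \<Sum>v\<in>B. m x v)"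
    using fin aB by (simp add: contract_mult_def sum.swap[of m B A] cong: if_cong) (auto intro!:
        sum.cong)
  have 2: "(\<Sum>v\<in>insert a B. contract_mult A a m x v) = (\<Sum>v\<in>V. m x v)" if "x \<in> B" for x
  proof -
    have "(\<Sum>v\<in>B. contract_mult A a m x v) = (\<Sum>v\<in>B. m x v)"
      using aB that by (intro sum.cong) (auto simp: contract_mult_def)
    then show ?thesis using fin aB that disj V
      by (auto simp: contract_mult_def sum.union_disjoint)
  qed
  have 3: "weight (insert a B) (contract_mult A a m) (contract_sum A a k)
    = 1 + sum k A + (\<Sum>x\<in>A. \<Sum>v\<in>B. m x v) + (\<Sum>x\<in>B. 1 + k x + (\<Sum>v\<in>V. m x v))"
  proof -
    have "(\<Sum>x\<in>B. 1 + contract_sum A a k x + (\<Sum>v\<in>insert a B. contract_mult A a m x v))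
      = (\<Sum>x\<in>B. 1 + k x + (\<Sum>v\<in>V. m x v))"
      using 2 aB by (intro sum.cong) (auto simp: contract_sum_def)
    then have "weight (insert a B) (contract_mult A a m) (contract_sum A a k)
      = (1 + contract_sum A a k a + (\<Sum>v\<in>insert a B. contract_mult A a m a v)) + (\<Sum>x\<in>B. 1 + k x +
          (\<Sum>v\<in>V. m x v))"
      unfolding weight_def using sum.insert[OF fin(2) aB] by metis
    then show ?thesis unfolding 1 by (simp add: contract_sum_def)
  qed
  have 4: "weight V m k = (\<Sum>x\<in>A. 1 + k x + (\<Sum>v\<in>V. m x v)) + (\<Sum>x\<in>B. 1 + k x + (\<Sum>v\<in>V. m x v))"
    unfolding weight_def by (subst (1) V) (simp add: sum.union_disjoint fin disj)
  have 5: "(\<Sum>v\<in>B. m x v) \<le> (\<Sum>v\<in>V. m x v)" for x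
    by (rule sum_mono2) (use finV V multD(2)[OF m] in auto)
  have "(\<Sum>x\<in>A. 1 + k x + (\<Sum>v\<in>B. m x v)) \<le> (\<Sum>x\<in>A. 1 + k x + (\<Sum>v\<in>V. m x v))"
    by (intro sum_mono add_left_mono 5)
  moreover have "(\<Sum>x\<in>A. 1 + k x + (\<Sum>v\<in>B. m x v)) = int (card A) + sum k A + (\<Sum>x\<in>A. \<Sum>v\<in>B. m x v)"
    by (simp add: sum.distrib)
  ultimately show ?thesis using 3 4 A unfolding V_def by linarith
qed

locale minimal_unextendable =
  fixes V :: "'v set" and m :: "'v \<Rightarrow> 'v \<Rightarrow> int" and k c \<beta> :: "'v \<Rightarrow> int"
  assumes I: "extension_data V m k c \<beta>"
    and IH: "\<And>(V' :: 'v set) m' k' c' \<beta>'. extension_data V' m' k' c' \<beta>' \<Longrightarrow>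
        weight V' m' k' < weight V m k \<Longrightarrow>
      orientable V' m' (\<lambda>x. \<beta>' x - c' x)"
    and cex: "\<not> orientable V m (\<lambda>x. \<beta> x - c x)"
begin

abbreviation d :: "'v set \<Rightarrow> int" where "d A \<equiv> cut V m A + sum k A"

lemma finV: "finite V" and m: "mult m" and k0: "0 \<le> k x" and attc: "x \<in> V \<Longrightarrow> attainable (k x) (c x)"
  and bal: "3 dvd (sum \<beta> V - sum c V)" and weakV: "\<not> sufficient (sum k V - 2) (sum \<beta> V)"
  and okA: "A \<subseteq> V \<Longrightarrow> A \<noteq> {} \<Longrightarrow> A \<noteq> V \<Longrightarrow> sufficient (d A) (sum \<beta> A)"
  using I unfolding extension_data_def by blast+

lemma finA: "A \<subseteq> V \<Longrightarrow> finite A" using finV finite_subset by blast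

lemma card_V: "2 \<le> card V"
proof (rule ccontr)
  assume "\<not> 2 \<le> card V"
  then have "card V = 0 \<or> card V = 1" by linarith
  then have "V = {} \<or> (\<exists>x. V = {x})" using finV by (auto simp: card_1_singleton_iff)
  then obtain x where "V \<subseteq> {x}" by blast
  then show False
    using orientable_empty_or_single[of V x m "\<lambda>x. \<beta> x - c x"] m bal cex by (simp add: sum_subtractf)
qed

lemma card_ge2: "A \<subseteq> V \<Longrightarrow> x \<in> A \<Longrightarrow> A \<noteq> {x} \<Longrightarrow> 2 \<le> card A"
proof -
  assume a: "A \<subseteq> V" "x \<in> A" "A \<noteq> {x}"
  then obtain y where y: "y \<in> A" "y \<noteq> x" by blast
  have "card {x, y} \<le> card A" using a y by (intro card_mono finA) auto
  then show ?thesis using y by simp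
qed

text \<open>
  Contraction preserves all cuts that survive, hence the hypotheses, and lowers the weight.
\<close>

lemma quotient_orientable:
  assumes A: "A \<subseteq> V" "2 \<le> card A" and a: "a \<in> A"
  shows "orientable (insert a (V - A)) (contract_mult A a m) (contract_sum A a (\<lambda>x. \<beta> x - c x))"
proof -
  define B where "B = V - A"
  have fin: "finite A" "finite B" and disj: "A \<inter> B = {}" and V: "V = A \<union> B" and aB: "a \<notin> B"
    using finA finV A a by (auto simp: B_def)
  note sc = sum_contract[OF fin disj a]
  have full: "insert a B \<subseteq> insert a B" "A \<union> insert a B = V" using V a by auto
  have "extension_data (insert a B) (contract_mult A a m) (contract_sum A a k) (contract_sum A a c)
      (contract_sum A a \<beta>)"
    unfolding extension_data_def
  proof (intro conjI allI ballI impI)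
    show "0 \<le> contract_sum A a k x" for x by (auto simp: contract_sum_def k0 intro: sum_nonneg)
    show "attainable (contract_sum A a k x) (contract_sum A a c x)" if "x \<in> insert a B" for x
      using that V attc fin k0 by (auto simp: contract_sum_def intro!: attainable_sum)
    show "3 dvd sum (contract_sum A a \<beta>) (insert a B) - sum (contract_sum A a c) (insert a B)"
      using sc[OF full(1)] full(2) bal by simp
    show "\<not> sufficient (sum (contract_sum A a k) (insert a B) - 2) (sum (contract_sum A a \<beta>) (insert
        a B))"
      using sc[OF full(1)] full(2) weakV by simp
    fix C assume C: "C \<subseteq> insert a B" "C \<noteq> {}" "C \<noteq> insert a B"
    define D where "D = (if a \<in> C then A \<union> C else C)"
    have "sufficient (d D) (sum \<beta> D)"
      by (rule okA) (use C V a aB disj in \<open>auto simp: D_def\<close>)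
    then show "sufficient (cut (insert a B) (contract_mult A a m) C + sum (contract_sum A a k) C)
        (sum (contract_sum A a \<beta>) C)"
      using sc[OF C(1)] cut_contract[OF fin disj a m C(1)] V unfolding D_def by simp
  qed (use fin mult_contract[OF m] in auto)
  moreover have "weight (insert a B) (contract_mult A a m) (contract_sum A a k) < weight V m k"
    unfolding V by (rule weight_contract_less[OF fin disj m a A(2)])
  ultimately have "orientable (insert a B) (contract_mult A a m) (\<lambda>x. contract_sum A a \<beta> x -
      contract_sum A a c x)" by (rule IH)
  moreover have "(\<lambda>x. contract_sum A a \<beta> x - contract_sum A a c x) = contract_sum A a (\<lambda>x. \<beta> x - c x)"
    by (rule ext) (simp add: contract_sum_def sum_subtractf)
  ultimately show ?thesis by (simp add: B_def)
qed

text \<open>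
  A cut around \<open>A\<close> that fails the condition for two edges fewer is small enough for the
  contracted outside of \<open>A\<close> to serve as a root.
\<close>

lemma inner_orientable:
  assumes A: "A \<subseteq> V" "A \<noteq> V" and weak: "\<not> sufficient (d A - 2) (sum \<beta> A)"
    and g: "\<And>x y. x \<in> A \<Longrightarrow> y \<in> V - A \<Longrightarrow> attainable (m x y) (g x y)"
      "3 dvd (\<Sum>x\<in>A. (\<beta> x - c x) - (\<Sum>y\<in>V-A. g x y))"
  shows "orientable A m (\<lambda>x. (\<beta> x - c x) - (\<Sum>y\<in>V-A. g x y))"
proof -
  define B where "B = V - A"
  have fin: "finite A" "finite B" and disj: "A \<inter> B = {}" and V: "V = A \<union> B"
    using finA finV A by (auto simp: B_def)
  define k' where "k' x = k x + (\<Sum>y\<in>B. m x y)" for x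
  define c' where "c' x = c x + (\<Sum>y\<in>B. g x y)" for x
  have sk: "cut A m C + sum k' C = d C" if "C \<subseteq> A" for C
  proof -
    have "(\<Sum>v\<in>V - C. m u v) = (\<Sum>v\<in>A - C. m u v) + (\<Sum>v\<in>B. m u v)" for u
    proof -
      have "V - C = (A - C) \<union> B" using that V disj by auto
      moreover have "(A - C) \<inter> B = {}" using disj by auto
      ultimately show ?thesis using fin by (simp add: sum.union_disjoint)
    qed
    then show ?thesis by (simp add: cut_def k'_def sum.distrib)
  qed
  have "extension_data A m k' c' \<beta>"
    unfolding extension_data_def
  proof (intro conjI allI ballI impI)
    show "0 \<le> k' x" for x by (auto simp: k'_def k0 multD[OF m] intro!: add_nonneg_nonneg sum_nonneg)
    show "attainable (k' x) (c' x)" if "x \<in> A" for x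
      unfolding k'_def c'_def using that V g(1) attc
      by (intro attainable_plus attainable_sum fin k0 sum_nonneg multD[OF m]) (auto simp: B_def)
    show "3 dvd sum \<beta> A - sum c' A"
      using g(2) by (simp add: c'_def sum_subtractf sum.distrib B_def algebra_simps)
    have "sum k' A = d A" using sk[of A] by (simp add: cut_def)
    then show "\<not> sufficient (sum k' A - 2) (sum \<beta> A)" using weak by simp
    show "sufficient (cut A m C + sum k' C) (sum \<beta> C)" if "C \<subseteq> A" "C \<noteq> {}" "C \<noteq> A" for C
      using okA[of C] that A sk by auto
  qed (use fin m in auto)
  moreover have "weight A m k' < weight V m k"
  proof -
    have 1: "k' x + (\<Sum>v\<in>A. m x v) = k x + (\<Sum>v\<in>V. m x v)" for x
      unfolding V k'_def using fin disj by (simp add: sum.union_disjoint)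
    have "B \<noteq> {}" using A by (auto simp: B_def)
    then have "0 < (\<Sum>x\<in>B. 1 + k x + (\<Sum>v\<in>V. m x v))"
      using fin by (intro sum_pos) (auto intro!: add_pos_nonneg k0 sum_nonneg multD[OF m])
    moreover have "weight V m k = (\<Sum>x\<in>A. 1 + k x + (\<Sum>v\<in>V. m x v)) + (\<Sum>x\<in>B. 1 + k x + (\<Sum>v\<in>V. m x v))"
      unfolding weight_def by (subst (1) V) (simp add: sum.union_disjoint fin disj)
    moreover have "weight A m k' = (\<Sum>x\<in>A. 1 + k x + (\<Sum>v\<in>V. m x v))"
      unfolding weight_def by (intro sum.cong refl) (use 1 in \<open>simp add: add.assoc\<close>)
    ultimately show ?thesis by linarith
  qed
  ultimately have "orientable A m (\<lambda>x. \<beta> x - c' x)" by (rule IH)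
  then show ?thesis by (simp add: c'_def B_def diff_diff_eq)
qed

lemma proper_cut_slack:
  assumes A: "A \<subseteq> V" "A \<noteq> V" "2 \<le> card A"
  shows "sufficient (d A - 2) (sum \<beta> A)"
proof (rule ccontr)
  assume weak: "\<not> sufficient (d A - 2) (sum \<beta> A)"
  obtain a where a: "a \<in> A" using A(3) by fastforce
  have "orientable (A \<union> (V - A)) m (\<lambda>x. \<beta> x - c x)"
    by (rule orientable_contract[OF _ _ _ a m quotient_orientable[OF A(1,3) a] inner_orientable[OF
        A(1,2) weak]])
      (use finA finV A in auto)
  moreover have "A \<union> (V - A) = V" using A by auto
  ultimately show False using cex by simp
qed

text \<open>
  Two parallel edges carry any residue, so a pair joined by them can be contracted.
\<close>

lemma simple:
  assumes "x \<in> V" "y \<in> V" "x \<noteq> y"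
  shows "m x y \<le> 1"
proof (rule ccontr)
  assume "\<not> m x y \<le> 1"
  then have m2: "2 \<le> m x y" by simp
  have A: "{x, y} \<subseteq> V" "2 \<le> card {x, y}" "x \<in> {x, y}" using assms by auto
  have inner: "orientable {x, y} m (\<lambda>u. \<beta> u - c u - (\<Sum>v\<in>V - {x, y}. g u v))"
    if "3 dvd (\<Sum>u\<in>{x, y}. \<beta> u - c u - (\<Sum>v\<in>V - {x, y}. g u v))" for g
    using that assms by (intro orientable_pair m m2) auto
  have "orientable ({x, y} \<union> (V - {x, y})) m (\<lambda>x. \<beta> x - c x)"
    by (rule orientable_contract[OF _ _ _ A(3) m quotient_orientable[OF A] inner]) (use finV in auto)
  moreover have "{x, y} \<union> (V - {x, y}) = V" using assms by auto
  ultimately show False using cex by simp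
qed

definition out_removable :: "'v \<Rightarrow> bool" where "out_removable x \<longleftrightarrow> sufficient (d {x} - 1) (\<beta> x - 1)"
definition in_removable :: "'v \<Rightarrow> bool" where "in_removable x \<longleftrightarrow> sufficient (d {x} - 1) (\<beta> x + 1)"

lemma sufficient_step: "sufficient (e - 2) b \<Longrightarrow> s = 1 \<or> s = -1 \<Longrightarrow> sufficient (e - 1) (b + s)"
  unfolding sufficient_def by presburger

lemma proper_cut_slack_or_single:
  assumes "A \<subseteq> V" "A \<noteq> V" "x \<in> A" "A \<noteq> {x}"
  shows "sufficient (d A - 2) (sum \<beta> A)"
  using proper_cut_slack card_ge2 assms by blast

text \<open>
  If the edge leaving \<open>x\<close> is deleted, the condition at \<open>{x}\<close> is what
  \<open>out_removable\<close> demands, and larger sets have two edges to spare.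
\<close>

lemma out_set:
  assumes "A \<subseteq> V" "A \<noteq> V" "x \<in> A" "out_removable x"
  shows "sufficient (d A - 1) (sum \<beta> A - 1)"
proof (cases "A = {x}")
  case True
  then show ?thesis using assms(4) by (simp add: out_removable_def)
next
  case False
  then show ?thesis using sufficient_step[OF proper_cut_slack_or_single[OF assms(1-3) False], of
      "-1"] by simp
qed

lemma in_set:
  assumes "A \<subseteq> V" "A \<noteq> V" "x \<in> A" "in_removable x"
  shows "sufficient (d A - 1) (sum \<beta> A + 1)"
proof (cases "A = {x}")
  case True
  then show ?thesis using assms(4) by (simp add: in_removable_def)
next
  case False
  then show ?thesis using sufficient_step[OF proper_cut_slack_or_single[OF assms(1-3) False], of
      "1"] by simp
qed

lemma weight_del:
  assumes "x \<in> V" "y \<in> V" "x \<noteq> y"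
  shows "weight V (\<lambda>u v. m u v - edge x y u v) k' = int (card V) + sum k' V + (\<Sum>x\<in>V. \<Sum>v\<in>V. m x v) - 2"
  using assms finV by (simp add: weight_eq sum_subtractf edge_sum2)

text \<open>
  Otherwise the edge could be directed from \<open>x\<close> to \<open>y\<close> and deleted, and the demand
  adjusted.
\<close>

lemma no_deletable_edge:
  assumes xy: "x \<in> V" "y \<in> V" "1 \<le> m x y" and out: "out_removable x" and inn: "in_removable y"
  shows False
proof -
  have ne: "x \<noteq> y" using xy multD(3)[OF m, of x] by auto
  define m' where "m' u v = m u v - edge x y u v" for u v
  define \<beta>' where "\<beta>' v = \<beta> v - arc x y v" for v
  have mm: "mult m'" unfolding m'_def by (rule mult_del[OF m ne xy(3)])
  have sb: "sum \<beta>' A = sum \<beta> A - of_bool (x \<in> A) + of_bool (y \<in> A)" if "A \<subseteq> V" for A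
    using that finA by (simp add: \<beta>'_def sum_subtractf sum_arc)
  have sc: "cut V m' A = cut V m A - of_bool ((x \<in> A) \<noteq> (y \<in> A))" if "A \<subseteq> V" for A
    unfolding m'_def using that cut_edge[OF finV that xy(1,2) ne] by (simp add: cut_diff)
  have "extension_data V m' k c \<beta>'"
    unfolding extension_data_def
  proof (intro conjI allI ballI impI)
    fix A assume A: "A \<subseteq> V" "A \<noteq> {}" "A \<noteq> V"
    show "sufficient (cut V m' A + sum k A) (sum \<beta>' A)"
      using sb[OF A(1)] sc[OF A(1)] okA[OF A] out_set[OF A(1,3) _ out] in_set[OF A(1,3) _ inn]
      by (cases "x \<in> A"; cases "y \<in> A") (simp_all add: diff_add_eq)
  qed (use finV mm k0 attc bal weakV sb[of V] xy in auto)
  moreover have "weight V m' k < weight V m k"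
    using weight_del[OF xy(1,2) ne, of k] by (simp add: m'_def weight_eq)
  ultimately have "orientable V m' (\<lambda>v. \<beta>' v - c v)" by (rule IH)
  then have "orientable V m' (\<lambda>v. (\<beta> v - c v) - 1 * arc x y v)"
    by (simp add: \<beta>'_def algebra_simps)
  from orientable_add_edge[OF finV mm xy(1,2) ne _ this] show False
    using cex by (simp add: m'_def)
qed

text \<open>
  The two sides of a separation would have boundaries consisting of root edges only, at least 4 each,
  but there are at most 7 root edges.
\<close>

lemma connected:
  assumes "A \<subseteq> V" "A \<noteq> {}" "A \<noteq> V"
  shows "\<exists>x\<in>A. \<exists>y\<in>V - A. 1 \<le> m x y"
proof (rule ccontr)
  assume "\<not> ?thesis"
  then have "m x y = 0" if "x \<in> A" "y \<in> V - A" for x y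
    using that multD(2)[OF m, of x y] by force
  then have z: "cut V m A = 0" by (simp add: cut_def)
  then have z': "cut V m (V - A) = 0" using cut_compl[OF m assms(1)] by simp
  have "sum k V = sum k A + sum k (V - A)" using sum.subset_diff[OF assms(1) finV, of k] by simp
  then show False
    using okA[OF assms] okA[of "V - A"] assms z z' weakV unfolding sufficient_def by force
qed

lemma sum_edge_W:
  assumes "W \<subseteq> V" "y \<in> W" "z \<in> W" "y \<noteq> z"
  shows "(\<Sum>u\<in>W. \<Sum>v\<in>W. edge y z u v) = 2"
  using assms finA by (simp add: edge_sum2)

lemma split_vertex:
  assumes x: "x \<in> V" and M: "mult m'" and k': "\<And>z. 0 \<le> k' z"
    and att': "\<And>z. z \<in> V - {x} \<Longrightarrow> attainable (k' z) (c' z)"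
    and bal': "3 dvd (sum c V - sum c' (V - {x}))" and sk: "sum k' (V - {x}) = sum k V"
    and bx: "3 dvd \<beta> x"
    and size: "(\<Sum>u\<in>V-{x}. \<Sum>v\<in>V-{x}. m' u v) \<le> (\<Sum>u\<in>V-{x}. \<Sum>v\<in>V-{x}. m u v) + 2 * (\<Sum>v\<in>V-{x}. m x v)"
    and ok: "\<And>A. A \<subseteq> V - {x} \<Longrightarrow> A \<noteq> {} \<Longrightarrow> A \<noteq> V - {x} \<Longrightarrow>
      sufficient (cut (V - {x}) m' A + sum k' A) (sum \<beta> A)"
  shows "orientable (V - {x}) m' (\<lambda>v. \<beta> v - c' v)"
proof -
  have sb: "sum \<beta> V = \<beta> x + sum \<beta> (V - {x})" by (rule sum.remove[OF finV x])
  have d1: "3 dvd (sum \<beta> (V - {x}) - sum \<beta> V)" using sb bx by simp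
  have d2: "3 dvd sum \<beta> (V - {x}) - sum c' (V - {x})" using sb bx bal bal' by presburger
  have "extension_data (V - {x}) m' k' c' \<beta>"
    unfolding extension_data_def
  proof (intro conjI allI ballI impI)
    show "\<not> sufficient (sum k' (V - {x}) - 2) (sum \<beta> (V - {x}))"
      using weakV sk sufficient_cong[OF d1] by simp
  qed (use finV M k' att' d2 ok in auto)
  moreover have "card V = Suc (card (V - {x}))" using finV x by (metis card.remove)
  then have "weight (V - {x}) m' k' < weight V m k"
    unfolding weight_eq sum_vertex_removed[OF finV m x] sk using size by simp
  ultimately show ?thesis by (rule IH)
qed

lemma orientable_join_vertex:
  assumes x: "x \<in> V" and sol: "orientable (V - {x}) m (\<lambda>v. (\<beta> v - c v) - g v)"
    and "\<And>v. v \<in> V - {x} \<Longrightarrow> attainable (m v x) (g v)" "3 dvd (sum g (V - {x}) + (\<beta> x - c x))"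
  shows False
proof -
  have "orientable (insert x (V - {x})) m (\<lambda>x. \<beta> x - c x)"
    by (rule orientable_add_vertex[OF _ _ m sol assms(3,4)]) (use finV in auto)
  then show False using cex x by (simp add: insert_absorb)
qed

text \<open>
  The complement of \<open>x\<close> satisfies the cut condition and the root satisfies the opposite one.
  With three or four edges between \<open>x\<close> and the root these two contradict each other.
\<close>

lemma degree_four_k:
  assumes x: "x \<in> V" and d4: "d {x} = 4" and b0: "3 dvd \<beta> x"
  shows "k x \<le> 2"
proof (rule ccontr)
  assume k3: "\<not> k x \<le> 2"
  have c: "cut V m (V - {x}) = 4 - k x" using d4 cut_compl[OF m, of "{x}" V] x by simp
  have sk: "sum k V = k x + sum k (V - {x})" and sb: "sum \<beta> V = \<beta> x + sum \<beta> (V - {x})"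
    using sum.remove[OF finV x] by blast+
  have "V - {x} \<noteq> {}" using card_V by (auto dest: card_mono[rotated])
  then have "sufficient (d (V - {x})) (sum \<beta> (V - {x}))" using x by (intro okA) auto
  then show False using weakV sk sb c k3 b0 unfolding sufficient_def by simp presburger
qed

text \<open>
  A vertex of degree 4 with demand 0 is replaced by two edges, each standing for a path through it.
  Its neighbours within \<open>V\<close> are distinct, so larger sets lose at most the two edges that
  they have to spare, unless all four neighbours lie in the set; then the boundary becomes that of
  the set together with \<open>x\<close>. A root edge at \<open>x\<close> is always paired with an edge to a
  neighbour, which receives the root edge with its direction.
\<close>

lemma no_degree_four:
  assumes x: "x \<in> V" and d4: "d {x} = 4" and b0: "3 dvd \<beta> x"
  shows False
proof -
  define W where "W = V - {x}"
  define N where "N = {y \<in> W. m x y = 1}"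
  have finW: "finite W" and WV: "W \<subseteq> V" and finN: "finite N" using finV by (auto simp: W_def N_def)
  have mN: "m x y = of_bool (y \<in> N)" if "y \<in> W" for y
  proof -
    have "m x y = 0 \<or> m x y = 1"
      using simple[OF x, of y] multD(2)[OF m, of x y] that by (auto simp: W_def)
    then show ?thesis using that by (auto simp: N_def)
  qed
  have cN: "(\<Sum>v\<in>A. m x v) = int (card (N \<inter> A))" if "A \<subseteq> W" for A
  proof -
    have "(\<Sum>v\<in>A. m x v) = (\<Sum>v\<in>A. of_bool (v \<in> N))" using that mN by (intro sum.cong) auto
    also have "\<dots> = int (card (A \<inter> N))"
      using finite_subset[OF that finW] by (simp add: of_bool_def sum.If_cases)
    finally show ?thesis by (simp add: Int_commute)
  qed
  have NW: "N \<inter> W = N" by (auto simp: N_def)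
  have card_N: "int (card N) = 4 - k x"
    using d4 cN[of W] NW by (simp add: cut_def W_def)
  have sk: "sum k V = k x + sum k W" and sc: "sum c V = c x + sum c W"
    using sum.remove[OF finV x, of k] sum.remove[OF finV x, of c] by (simp_all add: W_def)
  have cutA: "cut W m A = cut V m A - int (card (N \<inter> A))" if "A \<subseteq> W" for A
    using cut_vertex_removed[OF finV m x, of A] cN that by (simp add: W_def)
  have okA': "sufficient (d A) (sum \<beta> A)" if "A \<subseteq> W" "A \<noteq> {}" for A
    using okA[of A] that x by (auto simp: W_def)
  have okA2: "sufficient (d A - 2) (sum \<beta> A)" if "A \<subseteq> W" "y \<in> A" "z \<in> A" "y \<noteq> z" for A y z
    by (rule proper_cut_slack_or_single[of A y]) (use that x in \<open>auto simp: W_def\<close>)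
  have full: "sufficient (d A - 4) (sum \<beta> A)" if "A \<subseteq> W" "A \<noteq> {}" "A \<noteq> W" "N \<subseteq> A" "k x = 0" for A
  proof -
    have A: "finite A" "x \<notin> A" using finite_subset[OF that(1) finW] that(1) by (auto simp: W_def)
    have "sufficient (d (insert x A)) (sum \<beta> (insert x A))"
      by (rule okA) (use that x in \<open>auto simp: W_def\<close>)
    moreover have "cut V m (insert x A) = cut V m A - 4"
    proof -
      have "N \<inter> (W - A) = {}" using that by auto
      then have "(\<Sum>u\<in>W - A. m x u) = 0" using cN[of "W - A"] by simp
      moreover have "N \<inter> A = N" using that by auto
      ultimately show ?thesis
        using cut_vertex_added[OF finV x, of A] cutA[OF that(1)] card_N that by (simp add: W_def)
    qed
    moreover have "3 dvd (sum \<beta> (insert x A) - sum \<beta> A)" using A b0 by simp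
    ultimately show ?thesis
      using A that sufficient_cong[of "sum \<beta> (insert x A)" "sum \<beta> A"] by (simp add: algebra_simps)
  qed
  have att1: "attainable (m v x) (of_bool (v \<in> N) * s)" if "v \<in> W" "s = 1 \<or> s = -1" for v s
    using that mN[of v] multD(1)[OF m, of x v] by (auto simp: attainable_def)
  have k012: "k x = 0 \<or> k x = 1 \<or> k x = 2" using degree_four_k[OF x d4 b0] k0[of x] by linarith
  note split = split_vertex[OF x _ _ _ _ _ b0, folded W_def]
  note join = orientable_join_vertex[OF x, folded W_def]
  note ce = cut_edge[OF finW] sum_edge_W[OF WV]
  show False
  proof (cases "k x = 0")
    case k: True
    then have "card N = 4" using card_N by simp
    then obtain y1 N1 where N1: "N = insert y1 N1" "y1 \<notin> N1" "card N1 = 3"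
      by (metis card_eq_SucD eval_nat_numeral(2) numeral_eq_Suc semiring_norm(26,27) Suc_numeral)
    then obtain y2 y3 y4 where y: "N = {y1, y2, y3, y4}" "distinct [y1, y2, y3, y4]"
      unfolding card_3_iff by auto
    have yW: "y1 \<in> W" "y2 \<in> W" "y3 \<in> W" "y4 \<in> W" using y(1) by (auto simp: N_def)
    define m1 where "m1 u v = m u v + edge y3 y4 u v" for u v
    define m2 where "m2 u v = m1 u v + edge y1 y2 u v" for u v
    have m1': "m1 = (\<lambda>u v. m u v + edge y3 y4 u v)" and m2': "m2 = (\<lambda>u v. m1 u v + edge y1 y2 u v)"
      by (simp_all add: m1_def m2_def fun_eq_iff)
    have M: "mult m1" "mult m2" unfolding m1_def m2_def using y by (auto intro!: mult_edge m)
    have "orientable W m2 (\<lambda>v. \<beta> v - c v)"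
    proof (rule split[OF M(2)])
      show "0 \<le> k z" for z by (rule k0)
      show "attainable (k z) (c z)" if "z \<in> W" for z using that WV attc by auto
      show "3 dvd sum c V - sum c W" using sc attc[OF x] k by simp
      show "sum k W = sum k V" using sk k by simp
      show "(\<Sum>u\<in>W. sum (m2 u) W) \<le> (\<Sum>u\<in>W. sum (m u) W) + 2 * sum (m x) W"
        using y yW cN[of W] NW \<open>card N = 4\<close> by (simp add: m2_def m1_def sum.distrib ce)
      fix A assume A: "A \<subseteq> W" "A \<noteq> {}" "A \<noteq> W"
      have card: "int (card (N \<inter> A)) = of_bool (y1 \<in> A) + of_bool (y2 \<in> A) + of_bool (y3 \<in> A) +
          of_bool (y4 \<in> A)"
        using y by (auto simp: Int_insert_left card_insert_if)
      have "cut W m2 A = cut W m A + of_bool ((y3 \<in> A) \<noteq> (y4 \<in> A)) + of_bool ((y1 \<in> A) \<noteq> (y2 \<in> A))"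
        using y yW A by (simp add: m1' m2' cut_add ce)
      then have eq: "cut W m2 A + sum k A = d A - 2 * of_bool (y1 \<in> A \<and>
          y2 \<in> A) - 2 * of_bool (y3 \<in> A \<and> y4 \<in> A)"
        using cutA[OF A(1)] card by (simp add: of_bool_def)
      show "sufficient (cut W m2 A + sum k A) (sum \<beta> A)"
        unfolding eq using okA'[OF A(1,2)] okA2[OF A(1), of y1 y2] okA2[OF A(1), of y3 y4] full[OF A
            _ k] y
        by (cases "y1 \<in> A \<and> y2 \<in> A"; cases "y3 \<in> A \<and> y4 \<in> A") auto
    qed
    then obtain s where s: "s = 1 \<or> s = -1" "orientable W m1 (\<lambda>v. \<beta> v - c v - s * arc y1 y2 v)"
      using orientable_remove_edge[OF finW M(1) yW(1,2), folded m2_def] y by auto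
    then obtain t where t: "t = 1 \<or> t = -1"
        "orientable W m (\<lambda>v. \<beta> v - c v - s * arc y1 y2 v - t * arc y3 y4 v)"
      using orientable_remove_edge[OF finW m yW(3,4), folded m1_def] y by auto
    show False
    proof (rule join)
      show "orientable W m (\<lambda>v. \<beta> v - c v - (s * arc y1 y2 v + t * arc y3 y4 v))"
        using t(2) by (simp add: algebra_simps)
      show "attainable (m v x) (s * arc y1 y2 v + t * arc y3 y4 v)" if "v \<in> W" for v
        using att1[OF that s(1)] att1[OF that t(1)] y by (auto simp: arc_def)
      show "3 dvd sum (\<lambda>v. s * arc y1 y2 v + t * arc y3 y4 v) W + (\<beta> x - c x)"
        using yW b0 attc[OF x] k by (simp add: sum.distrib sum_distrib_left[symmetric] sum_arc finW)
    qed
  next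
    case False
    show False
    proof (cases "k x = 1")
      case k: True
      then have "card N = 3" using card_N by simp
      then obtain y1 y2 y3 where y: "N = {y1, y2, y3}" "distinct [y1, y2, y3]"
        unfolding card_3_iff by auto
      have yW: "y1 \<in> W" "y2 \<in> W" "y3 \<in> W" using y(1) by (auto simp: N_def)
      obtain s where s: "s = 1 \<or> s = -1" "3 dvd (c x - s)"
      proof -
        have "\<not> 3 dvd c x" using attc[OF x] k by (simp add: attainable_def)
        then have "3 dvd (c x - 1) \<or> 3 dvd (c x - -1)" by presburger
        then show ?thesis using that by blast
      qed
      define k' where "k' v = k v + of_bool (v = y1)" for v
      define c' where "c' v = c v + of_bool (v = y1) * s" for v
      define m1 where "m1 u v = m u v + edge y2 y3 u v" for u v
      have m1': "m1 = (\<lambda>u v. m u v + edge y2 y3 u v)" by (simp add: m1_def fun_eq_iff)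
      have M: "mult m1" unfolding m1_def using y by (auto intro!: mult_edge m)
      have sk': "sum k' A = sum k A + of_bool (y1 \<in> A)" if "finite A" for A
        using that by (simp add: k'_def sum.distrib sum_of_bool_eq)
      have "orientable W m1 (\<lambda>v. \<beta> v - c' v)"
      proof (rule split[OF M])
        show "0 \<le> k' z" for z using k0[of z] by (simp add: k'_def)
        show "attainable (k' z) (c' z)" if "z \<in> W" for z
          using that WV attc[of z] attainable_add[OF k0 s(1)] by (auto simp: k'_def c'_def)
        have "sum c' W = sum c W + s"
          using yW finW by (simp add: c'_def sum.distrib sum_distrib_right[symmetric] sum_of_bool_eq)
        then show "3 dvd sum c V - sum c' W" using sc s(2) by simp
        show "sum k' W = sum k V" using sk k sk'[OF finW] yW by simp
        show "(\<Sum>u\<in>W. sum (m1 u) W) \<le> (\<Sum>u\<in>W. sum (m u) W) + 2 * sum (m x) W"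
          using y yW cN[of W] NW \<open>card N = 3\<close> by (simp add: m1_def sum.distrib ce)
        fix A assume A: "A \<subseteq> W" "A \<noteq> {}" "A \<noteq> W"
        have card: "int (card (N \<inter> A)) = of_bool (y1 \<in> A) + of_bool (y2 \<in> A) + of_bool (y3 \<in> A)"
          using y by (auto simp: Int_insert_left card_insert_if)
        have "cut W m1 A = cut W m A + of_bool ((y2 \<in> A) \<noteq> (y3 \<in> A))"
          using y yW A by (simp add: m1' cut_add ce)
        then have eq: "cut W m1 A + sum k' A = d A - 2 * of_bool (y2 \<in> A \<and> y3 \<in> A)"
          using cutA[OF A(1)] card sk'[OF finite_subset[OF A(1) finW]] by (simp add: of_bool_def)
        show "sufficient (cut W m1 A + sum k' A) (sum \<beta> A)"
          unfolding eq using okA'[OF A(1,2)] okA2[OF A(1), of y2 y3] y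
          by (cases "y2 \<in> A \<and> y3 \<in> A") auto
      qed
      then obtain t where t: "t = 1 \<or> t = -1" "orientable W m (\<lambda>v. \<beta> v - c' v - t * arc y2 y3 v)"
        using orientable_remove_edge[OF finW m yW(2,3), folded m1_def] y by auto
      show False
      proof (rule join)
        show "orientable W m (\<lambda>v. \<beta> v - c v - (of_bool (v = y1) * s + t * arc y2 y3 v))"
          using t(2) by (simp add: c'_def algebra_simps)
        show "attainable (m v x) (of_bool (v = y1) * s + t * arc y2 y3 v)" if "v \<in> W" for v
          using att1[OF that s(1)] att1[OF that t(1)] y by (auto simp: arc_def)
        show "3 dvd sum (\<lambda>v. of_bool (v = y1) * s + t * arc y2 y3 v) W + (\<beta> x - c x)"
        proof -
          have "sum (\<lambda>v. of_bool (v = y1) * s + t * arc y2 y3 v) W = s"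
            using yW by (simp add: sum.distrib sum_distrib_left[symmetric] sum_distrib_right[symmetric]
              sum_arc sum_of_bool_eq finW)
          then show ?thesis using s(2) b0 by presburger
        qed
      qed
    next
      case k1: False
      then have k: "k x = 2" using k012 False by simp
      then have "card N = 2" using card_N by simp
      then obtain y1 y2 where y: "N = {y1, y2}" "y1 \<noteq> y2" unfolding card_2_iff by auto
      have yW: "y1 \<in> W" "y2 \<in> W" using y(1) by (auto simp: N_def)
      obtain s t where s: "s = 1 \<or> s = -1" "t = 1 \<or> t = -1" "3 dvd (c x - s - t)"
      proof -
        have "3 dvd (c x - 1 - 1) \<or> 3 dvd (c x - 1 - -1) \<or> 3 dvd (c x - -1 - -1)" by presburger
        then show ?thesis using that by blast
      qed
      define k' where "k' v = k v + of_bool (v = y1) + of_bool (v = y2)" for v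
      define h where "h v = of_bool (v = y1) * s + of_bool (v = y2) * t" for v
      define c' where "c' v = c v + h v" for v
      have sk': "sum k' A = sum k A + of_bool (y1 \<in> A) + of_bool (y2 \<in> A)" if "finite A" for A
        using that by (simp add: k'_def sum.distrib sum_of_bool_eq)
      have sh: "sum h W = s + t"
        using yW finW by (simp add: h_def sum.distrib sum_distrib_right[symmetric] sum_of_bool_eq)
      have "orientable W m (\<lambda>v. \<beta> v - c' v)"
      proof (rule split[OF m])
        show "0 \<le> k' z" for z using k0[of z] by (simp add: k'_def)
        show "attainable (k' z) (c' z)" if "z \<in> W" for z
          using that WV attc[of z] attainable_add[OF k0 s(1)] attainable_add[OF k0 s(2)] y(2)
          by (auto simp: k'_def c'_def h_def)
        have "sum c' W = sum c W + s + t" using sh by (simp add: c'_def sum.distrib)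
        then show "3 dvd sum c V - sum c' W" using sc s(3) by (simp add: algebra_simps)
        show "sum k' W = sum k V" using sk k sk'[OF finW] yW by simp
        show "(\<Sum>u\<in>W. sum (m u) W) \<le> (\<Sum>u\<in>W. sum (m u) W) + 2 * sum (m x) W"
          using cN[of W] by simp
        fix A assume A: "A \<subseteq> W" "A \<noteq> {}" "A \<noteq> W"
        have "int (card (N \<inter> A)) = of_bool (y1 \<in> A) + of_bool (y2 \<in> A)"
          using y by (auto simp: Int_insert_left card_insert_if)
        then have "cut W m A + sum k' A = d A"
          using cutA[OF A(1)] sk'[OF finite_subset[OF A(1) finW]] by simp
        then show "sufficient (cut W m A + sum k' A) (sum \<beta> A)"
          using okA'[OF A(1,2)] by simp
      qed
      then have sol: "orientable W m (\<lambda>v. \<beta> v - c v - h v)" by (simp add: c'_def algebra_simps)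
      show False
      proof (rule join[OF sol])
        show "attainable (m v x) (h v)" if "v \<in> W" for v
          using att1[OF that s(1)] att1[OF that s(2)] y by (auto simp: h_def)
        show "3 dvd sum h W + (\<beta> x - c x)"
          using s(3) b0 sh by presburger
      qed
    qed
  qed
qed

lemma sufficient_positive:
  "sufficient (e - 1) (b - 1) \<Longrightarrow> \<not> sufficient (e - 1) (b + 1) \<Longrightarrow>
      e = 5 \<and> 3 dvd (b - 1) \<or> e = 6 \<and> 3 dvd (b - 2)"
  unfolding sufficient_def by presburger

lemma sufficient_weak_le: "\<not> sufficient (K - 2) B \<Longrightarrow> 3 dvd (B + K) \<Longrightarrow> K \<le> 5"
  unfolding sufficient_def by presburger

lemma sufficient_weak_step: "K \<le> 5 \<Longrightarrow> 3 dvd (B + K) \<Longrightarrow> \<not> sufficient (K + 1 - 2) B"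
  unfolding sufficient_def by presburger

lemma sufficient_weak_del: "\<not> sufficient (K - 2) B \<Longrightarrow> \<not> sufficient (K - 1 - 2) (B - 1)"
  unfolding sufficient_def by presburger

text \<open>
  Only the vertices of degree 4 with demand 0, which are excluded, can neither lose an outgoing
  nor an incoming edge.
\<close>

lemma vertex_sign:
  assumes "x \<in> V"
  shows "out_removable x \<or> in_removable x"
proof -
  have "{x} \<noteq> V" using card_V by auto
  then have "sufficient (d {x}) (\<beta> x)" using okA[of "{x}"] assms by simp
  moreover have "\<not> (d {x} = 4 \<and> 3 dvd \<beta> x)" using no_degree_four assms by blast
  ultimately show ?thesis unfolding out_removable_def in_removable_def sufficient_def by presburger
qed

lemma has_neighbour:
  assumes "x \<in> V"
  shows "\<exists>y\<in>V. y \<noteq> x \<and> 1 \<le> m x y"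
proof -
  have "{x} \<noteq> V" using card_V by auto
  then show ?thesis using connected[of "{x}"] assms by auto
qed

text \<open>
  An edge from an out-removable to an in-removable vertex is deletable. Hence a vertex of both kinds
  has no neighbour at all, and by connectedness only one kind occurs.
\<close>

lemma same_sign: "(\<forall>x\<in>V. out_removable x \<and> \<not> in_removable x) \<or> (\<forall>x\<in>V. in_removable x \<and>
    \<not> out_removable x)"
proof -
  have edge: "\<not> (out_removable x \<and> in_removable y)" if "x \<in> V" "y \<in> V" "1 \<le> m x y \<or> 1 \<le> m y x" for x y
    using no_deletable_edge[OF that(1,2)] that multD(1)[OF m, of x y] by auto
  have one: "\<not> (out_removable x \<and> in_removable x)" if x: "x \<in> V" for x
  proof -
    obtain y where "y \<in> V" "1 \<le> m x y" using has_neighbour[OF x] by blast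
    then show ?thesis using edge[of x y] edge[of y x] vertex_sign[of y] x by blast
  qed
  define P where "P = {x \<in> V. out_removable x}"
  have "P = {} \<or> P = V"
  proof (rule ccontr)
    assume "\<not> (P = {} \<or> P = V)"
    then obtain x y where "x \<in> P" "y \<in> V - P" "1 \<le> m x y"
      using connected[of P] by (auto simp: P_def)
    then show False using edge[of x y] vertex_sign[of y] by (auto simp: P_def)
  qed
  then show ?thesis using one vertex_sign by (auto simp: P_def)
qed

text \<open>
  A root edge directed from \<open>x\<close> to the root could be deleted: the root stays small, and
  \<open>x\<close> can lose an outgoing edge.
\<close>

lemma no_removable_root_edge:
  assumes x: "x \<in> V" "out_removable x" and kx: "1 \<le> k x" and cx: "attainable (k x - 1) (c x - 1)"
  shows False
proof -
  define k' where "k' v = k v - of_bool (v = x)" for v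
  define c' where "c' v = c v - of_bool (v = x)" for v
  define \<beta>' where "\<beta>' v = \<beta> v - of_bool (v = x)" for v
  have s: "sum k' A = sum k A - of_bool (x \<in> A)" "sum c' A = sum c A - of_bool (x \<in> A)"
    "sum \<beta>' A = sum \<beta> A - of_bool (x \<in> A)" if "A \<subseteq> V" for A
    using finA[OF that] by (simp_all add: k'_def c'_def \<beta>'_def sum_subtractf sum_of_bool_eq)
  have "extension_data V m k' c' \<beta>'"
    unfolding extension_data_def
  proof (intro conjI allI ballI impI)
    show "0 \<le> k' z" for z using k0[of z] kx by (simp add: k'_def)
    show "attainable (k' z) (c' z)" if "z \<in> V" for z using attc[OF that] cx by (simp add: k'_def c'_def)
    show "3 dvd sum \<beta>' V - sum c' V" using s[of V] bal by simp
    show "\<not> sufficient (sum k' V - 2) (sum \<beta>' V)"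
      using s[of V] sufficient_weak_del[OF weakV] x by simp
    fix A assume A: "A \<subseteq> V" "A \<noteq> {}" "A \<noteq> V"
    show "sufficient (cut V m A + sum k' A) (sum \<beta>' A)"
      unfolding s(1)[OF A(1)] s(3)[OF A(1)] using okA[OF A] out_set[OF A(1,3) _ x(2)]
      by (cases "x \<in> A") (simp_all add: add_diff_eq)
  qed (use finV m in auto)
  moreover have "weight V m k' < weight V m k" using s[of V] x by (simp add: weight_eq)
  ultimately have "orientable V m (\<lambda>v. \<beta>' v - c' v)" by (rule IH)
  then show False using cex by (simp add: \<beta>'_def c'_def)
qed

text \<open>
  If all vertices are of the out-removable kind, all have degree 5 and demand 1 or degree 6 and
  demand 2, and all root edges are directed away from the root, so that there are at most five of
  them. Without root edges any vertex can become the root. Otherwise an edge from the root to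
  \<open>x\<close> is replaced by two edges from \<open>x\<close> to the root, which is the same modulo 3, and
  an edge within \<open>V\<close> is directed towards \<open>x\<close> and deleted.
\<close>

lemma not_all_out: "\<not> (\<forall>x\<in>V. out_removable x \<and> \<not> in_removable x)"
proof
  assume all: "\<forall>x\<in>V. out_removable x \<and> \<not> in_removable x"
  have type: "d {x} = 5 \<and> 3 dvd (\<beta> x - 1) \<or> d {x} = 6 \<and> 3 dvd (\<beta> x - 2)" if "x \<in> V" for x
    using all that sufficient_positive[of "d {x}"
        "\<beta> x"] unfolding out_removable_def in_removable_def by blast
  have ck: "3 dvd (c x + k x)" if "x \<in> V" for x
  proof (cases "1 \<le> k x")
    case True
    then have "\<not> attainable (k x - 1) (c x - 1)" using no_removable_root_edge all that by blast
    then show ?thesis using attc[OF that] True unfolding attainable_def by presburger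
  next
    case False
    then have "k x = 0" using k0[of x] by simp
    then show ?thesis using attc[OF that] by simp
  qed
  have "3 dvd (\<Sum>x\<in>V. c x + k x)" by (rule dvd_sum) (rule ck)
  then have bk: "3 dvd (sum \<beta> V + sum k V)" using bal by (simp add: sum.distrib) presburger
  \<comment> \<open>A root of degree 6 or 7 is small only for demands that \<open>bk\<close> excludes.\<close>
  have k5: "sum k V \<le> 5" by (rule sufficient_weak_le[OF weakV bk])
  show False
  proof (cases "sum k V = 0")
    case True
    then have kz: "k x = 0" if "x \<in> V" for x using that finV k0 by (simp add: sum_nonneg_eq_0_iff)
    obtain x where x: "x \<in> V" using card_V by fastforce
    define A where "A = V - {x}"
    have A: "A \<subseteq> V" "A \<noteq> V" "V = A \<union> {x}" using x by (auto simp: A_def)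
    have "A \<noteq> {}" using card_V A by auto
    then obtain a where a: "a \<in> A" by blast
    have VA: "V - A = {x}" using x by (auto simp: A_def)
    have dA: "cut V m A = d {x}" using cut_compl[OF m, of "{x}" V] x kz by (simp add: A_def)
    have dA': "d A = d {x}" using dA kz A by simp
    have sbA: "sum \<beta> V = \<beta> x + sum \<beta> A" using sum.remove[OF finV x, of \<beta>] by (simp add: A_def)
    have weak: "\<not> sufficient (d A - 2) (sum \<beta> A)"
      using type[OF x] sbA bk True unfolding dA' sufficient_def by presburger
    have inner: "orientable A m (\<lambda>u. \<beta> u - c u - (\<Sum>v\<in>{x}. g u v))"
      if "\<And>u v. u \<in> A \<Longrightarrow> v \<in> {x} \<Longrightarrow> attainable (m u v) (g u v)"
        "3 dvd (\<Sum>u\<in>A. \<beta> u - c u - (\<Sum>v\<in>{x}. g u v))" for g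
      using inner_orientable[OF A(1,2) weak, unfolded VA, OF that] .
    have "orientable (A \<union> {x}) m (\<lambda>x. \<beta> x - c x)"
    proof (rule orientable_contract[OF _ _ _ a m _ inner])
      have ax: "a \<noteq> x" using a by (auto simp: A_def)
      have "contract_mult A a m a x = cut V m A" using ax by (simp add: contract_mult_def cut_def VA)
      then have "2 \<le> contract_mult A a m a x" using dA type[OF x] by auto
      moreover have "3 dvd contract_sum A a (\<lambda>x. \<beta> x - c x) a + contract_sum A a (\<lambda>x. \<beta> x - c x) x"
        using bal sbA sum.remove[OF finV x, of c] ax
        by (simp add: contract_sum_def sum_subtractf A_def algebra_simps)
      ultimately show "orientable {a, x} (contract_mult A a m) (contract_sum A a (\<lambda>x. \<beta> x - c x))"
        by (intro orientable_pair ax mult_contract m)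
    qed (use finA[OF A(1)] in \<open>auto simp: A_def\<close>)
    then show False using cex A(3) by simp
  next
    case False
    then obtain x where x: "x \<in> V" "k x \<noteq> 0" using sum.neutral[of V k] by blast
    then have kx: "1 \<le> k x" using k0[of x] by linarith
    obtain y where y: "y \<in> V" "y \<noteq> x" "1 \<le> m x y" using has_neighbour[OF x(1)] by blast
    then have ne: "x \<noteq> y" by blast
    define m' where "m' u v = m u v - edge x y u v" for u v
    have m': "m' = (\<lambda>u v. m u v - edge x y u v)" by (simp add: m'_def fun_eq_iff)
    \<comment> \<open>The value \<open>c x\<close> stays: one edge into \<open>x\<close> and two edges out of it agree modulo 3.\<close>
    define k' where "k' v = k v + of_bool (v = x)" for v
    define \<beta>' where "\<beta>' v = \<beta> v + arc x y v" for v
    have mm: "mult m'" unfolding m' by (rule mult_del[OF m ne y(3)])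
    have sb: "sum \<beta>' A = sum \<beta> A + of_bool (x \<in> A) - of_bool (y \<in> A)"
      and sk: "sum k' A = sum k A + of_bool (x \<in> A)" if "A \<subseteq> V" for A
      using that finA by (simp_all add: \<beta>'_def k'_def sum.distrib sum_arc sum_of_bool_eq)
    have sc: "cut V m' A = cut V m A - of_bool ((x \<in> A) \<noteq> (y \<in> A))" if "A \<subseteq> V" for A
      unfolding m' using that cut_edge[OF finV that x(1) y(1) ne] by (simp add: cut_diff)
    have "extension_data V m' k' c \<beta>'"
      unfolding extension_data_def
    proof (intro conjI allI ballI impI)
      show "0 \<le> k' z" for z using k0[of z] by (simp add: k'_def)
      show "attainable (k' z) (c z)" if "z \<in> V" for z
        using attc[OF that] kx attainable_ge2[of "k x + 1" "c x"] by (auto simp: k'_def)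
      show "3 dvd sum \<beta>' V - sum c V" using sb[of V] bal x y by simp
      show "\<not> sufficient (sum k' V - 2) (sum \<beta>' V)"
        using sb[of V] sk[of V] sufficient_weak_step[OF k5 bk] x y by simp
      fix A assume A: "A \<subseteq> V" "A \<noteq> {}" "A \<noteq> V"
      have yout: "sufficient (d A - 1) (sum \<beta> A - 1)" if "y \<in> A"
        using out_set[OF A(1,3) that] all y by blast
      have xA: "6 \<le> d A \<or> A = {x}" if "x \<in> A"
        using proper_cut_slack_or_single[OF A(1,3) that] unfolding sufficient_def by linarith
      have eq: "cut V m' A + sum k' A = d A - of_bool ((x \<in> A) \<noteq> (y \<in> A)) + of_bool (x \<in> A)"
        using sk[OF A(1)] sc[OF A(1)] by simp
      consider "x \<in> A" "y \<in> A" | "x \<in> A" "y \<notin> A" "A \<noteq> {x}" | "A = {x}" | "x \<notin> A" "y \<in> A" | "x \<notin> A"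
          "y \<notin> A"
        by blast
      then show "sufficient (cut V m' A + sum k' A) (sum \<beta>' A)"
      proof cases
        case 1
        then have "6 \<le> d A" using xA ne by auto
        then show ?thesis unfolding eq using 1 by (simp add: sufficient_def)
      next
        case 2
        then show ?thesis unfolding eq using xA by (simp add: sufficient_def)
      next
        case 3
        then show ?thesis unfolding eq using sb[OF A(1)] type[OF x(1)] ne
            by (auto simp: sufficient_def) presburger+
      next
        case 4
        then show ?thesis unfolding eq using sb[OF A(1)] yout by simp
      next
        case 5
        then show ?thesis unfolding eq using sb[OF A(1)] okA[OF A] by simp
      qed
    qed (use finV mm in auto)
    moreover have "weight V m' k' < weight V m k"
      using weight_del[OF x(1) y(1) ne, of k'] sk[of V] x by (simp add: m' weight_eq)
    ultimately have "orientable V m' (\<lambda>v. \<beta>' v - c v)" by (rule IH)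
    then have "orientable V m' (\<lambda>v. (\<beta> v - c v) - -1 * arc x y v)"
      by (simp add: \<beta>'_def algebra_simps)
    from orientable_add_edge[OF finV mm x(1) y(1) ne _ this] show False
      using cex by (simp add: m')
  qed
qed

text \<open>
  Reversing all edges exchanges the two kinds of vertices.
\<close>

lemma negated: "minimal_unextendable V m k (\<lambda>x. - c x) (\<lambda>x. - \<beta> x)"
proof
  have "3 dvd (- sum \<beta> V + sum c V)" using bal by presburger
  then show "extension_data V m k (\<lambda>x. - c x) (\<lambda>x. - \<beta> x)"
    using finV m k0 attc weakV okA unfolding extension_data_def by (auto simp: sum_negf)
  show "\<not> orientable V m (\<lambda>x. - \<beta> x - - c x)"
  proof
    assume "orientable V m (\<lambda>x. - \<beta> x - - c x)"
    then obtain f where f: "\<And>u v. f v u = - f u v" "\<And>u v. u \<in> V \<Longrightarrow> v \<in> V \<Longrightarrow> attainable (m u v) (f u v)"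
      "\<And>u. u \<in> V \<Longrightarrow> 3 dvd ((\<Sum>v\<in>V. f u v) - (- \<beta> u - - c u))"
      by (rule orientableE) blast
    have "orientable V m (\<lambda>x. \<beta> x - c x)"
    proof (rule orientableI)
      show "f u v = - f v u" for u v by (rule f(1))
      show "attainable (m u v) (f v u)" if "u \<in> V" "v \<in> V" for u v
        using f(2)[OF that(2,1)] multD(1)[OF m, of u v] by simp
      show "3 dvd ((\<Sum>v\<in>V. f v u) - (\<beta> u - c u))" if "u \<in> V" for u
      proof -
        have "(\<Sum>v\<in>V. f v u) = (\<Sum>v\<in>V. - f u v)" by (intro sum.cong refl f(1))
        then show ?thesis using f(3)[OF that] by (simp add: sum_negf) presburger
      qed
    qed
    then show False using cex by blast
  qed
qed (rule IH)

lemma contradiction: False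
proof -
  interpret neg: minimal_unextendable V m k "\<lambda>x. - c x" "\<lambda>x. - \<beta> x" by (rule negated)
  have eq: "sufficient e (- b - 1) = sufficient e (b + 1)"
      "sufficient e (- b + 1) = sufficient e (b - 1)" for e b
    unfolding sufficient_def by presburger+
  show False
    using same_sign not_all_out neg.not_all_out
    unfolding out_removable_def in_removable_def neg.out_removable_def neg.in_removable_def eq by blast
qed

end

theorem orientation_extension:
  assumes "extension_data V m k c \<beta>"
  shows "orientable V m (\<lambda>x. \<beta> x - c x)"
  using assms
proof (induction "nat (weight V m k)" arbitrary: V m k c \<beta> rule: less_induct)
  case less
  show ?case
  proof (rule ccontr)
    assume "\<not> ?thesis"
    then have "minimal_unextendable V m k c \<beta>"
    proof unfold_locales
      fix V' :: "'a set" and m' k' c' \<beta>' assume i: "extension_data V' m' k' c' \<beta>'" and "weight V' m'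
          k' < weight V m k"
      then have "nat (weight V' m' k') < nat (weight V m k)" using weight_nonneg[OF i] by simp
      then show "orientable V' m' (\<lambda>x. \<beta>' x - c' x)" using i by (rule less.hyps)
    qed (use less.prems in auto)
    then show False by (rule minimal_unextendable.contradiction)
  qed
qed

corollary orientable_if_six_edge_connected:
  assumes "finite V" "mult m" "3 dvd sum b V"
    and "\<And>A. A \<subseteq> V \<Longrightarrow> A \<noteq> {} \<Longrightarrow> A \<noteq> V \<Longrightarrow> 6 \<le> cut V m A"
  shows "orientable V m b"
proof -
  have "extension_data V m (\<lambda>_. 0) (\<lambda>_. 0) b"
    using assms by (auto simp: extension_data_def sufficient_def)
  from orientation_extension[OF this] show ?thesis by simp
qed

section \<open>Graphs with many crossing edges in every partition\<close>

text \<open>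
  The condition of Nash-Williams and Tutte for four edge-disjoint spanning trees, with every crossing
  edge counted at both of its ends.
\<close>

definition tree_rich :: "'v set \<Rightarrow> ('v \<Rightarrow> 'v \<Rightarrow> int) \<Rightarrow> bool" where
  "tree_rich V m \<longleftrightarrow> (\<forall>P. partition_on V P \<longrightarrow> 8 * int (card P) - 8 \<le> (\<Sum>A\<in>P. cut V m A))"

lemma tree_richD: "tree_rich V m \<Longrightarrow> partition_on V P \<Longrightarrow> 8 * int (card P) - 8 \<le> (\<Sum>A\<in>P. cut V m A)"
  by (simp add: tree_rich_def)

lemma even_inner:
  assumes "finite A" "mult m"
  shows "even (\<Sum>u\<in>A. \<Sum>v\<in>A. m u v)"
  using assms(1)
proof induction
  case (insert x A)
  have eq: "(\<Sum>u\<in>insert x A. \<Sum>v\<in>insert x A. m u v) = 2 * (\<Sum>v\<in>A. m x v) + (\<Sum>u\<in>A. \<Sum>v\<in>A. m u v)"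
  proof -
    have "(\<Sum>u\<in>A. m u x) = (\<Sum>v\<in>A. m x v)" by (intro sum.cong refl multD(1)[OF assms(2)])
    then show ?thesis using insert multD(3)[OF assms(2), of x] by (simp add: sum.distrib)
  qed
  show ?case unfolding eq using insert by simp
qed simp

lemma cut_eq_diff:
  assumes "finite V" "A \<subseteq> V"
  shows "cut V m A = (\<Sum>u\<in>A. \<Sum>v\<in>V. m u v) - (\<Sum>u\<in>A. \<Sum>v\<in>A. m u v)"
proof -
  have "(\<Sum>v\<in>V - A. m u v) = (\<Sum>v\<in>V. m u v) - (\<Sum>v\<in>A. m u v)" for u
    using sum_diff[OF assms] by blast
  then show ?thesis by (simp add: cut_def sum_subtractf)
qed

lemma partition_part:
  assumes "partition_on V P" "finite V"
  shows "finite P" "A \<in> P \<Longrightarrow> finite A" "A \<in> P \<Longrightarrow> A \<subseteq> V" "A \<in> P \<Longrightarrow> A \<noteq> {}"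
  using assms finite_elements[OF assms(2,1)] finite_subset[of A V] by (auto simp: partition_on_def)

lemma partition_sum:
  fixes g :: "'v \<Rightarrow> 'a :: comm_monoid_add"
  assumes "partition_on V P" "finite V"
  shows "(\<Sum>A\<in>P. sum g A) = sum g V"
proof -
  have "sum g (\<Union>P) = (\<Sum>A\<in>P. sum g A)"
    using sum.Union_disjoint[of P g] partition_part[OF assms] partition_onD2[OF assms(1)]
    by (auto simp: disjoint_def)
  then show ?thesis using partition_onD1[OF assms(1)] by simp
qed

text \<open>
  The sum counts every crossing edge twice.
\<close>

lemma even_partition:
  assumes "partition_on V P" "finite V" "mult m"
  shows "even (\<Sum>A\<in>P. cut V m A)"
proof -
  have "(\<Sum>A\<in>P. cut V m A) = (\<Sum>A\<in>P. \<Sum>u\<in>A. \<Sum>v\<in>V. m u v) - (\<Sum>A\<in>P. \<Sum>u\<in>A. \<Sum>v\<in>A. m u v)"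
    using cut_eq_diff[OF assms(2)] partition_part(3)[OF assms(1,2)]
    by (simp add: sum_subtractf[symmetric])
  also have "(\<Sum>A\<in>P. \<Sum>u\<in>A. \<Sum>v\<in>V. m u v) = (\<Sum>u\<in>V. \<Sum>v\<in>V. m u v)"
    by (rule partition_sum[OF assms(1,2)])
  finally show ?thesis
    using even_inner[OF assms(2,3)] even_inner[OF _ assms(3)] partition_part(2)[OF assms(1,2)]
    by (simp add: dvd_sum)
qed

lemma partition_singletons: "partition_on V ((\<lambda>x. {x}) ` V)"
  by (auto simp: partition_on_def disjoint_def)

lemma sum_singletons:
  "(\<Sum>A\<in>(\<lambda>x. {x}) ` V. h A) = (\<Sum>x\<in>V. h {x})" "card ((\<lambda>x. {x}) ` V) = card V"
  by (simp_all add: sum.reindex inj_on_def card_image)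

lemma cut_singleton: "finite V \<Longrightarrow> mult m \<Longrightarrow> x \<in> V \<Longrightarrow> cut V m {x} = (\<Sum>v\<in>V. m x v)"
  by (simp add: cut_eq_diff multD)

lemma partition_cases:
  assumes "partition_on V P" "finite V"
  shows "(\<exists>A\<in>P. 2 \<le> card A) \<or> P = (\<lambda>x. {x}) ` V"
proof (cases "\<exists>A\<in>P. 2 \<le> card A")
  case True
  then show ?thesis by blast
next
  case False
  have P: "\<exists>x. A = {x}" if "A \<in> P" for A
  proof -
    have "card A \<noteq> 0" using partition_part[OF assms] that by auto
    moreover have "\<not> 2 \<le> card A" using False that by blast
    ultimately have "card A = 1" by linarith
    then show ?thesis by (simp add: card_1_singleton_iff)
  qed
  have "P = (\<lambda>x. {x}) ` V"
  proof (intro equalityI subsetI)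
    fix A assume A: "A \<in> P"
    then obtain x where "A = {x}" using P by blast
    then show "A \<in> (\<lambda>x. {x}) ` V" using partition_part(3)[OF assms A] by auto
  next
    fix A assume "A \<in> (\<lambda>x. {x}) ` V"
    then obtain x where x: "x \<in> V" "A = {x}" by blast
    then obtain B where "B \<in> P" "x \<in> B" using partition_onD1[OF assms(1)] by auto
    then show "A \<in> P" using P x by blast
  qed
  then show ?thesis by blast
qed

lemma partition_whole:
  assumes P: "partition_on V P" and fin: "finite V" and V: "V \<in> P"
  shows "P = {V}"
proof -
  have "B = V" if B: "B \<in> P" for B
  proof (rule ccontr)
    assume "B \<noteq> V"
    then have "B \<inter> V = {}" using B V partition_onD2[OF P] by (simp add: disjoint_def)
    then show False using partition_part(3,4)[OF P fin B] by blast
  qed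
  then show ?thesis using V by blast
qed

lemma partition_remove:
  assumes P: "partition_on V P" and A: "A \<in> P"
  shows "partition_on (V - A) (P - {A})"
proof (rule partition_onI)
  have disj: "B \<inter> C = {}" if "B \<in> P" "C \<in> P" "B \<noteq> C" for B C
    using disjointD[OF partition_onD2[OF P] that] .
  show "\<Union>(P - {A}) = V - A" using disj A partition_onD1[OF P] by blast
  show "disjnt p q" if "p \<in> P - {A}" "q \<in> P - {A}" "p \<noteq> q" for p q
    using disj that by (auto simp: disjnt_def)
  show "{} \<notin> P - {A}" using partition_onD3[OF P] by blast
qed

lemma partition_insert_vertex:
  assumes "partition_on (V - {x}) P" "x \<in> V"
  shows "partition_on V (insert {x} P)"
  using assms by (auto simp: partition_on_def disjoint_def)

lemma partition_insert_card:
  assumes "partition_on (V - {x}) P" "finite V" "x \<in> V"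
  shows "card (insert {x} P) = Suc (card P)" "{x} \<notin> P"
proof -
  show "{x} \<notin> P" using assms(1) by (auto simp: partition_on_def)
  then show "card (insert {x} P) = Suc (card P)" using partition_part(1)[OF assms(1)] assms(2) by simp
qed

lemma sum_partition_insert:
  assumes P: "partition_on (V - {x}) P" and fin: "finite V" and m: "mult m" and x: "x \<in> V"
  shows "(\<Sum>A\<in>insert {x} P. cut V m A) = 2 * cut V m {x} + (\<Sum>A\<in>P. cut (V - {x}) m A)"
proof -
  have "(\<Sum>A\<in>P. cut V m A) = (\<Sum>A\<in>P. cut (V - {x}) m A) + (\<Sum>A\<in>P. \<Sum>u\<in>A. m x u)"
    using cut_vertex_removed[OF fin m x] partition_part(3)[OF P] fin
    by (simp add: sum.distrib[symmetric])
  also have "(\<Sum>A\<in>P. \<Sum>u\<in>A. m x u) = (\<Sum>u\<in>V - {x}. m x u)"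
    by (rule partition_sum[OF P]) (use fin in auto)
  also have "\<dots> = cut V m {x}" by (simp add: cut_def)
  finally show ?thesis
    using partition_insert_card[OF P fin x] partition_part(1)[OF P] fin by simp
qed

lemma tree_rich_pair:
  assumes "x \<noteq> y" "mult m" "4 \<le> m x y"
  shows "tree_rich {x, y} m"
  unfolding tree_rich_def
proof (intro allI impI)
  fix P assume P: "partition_on {x, y} P"
  have fin: "finite {x, y}" by simp
  consider A where "A \<in> P" "2 \<le> card A" | "P = (\<lambda>x. {x}) ` {x, y}"
    using partition_cases[OF P fin] by blast
  then show "8 * int (card P) - 8 \<le> (\<Sum>A\<in>P. cut {x, y} m A)"
  proof cases
    case 2
    show ?thesis
      unfolding 2 sum_singletons using assms multD(1)[OF assms(2), of x y]
      by (simp add: cut_def insert_Diff_if)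
  next
    case 1
    then have "A = {x, y}"
      using partition_part(3)[OF P fin 1(1)] assms(1) by (intro card_seteq) auto
    then have "P = {{x, y}}" using partition_whole[OF P fin] 1(1) by blast
    then show ?thesis by (simp add: cut_def)
  qed
qed

lemma refine_partition:
  assumes P: "partition_on V P" and A: "A \<in> P" and Q: "partition_on A Q" and fin: "finite V" and m:
      "mult m"
  shows "partition_on V (P - {A} \<union> Q)" "card (P - {A} \<union> Q) + 1 = card P + card Q"
    "(\<Sum>B\<in>P - {A} \<union> Q. cut V m B) = (\<Sum>B\<in>P. cut V m B) + (\<Sum>B\<in>Q. cut A m B)"
proof -
  have finA: "finite A" and AV: "A \<subseteq> V" and finP: "finite P" using partition_part[OF P fin] A by auto
  note pQ = partition_part[OF Q finA]
  have disj: "(P - {A}) \<inter> Q = {}"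
  proof -
    have "B \<inter> A = {}" if "B \<in> P - {A}" for B
      using that A partition_onD2[OF P] by (auto simp: disjoint_def)
    moreover have "B \<inter> A \<noteq> {}" if "B \<in> Q" for B using pQ(3,4)[OF that] by blast
    ultimately show ?thesis by blast
  qed
  show "partition_on V (P - {A} \<union> Q)"
  proof (rule partition_onI)
    show "\<Union>(P - {A} \<union> Q) = V"
      using partition_onD1[OF P] partition_onD1[OF Q] A by auto
    show "{} \<notin> P - {A} \<union> Q"
      using partition_onD3[OF P] partition_onD3[OF Q] by auto
    show "disjnt p q" if "p \<in> P - {A} \<union> Q" "q \<in> P - {A} \<union> Q" "p \<noteq> q" for p q
    proof -
      have 1: "B \<inter> C = {}" if "B \<in> P - {A}" "C \<in> Q" for B C
        using that A partition_onD2[OF P] pQ(3)[of C] by (auto simp: disjoint_def)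
      then have "p \<inter> q = {}"
        using that 1[of p q] 1[of q p] disjointD[OF partition_onD2[OF P], of p q]
          disjointD[OF partition_onD2[OF Q], of p q] by blast
      then show ?thesis by (simp add: disjnt_def)
    qed
  qed
  show "card (P - {A} \<union> Q) + 1 = card P + card Q"
    using disj finP pQ(1) card.remove[OF finP A] by (simp add: card_Un_disjoint)
  have "cut V m B = cut A m B + (\<Sum>u\<in>B. \<Sum>v\<in>V - A. m u v)" if "B \<in> Q" for B
  proof -
    have BA: "B \<subseteq> A" using pQ(3) that by blast
    have "(\<Sum>v\<in>V - B. m u v) = (\<Sum>v\<in>A - B. m u v) + (\<Sum>v\<in>V - A. m u v)" for u
    proof -
      have "V - B = (A - B) \<union> (V - A)" "(A - B) \<inter> (V - A) = {}" using BA AV by auto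
      then show ?thesis using finA fin by (simp add: sum.union_disjoint)
    qed
    then show ?thesis by (simp add: cut_def sum.distrib)
  qed
  then have "(\<Sum>B\<in>Q. cut V m B) = (\<Sum>B\<in>Q. cut A m B) + (\<Sum>B\<in>Q. \<Sum>u\<in>B. \<Sum>v\<in>V - A. m u v)"
    by (simp add: sum.distrib)
  also have "(\<Sum>B\<in>Q. \<Sum>u\<in>B. \<Sum>v\<in>V - A. m u v) = cut V m A"
    unfolding cut_def by (rule partition_sum[OF Q finA])
  finally show "(\<Sum>B\<in>P - {A} \<union> Q. cut V m B) = (\<Sum>B\<in>P. cut V m B) + (\<Sum>B\<in>Q. cut A m B)"
    using sum.union_disjoint[OF _ pQ(1) disj, of "cut V m"] finP sum.remove[OF finP A, of "cut V m"]
        by simp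
qed

lemma tree_rich_contract:
  assumes fin: "finite A" "finite B" and disj: "A \<inter> B = {}" and a: "a \<in> A" and m: "mult m"
    and rich: "tree_rich (A \<union> B) m"
  shows "tree_rich (insert a B) (contract_mult A a m)"
  unfolding tree_rich_def
proof (intro allI impI)
  fix P assume P: "partition_on (insert a B) P"
  define \<phi> where "\<phi> C = (if a \<in> C then A \<union> C else C)" for C
  have aB: "a \<notin> B" using a disj by auto
  note pP = partition_part[OF P]
  have sub: "C \<subseteq> insert a B" if "C \<in> P" for C using pP(3) that fin by auto
  have dis: "C = D" if "C \<in> P" "D \<in> P" "z \<in> C" "z \<in> D" for C D z
    using that partition_onD2[OF P] by (auto simp: disjoint_def)
  have restrict: "\<phi> C \<inter> insert a B = C" if "C \<in> P" for C
    using sub[OF that] a disj by (auto simp: \<phi>_def)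
  then have inj: "inj_on \<phi> P" by (metis inj_onI)
  have mem: "z \<in> \<phi> C \<longleftrightarrow> (if z \<in> A then a \<in> C else z \<in> C)" if "C \<in> P" for z C
    using sub[OF that] a disj by (auto simp: \<phi>_def)
  have part: "partition_on (A \<union> B) (\<phi> ` P)"
  proof (rule partition_onI)
    show "\<Union>(\<phi> ` P) = A \<union> B"
    proof (intro equalityI subsetI)
      fix z assume "z \<in> \<Union>(\<phi> ` P)"
      then obtain C where C: "C \<in> P" "z \<in> \<phi> C" by blast
      then show "z \<in> A \<union> B" using sub[OF C(1)] mem[OF C(1), of z] a by (cases "z \<in> A") auto
    next
      fix z assume z: "z \<in> A \<union> B"
      have "(if z \<in> A then a else z) \<in> \<Union>P" using partition_onD1[OF P] z by auto
      then obtain C where "C \<in> P" "(if z \<in> A then a else z) \<in> C" by blast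
      then show "z \<in> \<Union>(\<phi> ` P)" using mem[of C z] by (auto split: if_splits)
    qed
    show "{} \<notin> \<phi> ` P"
      using pP(4) fin by (auto simp: \<phi>_def split: if_splits)
    show "disjnt p q" if pq: "p \<in> \<phi> ` P" "q \<in> \<phi> ` P" "p \<noteq> q" for p q
    proof -
      obtain C D where CD: "C \<in> P" "D \<in> P" "p = \<phi> C" "q = \<phi> D" using pq(1,2) by blast
      have "C = D" if "z \<in> \<phi> C" "z \<in> \<phi> D" for z
        using that mem[OF CD(1)] mem[OF CD(2)] dis[OF CD(1,2)] by (auto split: if_splits)
      then show ?thesis using CD pq(3) by (auto simp: disjnt_def)
    qed
  qed
  have "(\<Sum>C\<in>P. cut (insert a B) (contract_mult A a m) C) = (\<Sum>C\<in>P. cut (A \<union> B) m (\<phi> C))"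
    by (intro sum.cong refl) (simp add: cut_contract[OF fin disj a m sub] \<phi>_def)
  also have "\<dots> = (\<Sum>C\<in>\<phi> ` P. cut (A \<union> B) m C)" using inj by (simp add: sum.reindex)
  finally show "8 * int (card P) - 8 \<le> (\<Sum>C\<in>P. cut (insert a B) (contract_mult A a m) C)"
    using tree_richD[OF rich part] card_image[OF inj] by simp
qed

lemma sum_cut_edge_le:
  assumes P: "partition_on V P" and fin: "finite V" and xy: "x \<in> V" "y \<in> V" "x \<noteq> y"
  shows "(\<Sum>A\<in>P. cut V (edge x y) A) \<le> 2"
proof -
  note pP = partition_part[OF P fin]
  have one: "(\<Sum>A\<in>P. of_bool (z \<in> A)) = (1::int)" if "z \<in> V" for z
  proof -
    have "(\<Sum>A\<in>P. of_bool (z \<in> A)) = (\<Sum>A\<in>P. \<Sum>u\<in>A. of_bool (u = z) :: int)"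
      using pP by (intro sum.cong refl) (simp add: sum_of_bool_eq)
    also have "\<dots> = 1" using that by (simp add: partition_sum[OF P fin] sum_of_bool_eq fin)
    finally show ?thesis .
  qed
  have "(\<Sum>A\<in>P. cut V (edge x y) A) \<le> (\<Sum>A\<in>P. of_bool (x \<in> A) + of_bool (y \<in> A))"
    using pP cut_edge[OF fin _ xy] by (intro sum_mono) auto
  then show ?thesis using one xy by (simp add: sum.distrib)
qed

locale minimal_unorientable =
  fixes V :: "'v set" and m :: "'v \<Rightarrow> 'v \<Rightarrow> int" and b :: "'v \<Rightarrow> int"
  assumes finV: "finite V" and m: "mult m" and richV: "tree_rich V m" and bal: "3 dvd sum b V"
    and IH: "\<And>(V' :: 'v set) m' b'. finite V' \<Longrightarrow> mult m' \<Longrightarrow> tree_rich V' m' \<Longrightarrow> 3 dvd sum b' V' \<Longrightarrow>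
      weight V' m' (\<lambda>_. 0) < weight V m (\<lambda>_. 0) \<Longrightarrow> orientable V' m' b'"
    and cex: "\<not> orientable V m b"
begin

lemma two_vertices: "2 \<le> card V"
proof (rule ccontr)
  assume "\<not> 2 \<le> card V"
  then have "card V = 0 \<or> card V = 1" by linarith
  then have "V = {} \<or> (\<exists>x. V = {x})" using finV by (auto simp: card_1_singleton_iff)
  then obtain x where "V \<subseteq> {x}" by blast
  then show False using orientable_empty_or_single[of V x m b] m bal cex by simp
qed

text \<open>
  Both the subset and the quotient by it would be orientable for all prescriptions.
\<close>

lemma no_tree_rich_subset:
  assumes A: "A \<subseteq> V" "2 \<le> card A" "A \<noteq> V"
  shows "\<not> tree_rich A m"
proof
  assume rich: "tree_rich A m"
  obtain a where a: "a \<in> A" using A(2) by fastforce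
  define B where "B = V - A"
  have fin: "finite A" "finite B" and disj: "A \<inter> B = {}" and V: "V = A \<union> B"
    using finite_subset[OF A(1) finV] finV A by (auto simp: B_def)
  have "orientable (A \<union> B) m b"
  proof (rule orientable_contract[OF fin disj a m])
    have "A \<union> insert a B = A \<union> B" using a by auto
    then have s: "sum (contract_sum A a b) (insert a B) = sum b V"
      using sum_contract[OF fin disj a, of "insert a B" b] V by simp
    have z: "contract_sum A a (\<lambda>_. 0 :: int) = (\<lambda>_. 0)" by (simp add: contract_sum_def fun_eq_iff)
    show "orientable (insert a B) (contract_mult A a m) (contract_sum A a b)"
    proof (rule IH)
      show "tree_rich (insert a B) (contract_mult A a m)"
          using tree_rich_contract[OF fin disj a m] richV V by simp
      show "3 dvd sum (contract_sum A a b) (insert a B)" using s bal by simp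
      show "weight (insert a B) (contract_mult A a m) (\<lambda>_. 0) < weight V m (\<lambda>_. 0)"
        using weight_contract_less[OF fin disj m a A(2), of "\<lambda>_. 0"] V z by simp
    qed (use fin mult_contract[OF m] in auto)
    fix g assume g: "3 dvd (\<Sum>x\<in>A. b x - (\<Sum>y\<in>B. g x y))"
    show "orientable A m (\<lambda>x. b x - (\<Sum>y\<in>B. g x y))"
    proof (rule IH[OF fin(1) m rich g])
      have "card A < card V" using A finV by (intro psubset_card_mono) auto
      moreover have "(\<Sum>x\<in>A. \<Sum>v\<in>A. m x v) \<le> (\<Sum>x\<in>V. \<Sum>v\<in>V. m x v)"
      proof -
        have "(\<Sum>x\<in>A. \<Sum>v\<in>A. m x v) \<le> (\<Sum>x\<in>A. \<Sum>v\<in>V. m x v)"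
          by (intro sum_mono sum_mono2) (use A finV multD(2)[OF m] in auto)
        also have "\<dots> \<le> (\<Sum>x\<in>V. \<Sum>v\<in>V. m x v)"
          by (intro sum_mono2) (use A finV multD(2)[OF m] in \<open>auto intro: sum_nonneg\<close>)
        finally show ?thesis .
      qed
      ultimately show "weight A m (\<lambda>_. 0) < weight V m (\<lambda>_. 0)" by (simp add: weight_eq)
    qed
  qed
  then show False using cex V by simp
qed

text \<open>
  If equality held, refining \<open>P\<close> inside \<open>A\<close> would show that the subgraph on
  \<open>A\<close> satisfies the partition condition. The step from 8 to 6 is the parity of the sum.
\<close>

lemma surplus:
  assumes P: "partition_on V P" and A: "A \<in> P" "2 \<le> card A" and P2: "2 \<le> card P"
  shows "8 * int (card P) - 6 \<le> (\<Sum>B\<in>P. cut V m B)"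
proof (rule ccontr)
  assume "\<not> ?thesis"
  moreover have "even (\<Sum>B\<in>P. cut V m B)" by (rule even_partition[OF P finV m])
  ultimately have tight: "(\<Sum>B\<in>P. cut V m B) \<le> 8 * int (card P) - 8" by presburger
  have AV: "A \<subseteq> V" using partition_part(3)[OF P finV A(1)] .
  have "A \<noteq> V"
  proof
    assume "A = V"
    then have "P = {V}" using partition_whole[OF P finV] A(1) by blast
    then show False using P2 by simp
  qed
  moreover have "tree_rich A m"
    unfolding tree_rich_def
  proof (intro allI impI)
    fix Q assume Q: "partition_on A Q"
    note r = refine_partition[OF P A(1) Q finV m]
    show "8 * int (card Q) - 8 \<le> (\<Sum>B\<in>Q. cut A m B)"
      using tree_richD[OF richV r(1)] r(2,3) tight by linarith
  qed
  ultimately show False using no_tree_rich_subset AV A(2) by blast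
qed

text \<open>
  With more edges any edge could be deleted: it crosses every partition at most once, and the
  partitions for which this could matter have an edge to spare.
\<close>

lemma total_degree: "(\<Sum>x\<in>V. \<Sum>v\<in>V. m x v) \<le> 8 * int (card V) - 8"
proof (rule ccontr)
  assume "\<not> ?thesis"
  then have tot: "8 * int (card V) - 6 \<le> (\<Sum>x\<in>V. \<Sum>v\<in>V. m x v)"
    using even_inner[OF finV m] by presburger
  have "(\<Sum>x\<in>V. \<Sum>v\<in>V. m x v) \<noteq> 0" using tot two_vertices by linarith
  then obtain x where x: "x \<in> V" "(\<Sum>v\<in>V. m x v) \<noteq> 0" by (rule sum.not_neutral_contains_not_neutral)
  from x(2) obtain y where y: "y \<in> V" "m x y \<noteq> 0" by (rule sum.not_neutral_contains_not_neutral)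
  have xy: "1 \<le> m x y" using y multD(2)[OF m, of x y] by linarith
  have ne: "x \<noteq> y" using y multD(3)[OF m, of x] by auto
  define m' where "m' = (\<lambda>u v. m u v - edge x y u v)"
  have m': "mult m'" unfolding m'_def by (rule mult_del[OF m ne xy])
  have "orientable V m' (\<lambda>v. b v - 1 * arc x y v)"
  proof (rule IH[OF finV m'])
    show "tree_rich V m'"
      unfolding tree_rich_def
    proof (intro allI impI)
      fix P assume P: "partition_on V P"
      have eq: "(\<Sum>A\<in>P. cut V m' A) = (\<Sum>A\<in>P. cut V m A) - (\<Sum>A\<in>P. cut V (edge x y) A)"
        by (simp add: m'_def cut_diff sum_subtractf)
      note le = sum_cut_edge_le[OF P finV x(1) y(1) ne]
      show "8 * int (card P) - 8 \<le> (\<Sum>A\<in>P. cut V m' A)"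
      proof (cases "2 \<le> card P")
        case False
        have "0 \<le> (\<Sum>A\<in>P. cut V m' A)" by (intro sum_nonneg cut_nonneg m')
        then show ?thesis using False by linarith
      next
        case True
        show ?thesis
        proof (cases "\<exists>A\<in>P. 2 \<le> card A")
          case big: True
          then show ?thesis using surplus[OF P _ _ True] eq le by fastforce
        next
          case False
          then have 2: "P = (\<lambda>x. {x}) ` V" using partition_cases[OF P finV] by blast
          have "(\<Sum>A\<in>P. cut V m A) = (\<Sum>x\<in>V. \<Sum>v\<in>V. m x v)"
            unfolding 2 sum_singletons by (intro sum.cong refl cut_singleton finV m)
          then show ?thesis using eq le tot sum_singletons(2)[of V] 2 by simp
        qed
      qed
    qed
    show "3 dvd (\<Sum>v\<in>V. b v - 1 * arc x y v)"
      using bal x y finV by (simp add: sum_subtractf sum_arc)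
    show "weight V m' (\<lambda>_. 0) < weight V m (\<lambda>_. 0)"
      using x y finV ne by (simp add: weight_eq m'_def sum_subtractf edge_sum2)
  qed
  from orientable_add_edge[OF finV m' x(1) y(1) ne _ this] show False
    using cex by (simp add: m'_def)
qed

lemma cut_single: "x \<in> V \<Longrightarrow> cut V m {x} = (\<Sum>v\<in>V. m x v)"
  by (rule cut_singleton[OF finV m])

lemma half_surplus:
  assumes A: "A \<subseteq> V" "A \<noteq> {}" "2 \<le> card (V - A)"
  shows "8 * int (card A) + 2 \<le> (\<Sum>x\<in>A. \<Sum>v\<in>V. m x v) + cut V m A"
proof -
  have fA: "finite A" using A finV finite_subset by blast
  define P where "P = insert (V - A) ((\<lambda>x. {x}) ` A)"
  have nin: "V - A \<notin> (\<lambda>x. {x}) ` A" using A by auto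
  have P: "partition_on V P" unfolding P_def partition_on_def disjoint_def using A by auto
  have c: "card P = Suc (card A)" using nin fA sum_singletons(2)[of A] by (simp add: P_def)
  have "card A \<noteq> 0" using A fA by auto
  then have "8 * int (card P) - 6 \<le> (\<Sum>B\<in>P. cut V m B)"
    using A c by (intro surplus[OF P, of "V - A"]) (auto simp: P_def)
  moreover have "(\<Sum>B\<in>P. cut V m B) = cut V m A + (\<Sum>x\<in>A. \<Sum>v\<in>V. m x v)"
    unfolding P_def using nin fA cut_compl[OF m A(1)] cut_single A(1)
    by (simp add: sum_singletons subset_iff)
  ultimately show ?thesis using c by simp
qed

text \<open>
  Apply the surplus to the two partitions that keep one side of the cut and split the other into
  single vertices, and compare with the total degree.
\<close>

lemma big_cut:
  assumes A: "A \<subseteq> V" "2 \<le> card A" "2 \<le> card (V - A)"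
  shows "6 \<le> cut V m A"
proof -
  have "V - (V - A) = A" using A by auto
  moreover have "A \<noteq> {}" "V - A \<noteq> {}" using A(2,3) by (metis card.empty not_numeral_le_zero)+
  ultimately have "8 * int (card A) + 2 \<le> (\<Sum>x\<in>A. \<Sum>v\<in>V. m x v) + cut V m A"
    "8 * int (card (V - A)) + 2 \<le> (\<Sum>x\<in>V-A. \<Sum>v\<in>V. m x v) + cut V m A"
    using half_surplus[of A] half_surplus[of "V - A"] A(1,2,3) cut_compl[OF m A(1)] by simp_all
  moreover have "(\<Sum>x\<in>V. \<Sum>v\<in>V. m x v) = (\<Sum>x\<in>V-A. \<Sum>v\<in>V. m x v) + (\<Sum>x\<in>A. \<Sum>v\<in>V. m x v)"
    by (rule sum.subset_diff[OF A(1) finV])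
  moreover have "card V = card A + card (V - A)"
    using A finV card_mono[OF finV A(1)] by (simp add: card_Diff_subset finite_subset)
  ultimately show ?thesis using total_degree by linarith
qed

lemma few_parallel:
  assumes "x \<in> V" "y \<in> V" "x \<noteq> y"
  shows "m x y \<le> 3"
proof (rule ccontr)
  assume "\<not> m x y \<le> 3"
  then have m4: "4 \<le> m x y" by simp
  show False
  proof (cases "V = {x, y}")
    case True
    then have "orientable V m b" using orientable_pair[OF assms(3) m] m4 bal assms(3) by simp
    then show False using cex by blast
  next
    case False
    then show False using no_tree_rich_subset[of "{x, y}"] tree_rich_pair[OF assms(3) m m4] assms
        by auto
  qed
qed

lemma min_degree:
  assumes x: "x \<in> V"
  shows "4 \<le> cut V m {x}"
proof -
  have ne: "V - {x} \<noteq> {}"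
  proof
    assume "V - {x} = {}"
    then have "V = {x}" using x by auto
    then show False using two_vertices by simp
  qed
  have "partition_on (V - {x}) {V - {x}}" using ne by (simp add: partition_on_space)
  from partition_insert_vertex[OF this x] have P: "partition_on V {{x}, V - {x}}" .
  have "{x} \<noteq> V - {x}" by auto
  then show ?thesis using tree_richD[OF richV P] cut_compl[OF m, of "{x}" V] x by simp
qed

text \<open>
  Here \<open>g\<close> describes the directions of the edges at \<open>x\<close>.
\<close>

lemma reinsert:
  assumes x: "x \<in> V" and "\<And>v. v \<in> V - {x} \<Longrightarrow> attainable (m v x) (g v)" "3 dvd (sum g (V - {x}) + b x)"
  shows "\<not> orientable (V - {x}) m (\<lambda>v. b v - g v)"
proof
  assume "orientable (V - {x}) m (\<lambda>v. b v - g v)"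
  then have "orientable (insert x (V - {x})) m b"
    using finV m assms by (intro orientable_add_vertex[where g = g]) auto
  then show False using cex x by (simp add: insert_absorb)
qed

lemma removed_size:
  assumes x: "x \<in> V"
  shows "weight V m (\<lambda>_. 0) = weight (V - {x}) m (\<lambda>_. 0) + 1 + 2 * cut V m {x}"
proof -
  have "card V = Suc (card (V - {x}))" using finV x by (metis card.remove)
  then show ?thesis using sum_vertex_removed[OF finV m x] by (simp add: weight_eq cut_def)
qed

text \<open>
  Removing \<open>x\<close> keeps the partition condition, since adding the part \<open>{x}\<close> costs four
  crossing edges. The edges at \<open>x\<close> attain any demand.
\<close>

lemma degree_not_4:
  assumes x: "x \<in> V"
  shows "cut V m {x} \<noteq> 4"
proof
  assume c4: "cut V m {x} = 4"
  define W where "W = V - {x}"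
  have fW: "finite W" using finV by (simp add: W_def)
  have "(\<Sum>v\<in>W. m v x) = 4" using c4 multD(1)[OF m, of _ x] by (simp add: cut_def W_def)
  then obtain g where g: "\<forall>v\<in>W. attainable (m v x) (g v)" "3 dvd (sum g W - - b x)"
    using attainable_sum_split[OF fW, of "\<lambda>v. m v x"
        "- b x"] multD(2)[OF m] by (auto simp: attainable_ge2)
  have "orientable W m (\<lambda>v. b v - g v)"
  proof (rule IH[OF fW m])
    show "tree_rich W m"
      unfolding tree_rich_def
    proof (intro allI impI)
      fix P assume P: "partition_on W P"
      then have P': "partition_on (V - {x}) P" by (simp add: W_def)
      show "8 * int (card P) - 8 \<le> (\<Sum>A\<in>P. cut W m A)"
        using tree_richD[OF richV partition_insert_vertex[OF P' x]] partition_insert_card[OF P' finV x]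
          sum_partition_insert[OF P' finV m x] c4 by (simp add: W_def)
    qed
    show "3 dvd (\<Sum>v\<in>W. b v - g v)"
      using g(2) bal sum.remove[OF finV x, of b] by (simp add: W_def sum_subtractf) presburger
    show "weight W m (\<lambda>_. 0) < weight V m (\<lambda>_. 0)" using removed_size[OF x] c4 by (simp add: W_def)
  qed
  then show False using reinsert[OF x, of g] g by (simp add: W_def)
qed

text \<open>
  Now removing \<open>x\<close> loses one edge too many, but only for the partition into singletons, as
  all others have a surplus. A single edge lifted between two distinct neighbours repairs this; the
  three remaining edges at \<open>x\<close> attain any demand.
\<close>

lemma degree_not_5:
  assumes x: "x \<in> V"
  shows "cut V m {x} \<noteq> 5"
proof
  assume c5: "cut V m {x} = 5"
  define W where "W = V - {x}"
  have fW: "finite W" using finV by (simp add: W_def)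
  have sW: "(\<Sum>v\<in>W. m x v) = 5" using c5 by (simp add: cut_def W_def)
  then have "(\<Sum>v\<in>W. m x v) \<noteq> 0" by simp
  then obtain y where y: "y \<in> W" "m x y \<noteq> 0" by (rule sum.not_neutral_contains_not_neutral)
  have "m x y \<le> 3" using few_parallel[OF x, of y] y by (auto simp: W_def)
  then have "(\<Sum>v\<in>W - {y}. m x v) \<noteq> 0" using sum.remove[OF fW y(1), of "m x"] sW by linarith
  then obtain z where z: "z \<in> W - {y}" "m x z \<noteq> 0" by (rule sum.not_neutral_contains_not_neutral)
  have ge: "1 \<le> m x y" "1 \<le> m x z" using y z multD(2)[OF m, of x] by (smt (verit))+
  have yz: "y \<in> W" "z \<in> W" "y \<noteq> z" using y z by auto
  define r where "r v = m v x - of_bool (v = y) - of_bool (v = z)" for v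
  have "sum r W = 3"
    using yz sW multD(1)[OF m, of _ x] fW by (simp add: r_def sum_subtractf sum_of_bool_eq)
  moreover have r0: "0 \<le> r v" for v
    using ge yz multD(1)[OF m, of v x] multD(2)[OF m, of v x] by (auto simp: r_def)
  ultimately obtain g where g: "\<forall>v\<in>W. attainable (r v) (g v)" "3 dvd (sum g W - - b x)"
    using attainable_sum_split[OF fW, of r "- b x"] by (auto simp: attainable_ge2)
  define m' where "m' = (\<lambda>u v. m u v + edge y z u v)"
  have "orientable W m' (\<lambda>v. b v - g v)"
  proof (rule IH[OF fW])
    show "mult m'" unfolding m'_def by (rule mult_edge[OF m yz(3)])
    show "tree_rich W m'"
      unfolding tree_rich_def
    proof (intro allI impI)
      fix P assume P: "partition_on W P"
      then have P': "partition_on (V - {x}) P" by (simp add: W_def)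
      have eq: "(\<Sum>A\<in>P. cut W m' A) = (\<Sum>A\<in>P. cut W m A) + (\<Sum>A\<in>P. cut W (edge y z) A)"
        by (simp add: m'_def cut_add sum.distrib)
      have e0: "0 \<le> (\<Sum>A\<in>P. cut W (edge y z) A)"
        unfolding cut_def edge_def by (intro sum_nonneg) auto
      have P1: "partition_on V (insert {x} P)" by (rule partition_insert_vertex[OF P' x])
      have cP: "card (insert {x} P) = Suc (card P)" by (rule partition_insert_card[OF P' finV x])
      have sP: "(\<Sum>A\<in>insert {x} P. cut V m A) = 10 + (\<Sum>A\<in>P. cut W m A)"
        using sum_partition_insert[OF P' finV m x] c5 by (simp add: W_def)
      have "P \<noteq> {}" using partition_onD1[OF P] yz by auto
      then have "card P \<noteq> 0" using partition_part(1)[OF P fW] by simp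
      then have two: "2 \<le> card (insert {x} P)" using cP by simp
      show "8 * int (card P) - 8 \<le> (\<Sum>A\<in>P. cut W m' A)"
      proof (cases "\<exists>A\<in>P. 2 \<le> card A")
        case True
        then obtain A where "A \<in> P" "2 \<le> card A" by blast
        then have "8 * int (card (insert {x} P)) - 6 \<le> (\<Sum>A\<in>insert {x} P. cut V m A)"
          by (intro surplus[OF P1 _ _ two, of A]) auto
        then show ?thesis using cP sP eq e0 by linarith
      next
        case False
        then have 2: "P = (\<lambda>x. {x}) ` W" using partition_cases[OF P fW] by blast
        have "mult (edge y z)" using yz by (auto simp: mult_def edge_def)
        then have "(\<Sum>A\<in>P. cut W (edge y z) A) = 2"
          unfolding 2 sum_singletons using yz fW by (simp add: cut_singleton edge_sum2)
        then show ?thesis using tree_richD[OF richV P1] cP sP eq by linarith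
      qed
    qed
    show "3 dvd (\<Sum>v\<in>W. b v - g v)"
      using g(2) bal sum.remove[OF finV x, of b] by (simp add: W_def sum_subtractf) presburger
    show "weight W m' (\<lambda>_. 0) < weight V m (\<lambda>_. 0)"
      using removed_size[OF x] c5 yz fW
      by (simp add: W_def m'_def weight_eq sum.distrib edge_sum2)
  qed
  then obtain s where s: "s = 1 \<or> s = -1" "orientable W m (\<lambda>v. (b v - g v) - s * arc y z v)"
    using orientable_remove_edge[OF fW m yz, folded m'_def] by blast
  define h where "h v = g v + s * arc y z v" for v
  have "attainable (m v x) (h v)" if "v \<in> W" for v
  proof -
    have a: "attainable (r v + 1) (g v + s)" "attainable (r v + 1) (g v - s)"
      using attainable_add[OF r0, of s v "g v"] attainable_add[OF r0, of "- s" v "g v"] s(1) g(1)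
          that by auto
    then show ?thesis using g(1) that yz(3) by (auto simp: h_def arc_def r_def)
  qed
  moreover have "sum h W = sum g W"
    using fW yz by (simp add: h_def sum.distrib sum_distrib_left[symmetric] sum_arc)
  moreover have "orientable W m (\<lambda>v. b v - h v)" using s(2) by (simp add: h_def diff_diff_eq)
  ultimately show False using reinsert[OF x, of h] g(2) by (simp add: W_def)
qed

lemma contradiction: False
proof -
  have deg: "6 \<le> cut V m {x}" if "x \<in> V" for x
    using min_degree[OF that] degree_not_4[OF that] degree_not_5[OF that] by linarith
  have "6 \<le> cut V m A" if A: "A \<subseteq> V" "A \<noteq> {}" "A \<noteq> V" for A
  proof -
    have single: "\<exists>x. B = {x}" if "finite B" "B \<noteq> {}" "\<not> 2 \<le> card B" for B :: "'v set"
    proof -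
      have "card B \<noteq> 0" using that by auto
      then have "card B = 1" using that(3) by linarith
      then show ?thesis by (simp add: card_1_singleton_iff)
    qed
    have fin: "finite A" "finite (V - A)" using A finV finite_subset by auto
    consider "2 \<le> card A" "2 \<le> card (V - A)" | x where "A = {x}" | x where "V - A = {x}"
      using single[of A] single[of "V - A"] A fin by blast
    then show ?thesis
    proof cases
      case 1
      then show ?thesis using big_cut A by blast
    next
      case 2
      then show ?thesis using deg A by auto
    next
      case 3
      then show ?thesis using deg[of x] cut_compl[OF m A(1)] by auto
    qed
  qed
  then show False using orientable_if_six_edge_connected[OF finV m bal] cex by blast
qed

end

theorem orientable_if_tree_rich:
  assumes "finite V" "mult m" "tree_rich V m" "3 dvd sum b V"
  shows "orientable V m b"
  using assms
proof (induction "nat (weight V m (\<lambda>_. 0))" arbitrary: V m b rule: less_induct)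
  case less
  show ?case
  proof (rule ccontr)
    assume "\<not> ?thesis"
    then have "minimal_unorientable V m b"
    proof unfold_locales
      fix V' :: "'a set" and m' and b' :: "'a \<Rightarrow> int"
      assume *: "finite V'" "mult m'" "tree_rich V' m'" "3 dvd sum b' V'"
        "weight V' m' (\<lambda>_. 0) < weight V m (\<lambda>_. 0)"
      have "0 \<le> weight V' m' (\<lambda>_. 0)"
        unfolding weight_def using multD(2)[OF *(2)] by (intro sum_nonneg add_nonneg_nonneg) auto
      then have "nat (weight V' m' (\<lambda>_. 0)) < nat (weight V m (\<lambda>_. 0))" using * by simp
      then show "orientable V' m' b'" using * by (intro less.hyps)
    qed (use less.prems in auto)
    then show False by (rule minimal_unorientable.contradiction)
  qed
qed

section \<open>From the cut conditions with minimum degree 5 to partitions\<close>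

definition has_edge :: "('v \<Rightarrow> 'v \<Rightarrow> int) \<Rightarrow> 'v set \<Rightarrow> bool" where
  "has_edge m A \<longleftrightarrow> (\<exists>x\<in>A. \<exists>y\<in>A. m x y \<noteq> 0)"

definition essential_cuts :: "'v set \<Rightarrow> ('v \<Rightarrow> 'v \<Rightarrow> int) \<Rightarrow> bool" where
  "essential_cuts V m \<longleftrightarrow> (\<forall>A. A \<subseteq> V \<longrightarrow> A \<noteq> {} \<longrightarrow> A \<noteq> V \<longrightarrow> 4 \<le> cut V m A) \<and>
     (\<forall>A. A \<subseteq> V \<longrightarrow> has_edge m A \<longrightarrow> has_edge m (V - A) \<longrightarrow> 23 \<le> cut V m A)"

lemma essential_cutsD: "essential_cuts V m \<Longrightarrow> A \<subseteq> V \<Longrightarrow> A \<noteq> {} \<Longrightarrow> A \<noteq> V \<Longrightarrow> 4 \<le> cut V m A"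
  "essential_cuts V m \<Longrightarrow> A \<subseteq> V \<Longrightarrow> has_edge m A \<Longrightarrow> has_edge m (V - A) \<Longrightarrow> 23 \<le> cut V m A"
  by (auto simp: essential_cuts_def)

lemma has_edgeI: "x \<in> A \<Longrightarrow> y \<in> A \<Longrightarrow> m x y \<noteq> 0 \<Longrightarrow> has_edge m A"
  by (auto simp: has_edge_def)

lemma has_edge_mono: "has_edge m A \<Longrightarrow> A \<subseteq> B \<Longrightarrow> has_edge m B"
  by (auto simp: has_edge_def)

lemma cut_independent:
  assumes "finite V" "mult m" "A \<subseteq> V" "\<not> has_edge m A"
  shows "cut V m A = (\<Sum>x\<in>A. cut V m {x})"
proof -
  have "(\<Sum>u\<in>A. \<Sum>v\<in>A. m u v) = 0" using assms(4) by (auto simp: has_edge_def intro!: sum.neutral)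
  then show ?thesis
    using assms by (simp add: cut_eq_diff multD(3) subset_iff)
qed

lemma cut_pair:
  assumes "finite V" "mult m" "x \<in> V" "y \<in> V" "x \<noteq> y"
  shows "cut V m {x, y} = cut V m {x} + cut V m {y} - 2 * m x y"
  using assms multD(1)[OF assms(2), of y x] by (simp add: cut_eq_diff multD(3))

lemma degree_ge_sum:
  assumes "finite V" "mult m" "x \<in> V" "B \<subseteq> V"
  shows "(\<Sum>v\<in>B. m x v) \<le> cut V m {x}"
  unfolding cut_singleton[OF assms(1-3)] using assms multD(2)[OF assms(2)] by (intro sum_mono2) auto

text \<open>
  Give each crossing edge the charge 1 / d A + 1 / d B, where A and B are the parts that it joins. The
  charges add up to the number of parts, and each is at most 1/4.
\<close>

lemma charge:
  fixes M :: "'p \<Rightarrow> 'p \<Rightarrow> real"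
  assumes fin: "finite P" and sym: "\<And>A B. A \<in> P \<Longrightarrow> B \<in> P \<Longrightarrow> M A B = M B A"
    and nn: "\<And>A B. A \<in> P \<Longrightarrow> B \<in> P \<Longrightarrow> 0 \<le> M A B"
    and d: "\<And>A. A \<in> P \<Longrightarrow> d A = (\<Sum>B\<in>P. M A B)" and pos: "\<And>A. A \<in> P \<Longrightarrow> 4 < d A"
    and ch: "\<And>A B. A \<in> P \<Longrightarrow> B \<in> P \<Longrightarrow> M A B \<noteq> 0 \<Longrightarrow> 16 \<le> (d A - 4) * (d B - 4)"
  shows "8 * real (card P) \<le> (\<Sum>A\<in>P. d A)"
proof -
  have w: "M A B / d A + M A B / d B \<le> M A B / 4" if "A \<in> P" "B \<in> P" for A B
  proof (cases "M A B = 0")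
    case False
    have p: "0 < d A" "0 < d B" using pos[of A] pos[of B] that by auto
    have "4 * (d A + d B) \<le> d A * d B" using ch[OF that False] by (simp add: algebra_simps)
    then have "1 / d A + 1 / d B \<le> 1 / 4" using p by (simp add: field_simps)
    then have "M A B * (1 / d A + 1 / d B) \<le> M A B * (1 / 4)"
      using nn[OF that] by (intro mult_left_mono)
    then show ?thesis by (simp add: algebra_simps)
  qed simp
  have c: "real (card P) = (\<Sum>A\<in>P. \<Sum>B\<in>P. M A B / d A)"
  proof -
    have "(\<Sum>A\<in>P. \<Sum>B\<in>P. M A B / d A) = (\<Sum>A\<in>P. d A / d A)"
      by (intro sum.cong refl) (simp add: sum_divide_distrib[symmetric] d[symmetric])
    also have "\<dots> = (\<Sum>A\<in>P. 1)" using pos by (intro sum.cong) fastforce+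
    finally show ?thesis by simp
  qed
  have c': "real (card P) = (\<Sum>A\<in>P. \<Sum>B\<in>P. M A B / d B)"
  proof -
    have "(\<Sum>A\<in>P. \<Sum>B\<in>P. M A B / d B) = (\<Sum>B\<in>P. \<Sum>A\<in>P. M A B / d B)" by (rule sum.swap)
    also have "\<dots> = real (card P)" unfolding c by (intro sum.cong refl) (simp add: sym)
    finally show ?thesis by simp
  qed
  have "2 * real (card P) = (\<Sum>A\<in>P. \<Sum>B\<in>P. M A B / d A + M A B / d B)"
    using c c' by (simp add: sum.distrib)
  also have "\<dots> \<le> (\<Sum>A\<in>P. \<Sum>B\<in>P. M A B / 4)" by (intro sum_mono w)
  also have "\<dots> = (\<Sum>A\<in>P. d A) / 4" using d by (simp add: sum_divide_distrib)
  finally show ?thesis by simp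
qed

lemma prod_bound:
  fixes a b :: real
  assumes "5 \<le> a" "5 \<le> b" "25 \<le> a + b"
  shows "16 \<le> (a - 4) * (b - 4)"
proof -
  have "0 \<le> (a - 5) * (b - 5)" using assms by simp
  then show ?thesis using assms by (simp add: algebra_simps)
qed

text \<open>
  The exceptional case of two adjacent vertices that meet all edges, so that the boundary of the pair
  is not an essential cut. Every other vertex has all its edges to \<open>a\<close> and
  \<open>b\<close>, so five or more vertices have enough edges. With four vertices the cut condition is
  used once more: an edge \<open>a p\<close> disjoint from an edge \<open>b q\<close> makes a degree large, and
  without such a pair \<open>a\<close> and \<open>b\<close> are joined by at least five edges.
\<close>

lemma star_bound:
  assumes fin: "finite V" and m: "mult m" and ess: "essential_cuts V m"
    and deg: "\<And>x. x \<in> V \<Longrightarrow> 5 \<le> cut V m {x}"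
    and ab: "a \<in> V" "b \<in> V" "a \<noteq> b" "m a b \<noteq> 0" and ne: "\<not> has_edge m (V - {a, b})"
  shows "8 * int (card V) - 8 \<le> (\<Sum>x\<in>V. cut V m {x})"
proof -
  define I where "I = V - {a, b}"
  have fI: "finite I" "I \<subseteq> V" using fin by (auto simp: I_def)
  have cV: "card V = card I + 2"
    using ab fin card_mono[OF fin, of "{a, b}"] by (simp add: I_def card_Diff_subset)
  define S where "S = (\<Sum>x\<in>I. cut V m {x})"
  define D where "D = (\<Sum>x\<in>V. cut V m {x})"
  have "cut V m I = S" unfolding S_def by (rule cut_independent[OF fin m fI(2)]) (use ne in \<open>simp
      add: I_def\<close>)
  moreover have "cut V m I = cut V m {a, b}" unfolding I_def by (rule cut_compl[OF m]) (use ab in auto)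
  ultimately have Sab: "S = cut V m {a} + cut V m {b} - 2 * m a b"
    using cut_pair[OF fin m ab(1-3)] by simp
  have DS: "D = S + cut V m {a} + cut V m {b}"
    using sum.subset_diff[of "{a, b}" V "\<lambda>x. cut V m {x}"] ab fin by (simp add: D_def S_def I_def)
  have m1: "1 \<le> m a b" using ab(4) multD(2)[OF m, of a b] by linarith
  have S5: "5 * int (card I) \<le> S"
    unfolding S_def using sum_mono[of I "\<lambda>_. 5"
        "\<lambda>x. cut V m {x}"] deg fI by (simp add: subset_iff mult.commute)
  have dab: "5 \<le> cut V m {a}" "5 \<le> cut V m {b}" using deg ab by auto
  consider "card I = 0" | "card I = 1" | "card I = 2" | "3 \<le> card I" by linarith
  then have "8 * int (card V) - 8 \<le> D"
  proof cases
    case 1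
    then show ?thesis using DS dab cV S5 by simp
  next
    case 2
    then show ?thesis using DS Sab dab cV S5 m1 by simp presburger
  next
    case 4
    then show ?thesis using DS Sab cV S5 m1 by simp
  next
    case 3
    then obtain i j where ij: "I = {i, j}" "i \<noteq> j" by (auto simp: card_2_iff)
    have inV: "i \<in> V" "j \<in> V" "i \<noteq> a" "i \<noteq> b" "j \<noteq> a" "j \<noteq> b" using ij by (auto simp: I_def)
    have V: "V = {a, b, i, j}" using ij ab by (auto simp: I_def)
    have mij: "m i j = 0" using ne ij has_edgeI[of i I j m] by (auto simp: I_def)
    have dist: "a \<noteq> b" "a \<noteq> i" "a \<noteq> j" "b \<noteq> i" "b \<noteq> j" "i \<noteq> j" using inV ij ab by auto
    have dd: "cut V m {x} = m x a + m x b + m x i + m x j" if "x \<in> V" for x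
      using cut_singleton[OF fin m that] dist by (simp add: V)
    note sym = multD(1)[OF m, of b a] multD(1)[OF m, of i a] multD(1)[OF m, of j a]
      multD(1)[OF m, of i b] multD(1)[OF m, of j b] multD(1)[OF m, of j i]
    have far: "20 \<le> cut V m {a} \<or> 6 \<le> cut V m {p}" if pq: "p \<in> I" "q \<in> I" "p \<noteq> q" "m a p \<noteq> 0"
        "m b q \<noteq> 0" for p q
    proof -
      have pV: "p \<in> V" "q \<in> V" "a \<noteq> p" "b \<noteq> p" "a \<noteq> q" "b \<noteq> q" using pq by (auto simp: I_def)
      have "23 \<le> cut V m {a, p}"
      proof (rule essential_cutsD(2)[OF ess])
        show "has_edge m {a, p}" using pq by (intro has_edgeI[of a _ p]) auto
        show "has_edge m (V - {a, p})" using pq pV ab by (intro has_edgeI[of b _ q]) auto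
      qed (use ab pV in auto)
      moreover have "1 \<le> m a p" using pq multD(2)[OF m, of a p] by linarith
      ultimately show ?thesis using cut_pair[OF fin m ab(1) pV(1,3)] by linarith
    qed
    have star: ?thesis if "5 \<le> m a b"
      using that DS Sab cV S5 3 by simp
    show ?thesis
    proof (cases "20 \<le> cut V m {a} \<or> 6 \<le> cut V m {i} \<or> 6 \<le> cut V m {j}")
      case True
      moreover have "S = cut V m {i} + cut V m {j}" using ij by (simp add: S_def)
      ultimately show ?thesis
        using DS Sab cV 3 m1 dab deg[OF inV(1)] deg[OF inV(2)] by auto
    next
      case False
      have no: "m a p = 0 \<or> m b q = 0" if "p \<in> I" "q \<in> I" "p \<noteq> q" for p q
        using far[OF that] False ij that by auto
      have nn: "m a i = 0 \<or> m b j = 0" "m a j = 0 \<or> m b i = 0" using no ij by auto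
      have d: "5 \<le> m a b + m a i + m a j" "5 \<le> m a b + m b i + m b j" "5 \<le> m a i + m b i"
          "5 \<le> m a j + m b j"
        using dd[OF ab(1)] dd[OF ab(2)] dd[OF inV(1)] dd[OF inV(2)] deg[OF ab(1)] deg[OF ab(2)]
          deg[OF inV(1)] deg[OF inV(2)] sym mij multD(3)[OF m] by auto
      have "5 \<le> m a b" using nn d by linarith
      then show ?thesis by (rule star)
    qed
  qed
  then show ?thesis by (simp add: D_def)
qed

text \<open>
  Take a violating partition with as many parts as possible. A part without edges could be split into
  single vertices, so each part is a single vertex or contains an edge.
\<close>

lemma tree_rich_if_min_degree_5:
  assumes fin: "finite V" and m: "mult m" and ess: "essential_cuts V m"
    and deg: "\<And>x. x \<in> V \<Longrightarrow> 5 \<le> cut V m {x}"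
  shows "tree_rich V m"
proof (rule ccontr)
  assume "\<not> tree_rich V m"
  define bad where "bad P \<longleftrightarrow> partition_on V P \<and> (\<Sum>A\<in>P. cut V m A) < 8 * int (card P) - 8" for P
  obtain P0 where P0: "bad P0" using \<open>\<not> tree_rich V m\<close> by (auto simp: tree_rich_def bad_def not_le)
  have "card P \<le> card V" if "bad P" for P
  proof -
    have P: "partition_on V P" using that by (simp add: bad_def)
    have "card P = (\<Sum>A\<in>P. 1)" by simp
    also have "\<dots> \<le> (\<Sum>A\<in>P. \<Sum>x\<in>A. 1)"
      using partition_part[OF P fin] by (intro sum_mono) (simp add: Suc_le_eq card_gt_0_iff)
    also have "\<dots> = card V" by (simp only: partition_sum[OF P fin]) simp
    finally show ?thesis .
  qed
  then obtain P where bP: "bad P" and max: "\<And>Q. bad Q \<Longrightarrow> card Q \<le> card P"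
    using ex_has_greatest_nat[of bad P0 card "Suc (card V)"] P0 by (auto simp: less_Suc_eq_le)
  have P: "partition_on V P" and lt: "(\<Sum>A\<in>P. cut V m A) < 8 * int (card P) - 8"
    using bP by (auto simp: bad_def)
  note pP = partition_part[OF P fin]
  have "0 \<le> (\<Sum>A\<in>P. cut V m A)" by (intro sum_nonneg cut_nonneg m)
  then have P2: "2 \<le> card P" using lt by linarith
  have part: "has_edge m A \<or> (\<exists>x. A = {x})" if A: "A \<in> P" for A
  proof (rule ccontr)
    assume n: "\<not> (has_edge m A \<or> (\<exists>x. A = {x}))"
    have "card A \<noteq> 0" using pP(2,4)[OF A] by simp
    moreover have "card A \<noteq> 1" using n by (auto simp: card_1_singleton_iff)
    ultimately have c2: "2 \<le> card A" by linarith
    note r = refine_partition[OF P A partition_singletons fin m]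
    have "(\<Sum>B\<in>(\<lambda>x. {x}) ` A. cut A m B) = 0"
      unfolding sum_singletons using n by (auto simp: has_edge_def cut_def intro!: sum.neutral)
    then have "bad (P - {A} \<union> (\<lambda>x. {x}) ` A)"
      unfolding bad_def using r lt c2 sum_singletons(2)[of A] by auto
    then show False using max[of "P - {A} \<union> (\<lambda>x. {x}) ` A"] r(2) sum_singletons(2)[of A] c2 by linarith
  qed
  have disj: "A \<inter> B = {}" if "A \<in> P" "B \<in> P" "A \<noteq> B" for A B
    using disjointD[OF partition_onD2[OF P] that] .
  have one: "has_edge m (V - A)" if A: "A \<in> P" "has_edge m A" for A
  proof (rule ccontr)
    assume n: "\<not> has_edge m (V - A)"
    have sub: "A \<subseteq> V" using pP(3)[OF A(1)] .
    have single: "\<exists>x. B = {x}" if B: "B \<in> P - {A}" for B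
    proof -
      have "B \<subseteq> V - A" using disj[of B A] B A pP(3)[of B] by blast
      then show ?thesis using part[of B] B n has_edge_mono by blast
    qed
    have d5: "5 \<le> cut V m B" if B: "B \<in> P - {A}" for B
    proof -
      obtain x where "B = {x}" using single[OF B] by blast
      then show ?thesis using deg[of x] pP(3)[of B] B by auto
    qed
    have c: "int (card (P - {A})) = int (card P) - 1"
      using card.remove[OF pP(1) A(1)] by simp
    have "(\<Sum>x\<in>V - A. cut V m {x}) = cut V m A"
      using cut_independent[OF fin m _ n] cut_compl[OF m sub] by simp
    moreover have "(\<Sum>x\<in>V - A. cut V m {x}) = (\<Sum>B\<in>P - {A}. cut V m B)"
    proof -
      from partition_sum[OF partition_remove[OF P A(1)], of "\<lambda>x. cut V m {x}"] fin
      have "(\<Sum>x\<in>V - A. cut V m {x}) = (\<Sum>B\<in>P - {A}. \<Sum>x\<in>B. cut V m {x})" by simp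
      also have "\<dots> = (\<Sum>B\<in>P - {A}. cut V m B)"
      proof (rule sum.cong[OF refl])
        fix B assume "B \<in> P - {A}"
        then obtain x where "B = {x}" using single by blast
        then show "(\<Sum>x\<in>B. cut V m {x}) = cut V m B" by simp
      qed
      finally show ?thesis .
    qed
    moreover have "(\<Sum>B\<in>P. cut V m B) = cut V m A + (\<Sum>B\<in>P - {A}. cut V m B)"
      by (rule sum.remove[OF pP(1) A(1)])
    moreover have "5 * int (card (P - {A})) \<le> (\<Sum>B\<in>P - {A}. cut V m B)"
      using sum_mono[of "P - {A}" "\<lambda>_. 5" "cut V m"] d5 by (simp add: mult.commute)
    ultimately show False using lt c P2 by linarith
  qed
  have big: "23 \<le> cut V m A" if "A \<in> P" "has_edge m A" for A
    using essential_cutsD(2)[OF ess pP(3)] one that by blast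
  have ge5: "5 \<le> cut V m A" if "A \<in> P" for A
    using part[OF that] big[OF that] deg pP(3)[OF that] by auto
  have pair: "25 \<le> cut V m A + cut V m B"
    if AB: "A \<in> P" "B \<in> P" "A \<noteq> B" and e: "x \<in> A" "y \<in> B" "m x y \<noteq> 0" for A B x y
  proof (cases "has_edge m A \<or> has_edge m B")
    case True
    then show ?thesis using big[OF AB(1)] big[OF AB(2)] ge5[OF AB(1)] ge5[OF AB(2)] by auto
  next
    case False
    then have AB1: "A = {x}" "B = {y}" using part[OF AB(1)] part[OF AB(2)] e by auto
    have xy: "x \<in> V" "y \<in> V" "x \<noteq> y" using AB1 AB pP(3) by auto
    have m1: "1 \<le> m x y" using e(3) multD(2)[OF m, of x y] by linarith
    show ?thesis
    proof (cases "has_edge m (V - {x, y})")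
      case True
      have "23 \<le> cut V m {x, y}"
        by (rule essential_cutsD(2)[OF ess _ _ True]) (use xy e in \<open>auto intro: has_edgeI\<close>)
      then show ?thesis using cut_pair[OF fin m xy] m1 AB1 by simp
    next
      case False
      have "\<exists>z. C = {z}" if C: "C \<in> P" for C
      proof (cases "C = {x} \<or> C = {y}")
        case c: False
        then have "C \<subseteq> V - {x, y}" using disj[OF C AB(1)] disj[OF C AB(2)] AB1 pP(3)[OF C] by blast
        then show ?thesis using part[OF C] has_edge_mono False by blast
      qed auto
      then have "\<not> (\<exists>C\<in>P. 2 \<le> card C)" by fastforce
      then have "P = (\<lambda>x. {x}) ` V" using partition_cases[OF P fin] by blast
      then have "(\<Sum>A\<in>P. cut V m A) = (\<Sum>x\<in>V. cut V m {x})" "card P = card V"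
        using sum_singletons[where V = V] by auto
      then show ?thesis
        using star_bound[OF fin m ess deg xy e(3) False] lt by linarith
    qed
  qed
  define M where "M A B = (if A = B then 0 else real_of_int (\<Sum>u\<in>A. \<Sum>v\<in>B. m u v))" for A B
  have "8 * real (card P) \<le> (\<Sum>A\<in>P. real_of_int (cut V m A))"
  proof (rule charge[OF pP(1), where M = M])
    fix A B assume AB: "A \<in> P" "B \<in> P"
    have "(\<Sum>u\<in>A. \<Sum>v\<in>B. m u v) = (\<Sum>v\<in>B. \<Sum>u\<in>A. m u v)" by (rule sum.swap)
    also have "\<dots> = (\<Sum>v\<in>B. \<Sum>u\<in>A. m v u)" by (intro sum.cong refl multD(1)[OF m])
    finally show "M A B = M B A" by (simp add: M_def)
    show "0 \<le> M A B" unfolding M_def using multD(2)[OF m] by (auto intro!: sum_nonneg)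
    assume MAB: "M A B \<noteq> 0"
    then have ne: "A \<noteq> B" by (auto simp: M_def)
    have "\<exists>x\<in>A. \<exists>y\<in>B. m x y \<noteq> 0"
    proof (rule ccontr)
      assume "\<not> ?thesis"
      then have "(\<Sum>u\<in>A. \<Sum>v\<in>B. m u v) = 0" by (auto intro!: sum.neutral)
      then show False using MAB by (simp add: M_def split: if_splits)
    qed
    then obtain x y where "x \<in> A" "y \<in> B" "m x y \<noteq> 0" by blast
    then have "25 \<le> cut V m A + cut V m B" by (rule pair[OF AB ne])
    then show "16 \<le> (real_of_int (cut V m A) - 4) * (real_of_int (cut V m B) - 4)"
      using ge5[OF AB(1)] ge5[OF AB(2)] by (intro prod_bound) linarith+
  next
    fix A assume A: "A \<in> P"
    show "4 < real_of_int (cut V m A)" using ge5[OF A] by linarith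
    have "(\<Sum>v\<in>V - A. m u v) = (\<Sum>B\<in>P - {A}. \<Sum>v\<in>B. m u v)" for u
      using partition_sum[OF partition_remove[OF P A], of "m u"] fin by simp
    then have "cut V m A = (\<Sum>u\<in>A. \<Sum>B\<in>P - {A}. \<Sum>v\<in>B. m u v)"
      by (simp add: cut_def)
    also have "\<dots> = (\<Sum>B\<in>P - {A}. \<Sum>u\<in>A. \<Sum>v\<in>B. m u v)" by (rule sum.swap)
    finally have "real_of_int (cut V m A) = (\<Sum>B\<in>P - {A}. real_of_int (\<Sum>u\<in>A. \<Sum>v\<in>B. m u v))"
      by simp
    also have "\<dots> = (\<Sum>B\<in>P - {A}. M A B)" unfolding M_def
        by (intro sum.cong refl if_not_P[symmetric]) blast
    finally have "real_of_int (cut V m A) = (\<Sum>B\<in>P - {A}. M A B)" .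
    then show "real_of_int (cut V m A) = (\<Sum>B\<in>P. M A B)"
      using sum.remove[OF pP(1) A, of "M A"] by (simp add: M_def)
  qed
  then have "real_of_int (8 * int (card P)) \<le> real_of_int (\<Sum>A\<in>P. cut V m A)" by simp
  then have "8 * int (card P) \<le> (\<Sum>A\<in>P. cut V m A)" by (simp only: of_int_le_iff)
  then show False using lt by linarith
qed

section \<open>Splitting vertices of degree 4\<close>

text \<open>
  Two edges between the same pair of vertices lift to a loop, which is dropped.
\<close>

definition lifted_edge :: "'v \<Rightarrow> 'v \<Rightarrow> 'v \<Rightarrow> 'v \<Rightarrow> int" where
  "lifted_edge a b u v = (if a = b then 0 else edge a b u v)"

lemma edge_eq_0: "edge x y u v = 0 \<longleftrightarrow> \<not> (u = x \<and> v = y \<or> u = y \<and> v = x)"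
  by (simp only: edge_def of_bool_eq_0_iff)

lemma mult_lifted_edge: "mult m \<Longrightarrow> mult (\<lambda>u v. m u v + lifted_edge a b u v)"
  by (auto simp: mult_def edge_def lifted_edge_def)

lemma cut_lifted_edge:
  assumes "finite V" "A \<subseteq> V" "a \<in> V" "b \<in> V"
  shows "cut V (lifted_edge a b) A = of_bool ((a \<in> A) \<noteq> (b \<in> A))"
proof (cases "a = b")
  case True
  then show ?thesis by (simp add: lifted_edge_def cut_def)
next
  case False
  then have "lifted_edge a b = edge a b" by (simp add: lifted_edge_def fun_eq_iff)
  then show ?thesis using cut_edge[OF assms False] by simp
qed

lemma orientable_remove_lifted_edge:
  assumes "finite V" "mult m" "a \<in> V" "b \<in> V" "orientable V (\<lambda>u v. m u v + lifted_edge a b u v) f"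
  shows "\<exists>s. (s = 1 \<or> s = -1) \<and> orientable V m (\<lambda>v. f v - s * arc a b v)"
proof (cases "a = b")
  case True
  then show ?thesis using assms(5) by (auto simp: lifted_edge_def arc_def)
next
  case False
  then show ?thesis using orientable_remove_edge[OF assms(1-4) False] assms(5)
      by (simp add: lifted_edge_def)
qed

lemma neighbour_list:
  assumes "finite W" "\<And>u. u \<in> W \<Longrightarrow> 0 \<le> f u" "sum f W = int n"
  shows "\<exists>ys. length ys = n \<and> set ys \<subseteq> W \<and> (\<forall>u\<in>W. f u = int (count_list ys u))"
  using assms
proof (induction n arbitrary: f)
  case 0
  then show ?case by (intro exI[of _ "[]"]) (simp add: sum_nonneg_eq_0_iff)
next
  case (Suc n)
  have "sum f W \<noteq> 0" using Suc.prems by simp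
  then obtain y where y: "y \<in> W" "f y \<noteq> 0" using sum.not_neutral_contains_not_neutral by blast
  have "1 \<le> f y" using y Suc.prems(2)[OF y(1)] by linarith
  then have "\<exists>ys. length ys = n \<and> set ys \<subseteq> W \<and> (\<forall>u\<in>W. f u - of_bool (u = y) = int (count_list ys u))"
    using Suc.prems y by (intro Suc.IH) (auto simp: sum_subtractf sum_of_bool_eq)
  then obtain ys where ys: "length ys = n" "set ys \<subseteq> W"
      "\<forall>u\<in>W. f u - of_bool (u = y) = int (count_list ys u)"
    by blast
  then have "\<forall>u\<in>W. f u = int (count_list (y # ys) u)" by (auto simp: algebra_simps split: if_splits)
  then show ?case using ys y by (intro exI[of _ "y # ys"]) simp
qed

locale degree_four_vertex =
  fixes V :: "'v set" and m :: "'v \<Rightarrow> 'v \<Rightarrow> int" and s y1 y2 y3 y4 :: 'v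
  assumes finV: "finite V" and m: "mult m" and ess: "essential_cuts V m" and s: "s \<in> V"
    and yW: "y1 \<in> V - {s}" "y2 \<in> V - {s}" "y3 \<in> V - {s}" "y4 \<in> V - {s}"
    and s_mult: "\<And>u. u \<in> V - {s} \<Longrightarrow>
      m s u = of_bool (u = y1) + of_bool (u = y2) + of_bool (u = y3) + of_bool (u = y4)"
begin

definition "W = V - {s}"

lemma finW: "finite W" and WV: "W \<subseteq> V" and sW: "s \<notin> W"
  using finV by (auto simp: W_def)

lemma yWs: "y1 \<in> W" "y2 \<in> W" "y3 \<in> W" "y4 \<in> W"
  using yW by (auto simp: W_def)

lemma sum_ms: "A \<subseteq> W \<Longrightarrow> (\<Sum>u\<in>A. m s u) = of_bool (y1 \<in> A) + of_bool (y2 \<in> A) + of_bool (y3 \<in> A) +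
    of_bool (y4 \<in> A)"
proof -
  assume A: "A \<subseteq> W"
  then have "(\<Sum>u\<in>A. m s u) = (\<Sum>u\<in>A. of_bool (u = y1) + of_bool (u = y2) + of_bool (u
      = y3) + of_bool (u = y4))"
    by (intro sum.cong refl s_mult) (auto simp: W_def)
  then show ?thesis using finite_subset[OF A finW] by (simp add: sum.distrib sum_of_bool_eq)
qed

lemma degree_s: "cut V m {s} = 4"
  using sum_ms[of W] yWs by (simp add: cut_def W_def)

lemma deg4: "x \<in> V \<Longrightarrow> 4 \<le> cut V m {x}"
  by (rule essential_cutsD(1)[OF ess]) (use s yW in auto)

lemma cutW: "A \<subseteq> W \<Longrightarrow> cut V m A = cut W m A + (\<Sum>u\<in>A. m s u)"
  using cut_vertex_removed[OF finV m s, of A] by (simp add: W_def)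

lemma cutWs:
  assumes A: "A \<subseteq> W"
  shows "cut V m (insert s A) = cut W m A + 4 - (\<Sum>u\<in>A. m s u)"
proof -
  have "cut V m (insert s A) = cut W m A + (\<Sum>u\<in>W - A. m s u)"
    using cut_vertex_added[OF finV s, of A m] A by (simp add: W_def)
  moreover have "(\<Sum>u\<in>W. m s u) = (\<Sum>u\<in>W - A. m s u) + (\<Sum>u\<in>A. m s u)"
    by (rule sum.subset_diff[OF A finW])
  moreover have "(\<Sum>u\<in>W. m s u) = 4" using degree_s by (simp add: cut_def W_def)
  ultimately show ?thesis by linarith
qed

lemma neighbour_degree:
  assumes y: "y \<in> W" "m s y \<noteq> 0" and e: "has_edge m (V - {s, y})"
  shows "21 \<le> cut V m {y}"
proof -
  have yV: "y \<in> V" "s \<noteq> y" using y by (auto simp: W_def)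
  have "23 \<le> cut V m {s, y}"
    by (rule essential_cutsD(2)[OF ess _ _ e]) (use y yV s in \<open>auto intro: has_edgeI\<close>)
  moreover have "1 \<le> m s y" using y multD(2)[OF m, of s y] by linarith
  ultimately show ?thesis using cut_pair[OF finV m s yV] degree_s by linarith
qed

lemma other_neighbour:
  assumes y: "y \<in> W" and z: "z \<in> W" "z \<noteq> y" "m s z \<noteq> 0"
  shows "\<exists>x\<in>W. x \<noteq> y \<and> m y x \<noteq> 0"
proof (rule ccontr)
  assume n: "\<not> ?thesis"
  have "cut V m {y} = (\<Sum>v\<in>V. m y v)" by (rule cut_singleton[OF finV m]) (use y W_def in auto)
  also have "\<dots> = (\<Sum>v\<in>{s}. m y v)"
    by (rule sum.mono_neutral_right) (use n s finV multD(3)[OF m, of y] in \<open>auto simp: W_def\<close>)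
  finally have "cut V m {y} = m s y" using multD(1)[OF m, of y s] by simp
  moreover have "m s y + m s z \<le> cut V m {s}"
    using degree_ge_sum[OF finV m s, of "{y, z}"] y z by (auto simp: W_def)
  moreover have "1 \<le> m s z" using z multD(2)[OF m, of s z] by linarith
  ultimately show False using deg4[of y] degree_s y by (auto simp: W_def)
qed

text \<open>
  A set can acquire its first edge by lifting only when it contains two neighbours of \<open>s\<close>. Each
  of them has, by the other one, an edge away from it and hence large degree.
\<close>

lemma independent_large:
  assumes B: "B \<subseteq> W" "\<not> has_edge m B" and yz: "y \<in> B" "z \<in> B" "y \<noteq> z" "m s y \<noteq> 0" "m s z \<noteq> 0"
  shows "42 \<le> cut V m B"
proof -
  have *: "21 \<le> cut V m {y}" if "y \<in> B" "z \<in> B" "y \<noteq> z" "m s y \<noteq> 0" "m s z \<noteq> 0" for y z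
  proof -
    have W: "y \<in> W" "z \<in> W" using that B by auto
    have "\<exists>x\<in>W. x \<noteq> z \<and> m z x \<noteq> 0" by (rule other_neighbour[OF W(2) W(1) that(3,4)])
    then obtain x where x: "x \<in> W" "x \<noteq> z" "m z x \<noteq> 0" by blast
    have "x \<noteq> y" using x that B(2) has_edgeI[of z B y m] by auto
    then have "has_edge m (V - {s, y})"
      using x that W sW by (intro has_edgeI[of z _ x]) (auto simp: W_def)
    then show ?thesis by (rule neighbour_degree[OF W(1) that(4)])
  qed
  have BV: "B \<subseteq> V" and fB: "finite B" using B WV finW finite_subset by auto
  have "cut V m {y} + cut V m {z} = (\<Sum>x\<in>{y, z}. cut V m {x})" using yz by simp
  also have "\<dots> \<le> (\<Sum>x\<in>B. cut V m {x})"
    by (rule sum_mono2) (use fB yz cut_nonneg[OF m] in auto)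
  also have "\<dots> = cut V m B" using cut_independent[OF finV m BV B(2)] by simp
  finally show ?thesis using *[OF yz] *[of z y] yz by simp
qed

definition split_mult :: "'v \<Rightarrow> 'v \<Rightarrow> 'v \<Rightarrow> 'v \<Rightarrow> 'v \<Rightarrow> 'v \<Rightarrow> int" where
  "split_mult a b c d = (\<lambda>u v. (m u v + lifted_edge a b u v) + lifted_edge c d u v)"

text \<open>
  Lifting lowers a cut below both of the cuts around \<open>A\<close> and around \<open>A\<close> with
  \<open>s\<close> only if it joins two neighbours inside \<open>A\<close> and the other two outside; and
  then by two edges. The bound 24 covers a violation of either cut condition.
\<close>

lemma bad_pairing:
  assumes abcd: "a \<in> W" "b \<in> W" "c \<in> W" "d \<in> W"
    and ms': "\<And>A. A \<subseteq> W \<Longrightarrow> (\<Sum>u\<in>A. m s u) = of_bool (a \<in> A) + of_bool (b \<in> A) + of_bool (c \<in> A) +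
        of_bool (d \<in> A)"
    and bad: "\<not> essential_cuts W (split_mult a b c d)"
  shows "\<exists>A\<subseteq>W. a \<in> A \<and> b \<in> A \<and> c \<notin> A \<and> d \<notin> A \<and> cut V m A \<le> 24"
proof -
  have nz: "m s x \<noteq> 0" if "x \<in> {a, b, c, d}" for x
    using ms'[of "{x}"] that abcd by (auto simp: of_bool_def split: if_splits)
  have cW: "cut W (split_mult a b c d) A
      = cut W m A + of_bool ((a \<in> A) \<noteq> (b \<in> A)) + of_bool ((c \<in> A) \<noteq> (d \<in> A))"
    if "A \<subseteq> W" for A
    unfolding split_mult_def using cut_lifted_edge[OF finW that] abcd by (simp add: cut_add)
  have c1: "cut V m A = cut W m A + of_bool (a \<in> A) + of_bool (b \<in> A) + of_bool (c \<in> A) + of_bool (d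
      \<in> A)"
    and c2: "cut V m (insert s A) = cut W m A + 4 - (of_bool (a \<in> A) + of_bool (b \<in> A) + of_bool (c
        \<in> A) + of_bool (d \<in> A))"
    if "A \<subseteq> W" for A
    using cutW[OF that] cutWs[OF that] ms'[OF that] by simp_all
  have conclude: ?thesis
    if A: "A \<subseteq> W" "cut W m A \<le> 22" and sep: "(a \<in> A) = (b \<in> A)" "(c \<in> A) = (d \<in> A)"
        "(a \<in> A) \<noteq> (c \<in> A)" for A
  proof (cases "a \<in> A")
    case True
    then show ?thesis using A sep c1[OF A(1)] by (intro exI[of _ A]) auto
  next
    case False
    have "W - A \<subseteq> W" by auto
    then show ?thesis using A sep c1[of "W - A"] abcd False cut_compl[OF m A(1)]
      by (intro exI[of _ "W - A"]) auto
  qed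
  have ends: "has_edge m A \<or> a \<noteq> b \<and> a \<in> A \<and> b \<in> A \<or> c \<noteq> d \<and> c \<in> A \<and> d \<in> A"
    if e: "has_edge (split_mult a b c d) A" for A
  proof -
    obtain u v where uv: "u \<in> A" "v \<in> A" "split_mult a b c d u v \<noteq> 0"
      using e unfolding has_edge_def by blast
    then have "m u v \<noteq> 0 \<or> lifted_edge a b u v \<noteq> 0 \<or>
        lifted_edge c d u v \<noteq> 0" by (auto simp: split_mult_def)
    then show ?thesis using uv by (auto simp: lifted_edge_def edge_eq_0 has_edge_def split: if_splits)
  qed
  have large: "38 \<le> cut W m A" if A: "A \<subseteq> W" "\<not> has_edge m A" "has_edge (split_mult a b c d) A" for A
  proof -
    have "42 \<le> cut V m A"
      using ends[OF A(3)] A(2) independent_large[OF A(1,2), of a b] independent_large[OF A(1,2), of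
          c d] nz by auto
    then show ?thesis using c1[OF A(1)] by (auto simp: of_bool_def split: if_splits)
  qed
  consider A where "A \<subseteq> W" "A \<noteq> {}" "A \<noteq> W" "cut W (split_mult a b c d) A < 4"
    | A where "A \<subseteq> W" "has_edge (split_mult a b c d) A" "has_edge (split_mult a b c d) (W - A)"
        "cut W (split_mult a b c d) A < 23"
    using bad unfolding essential_cuts_def by (auto simp: not_le)
  then show ?thesis
  proof cases
    case 1
    have "4 \<le> cut V m A" by (rule essential_cutsD(1)[OF ess]) (use 1 s sW WV in auto)
    moreover have "4 \<le> cut V m (insert s A)"
      by (rule essential_cutsD(1)[OF ess]) (use 1 s in \<open>auto simp: W_def\<close>)
    ultimately show ?thesis
      using conclude[OF 1(1)] c1[OF 1(1)] c2[OF 1(1)] cW[OF 1(1)] 1(4)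
      by (cases "a \<in> A"; cases "b \<in> A"; cases "c \<in> A"; cases "d \<in> A") simp_all
  next
    case 2
    have le: "cut W m A \<le> 22" using cW[OF 2(1)] 2(4) by (auto simp: of_bool_def split: if_splits)
    have eA: "has_edge m A" using large[OF 2(1) _ 2(2)] le by linarith
    have "cut W m (W - A) = cut W m A" by (rule cut_compl[OF m 2(1)])
    then have eWA: "has_edge m (W - A)" using large[OF _ _ 2(3)] le by fastforce
    have "23 \<le> cut V m A"
      by (rule essential_cutsD(2)[OF ess _ eA has_edge_mono[OF eWA]]) (use 2 WV in auto)
    moreover have "23 \<le> cut V m (insert s A)"
      by (rule essential_cutsD(2)[OF ess _ has_edge_mono[OF eA] has_edge_mono[OF eWA]]) (use 2 s in
          \<open>auto simp: W_def\<close>)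
    ultimately show ?thesis
      using conclude[OF 2(1) le] c1[OF 2(1)] c2[OF 2(1)] cW[OF 2(1)] 2(4)
      by (cases "a \<in> A"; cases "b \<in> A"; cases "c \<in> A"; cases "d \<in> A") simp_all
  qed
qed

lemma degree_21:
  assumes dist: "distinct [p, q, r]" and W: "p \<in> W" "q \<in> W" "r \<in> W"
    and nz: "m s p \<noteq> 0" "m s q \<noteq> 0" "m s r \<noteq> 0"
  shows "21 \<le> cut V m {p}"
proof (cases "has_edge m (V - {s, p})")
  case True
  then show ?thesis by (rule neighbour_degree[OF W(1) nz(1)])
next
  case False
  have only: "m p q \<noteq> 0" if "q \<in> W" "q \<noteq> p" for q
  proof -
    have "\<exists>x\<in>W. x \<noteq> q \<and> m q x \<noteq> 0" using other_neighbour[OF that(1) W(1) _ nz(1)] that(2) by blast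
    then obtain x where x: "x \<in> W" "x \<noteq> q" "m q x \<noteq> 0" by blast
    have "x = p" using False that x has_edgeI[of q "V - {s, p}" x m] by (auto simp: W_def)
    then show ?thesis using x multD(1)[OF m, of p q] by simp
  qed
  have "has_edge m (V - {s, q})"
    using only[OF W(3)] dist W by (intro has_edgeI[of p _ r]) (auto simp: W_def)
  then have q21: "21 \<le> cut V m {q}" by (rule neighbour_degree[OF W(2) nz(2)])
  have V: "p \<in> V" "q \<in> V" "r \<in> V" and sne: "s \<noteq> p" "s \<noteq> q" "s \<noteq> r" using W WV sW by auto
  have "cut V m {q} = (\<Sum>v\<in>V. m q v)" by (rule cut_singleton[OF finV m V(2)])
  also have "\<dots> = (\<Sum>v\<in>{s, p}. m q v)"
  proof (rule sum.mono_neutral_right[OF finV])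
    show "\<forall>i\<in>V - {s, p}. m q i = 0"
      using False has_edgeI[of q "V - {s, p}" _ m] W dist by (auto simp: W_def)
  qed (use s V in auto)
  also have "\<dots> = m s q + m p q" using sne multD(1)[OF m, of q s] multD(1)[OF m, of q p] by simp
  finally have "cut V m {q} = m s q + m p q" .
  moreover have "m s p + m s q + m s r \<le> 4"
    using degree_ge_sum[OF finV m s, of "{p, q, r}"] degree_s V dist by simp
  moreover have "m s p + m p q + m p r \<le> cut V m {p}"
    using degree_ge_sum[OF finV m V(1), of "{s, q, r}"] s V sne dist multD(1)[OF m, of p s] by simp
  moreover have "1 \<le> m s p" "1 \<le> m s r" "1 \<le> m p r"
    using nz only[OF W(3)] dist multD(2)[OF m, of s p] multD(2)[OF m, of s r] multD(2)[OF m, of p r]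
    by (auto simp: order_le_less)
  ultimately show ?thesis using q21 by linarith
qed

text \<open>
  The set \<open>X\<close> is a cell of the three bad cuts: it contains one neighbour of \<open>s\<close> and
  misses another one.
\<close>

lemma cell_large:
  assumes X: "X \<subseteq> W" "p \<in> X" "q \<notin> X" and dist: "distinct [p, q, r]" and W: "q \<in> W" "r \<in> W"
    and nz: "m s p \<noteq> 0" "m s q \<noteq> 0" "m s r \<noteq> 0"
  shows "21 \<le> cut V m X"
proof (cases "has_edge m X")
  case True
  have "has_edge m (V - X)" using X W s nz sW by (intro has_edgeI[of s _ q]) (auto simp: W_def)
  moreover have "X \<subseteq> V" using X WV by auto
  ultimately show ?thesis using essential_cutsD(2)[OF ess _ True] by fastforce
next
  case False
  have XV: "X \<subseteq> V" using X WV by auto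
  have "cut V m {p} = (\<Sum>x\<in>{p}. cut V m {x})" by simp
  also have "\<dots> \<le> (\<Sum>x\<in>X. cut V m {x})"
    by (rule sum_mono2) (use X finite_subset[OF XV finV] cut_nonneg[OF m] in auto)
  also have "\<dots> = cut V m X" using cut_independent[OF finV m XV False] by simp
  finally show ?thesis using degree_21[OF dist _ W nz] X by auto
qed

lemma two_cut: "A \<subseteq> V \<Longrightarrow> 2 * cut V m A = (\<Sum>u\<in>V. \<Sum>v\<in>V. m u v * of_bool ((u \<in> A) \<noteq> (v \<in> A)))"
proof -
  assume A: "A \<subseteq> V"
  have cut: "cut V m B = (\<Sum>u\<in>V. \<Sum>v\<in>V. m u v * of_bool (u \<in> B \<and> v \<notin> B))" if "B \<subseteq> V" for B
  proof -
    have "(\<Sum>v\<in>V. m u v * of_bool (u \<in> B \<and> v \<notin> B)) = (if u \<in> B then \<Sum>v\<in>V - B. m u v else 0)" for u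
    proof (cases "u \<in> B")
      case True
      have "(\<Sum>v\<in>V. m u v * of_bool (u \<in> B \<and> v \<notin> B)) = (\<Sum>v\<in>V - B. m u v)"
        by (rule sum.mono_neutral_cong_right) (use finV True in auto)
      then show ?thesis using True by simp
    qed simp
    then show ?thesis using that finV by (simp add: cut_def sum.If_cases Int_absorb1)
  qed
  have "2 * cut V m A = cut V m A + cut V m (V - A)" using cut_compl[OF m A] by simp
  also have "\<dots> = (\<Sum>u\<in>V. \<Sum>v\<in>V. m u v * of_bool (u \<in> A \<and> v \<notin> A) + m u v * of_bool (u \<in> V - A \<and>
      v \<notin> V - A))"
    using cut[OF A] cut[of "V - A"] by (simp add: sum.distrib)
  also have "\<dots> = (\<Sum>u\<in>V. \<Sum>v\<in>V. m u v * of_bool ((u \<in> A) \<noteq> (v \<in> A)))"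
    by (intro sum.cong refl) auto
  finally show ?thesis .
qed

text \<open>
  Every pair of vertices that is separated by cells on the left is separated at least as often by the
  three sets.
\<close>

lemma three_sets:
  assumes "A \<subseteq> V" "B \<subseteq> V" "C \<subseteq> V"
  shows "cut V m (A \<inter> B \<inter> C) + cut V m (A - B - C) + cut V m (B - A - C) + cut V m (C - A - B)
    \<le> cut V m A + cut V m B + cut V m C"
proof -
  have sub: "A \<inter> B \<inter> C \<subseteq> V" "A - B - C \<subseteq> V" "B - A - C \<subseteq> V" "C - A - B \<subseteq> V" using assms by auto
  have "2 * (cut V m (A \<inter> B \<inter> C) + cut V m (A - B - C) + cut V m (B - A - C) + cut V m (C - A - B))
    \<le> 2 * (cut V m A + cut V m B + cut V m C)"
    unfolding distrib_left two_cut[OF assms(1)] two_cut[OF assms(2)] two_cut[OF assms(3)]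
      two_cut[OF sub(1)] two_cut[OF sub(2)] two_cut[OF sub(3)] two_cut[OF sub(4)] sum.distrib[symmetric]
  proof (intro sum_mono)
    fix u v
    have b: "of_bool ((u \<in> A \<inter> B \<inter> C) \<noteq> (v \<in> A \<inter> B \<inter> C)) + of_bool ((u \<in> A - B - C) \<noteq> (v \<in> A - B - C))
      + of_bool ((u \<in> B - A - C) \<noteq> (v \<in> B - A - C)) + of_bool ((u \<in> C - A - B) \<noteq> (v \<in> C - A - B))
      \<le> (of_bool ((u \<in> A) \<noteq> (v \<in> A)) + of_bool ((u \<in> B) \<noteq> (v \<in> B)) + of_bool ((u \<in> C) \<noteq> (v \<in> C)) ::
          int)"
      by (cases "u \<in> A"; cases "u \<in> B"; cases "u \<in> C"; cases "v \<in> A"; cases "v \<in> B"; cases "v \<in> C")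
          simp_all
    from mult_left_mono[OF b multD(2)[OF m, of u v]]
    show "m u v * of_bool ((u \<in> A \<inter> B \<inter> C) \<noteq> (v \<in> A \<inter> B \<inter> C)) + m u v * of_bool ((u \<in> A - B - C) \<noteq>
        (v \<in> A - B - C))
      + m u v * of_bool ((u \<in> B - A - C) \<noteq> (v \<in> B - A - C)) + m u v * of_bool ((u \<in> C - A - B) \<noteq> (v
          \<in> C - A - B))
      \<le> m u v * of_bool ((u \<in> A) \<noteq> (v \<in> A)) + m u v * of_bool ((u \<in> B) \<noteq> (v \<in> B)) + m u v * of_bool
          ((u \<in> C) \<noteq> (v \<in> C))"
      by (simp only: distrib_left)
  qed
  then show ?thesis by simp
qed

lemma good_pairing:
  "essential_cuts W (split_mult y1 y2 y3 y4) \<or> essential_cuts W (split_mult y1 y3 y2 y4) \<or>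
      essential_cuts W (split_mult y1 y4 y2 y3)"
proof (rule ccontr)
  assume n: "\<not> ?thesis"
  have "\<exists>A\<subseteq>W. y1 \<in> A \<and> y2 \<in> A \<and> y3 \<notin> A \<and> y4 \<notin> A \<and> cut V m A \<le> 24"
    by (rule bad_pairing[OF yWs]) (use n sum_ms in auto)
  then obtain A where A: "A \<subseteq> W" "y1 \<in> A" "y2 \<in> A" "y3 \<notin> A" "y4 \<notin> A" "cut V m A \<le> 24" by blast
  have "\<exists>B\<subseteq>W. y1 \<in> B \<and> y3 \<in> B \<and> y2 \<notin> B \<and> y4 \<notin> B \<and> cut V m B \<le> 24"
    by (rule bad_pairing[OF yWs(1,3,2,4)]) (use n sum_ms in auto)
  then obtain B where B: "B \<subseteq> W" "y1 \<in> B" "y3 \<in> B" "y2 \<notin> B" "y4 \<notin> B" "cut V m B \<le> 24" by blast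
  have "\<exists>C\<subseteq>W. y1 \<in> C \<and> y4 \<in> C \<and> y2 \<notin> C \<and> y3 \<notin> C \<and> cut V m C \<le> 24"
    by (rule bad_pairing[OF yWs(1,4,2,3)]) (use n sum_ms in auto)
  then obtain C where C: "C \<subseteq> W" "y1 \<in> C" "y4 \<in> C" "y2 \<notin> C" "y3 \<notin> C" "cut V m C \<le> 24" by blast
  have dist: "distinct [y1, y2, y3, y4]" using A B C by auto
  have nz: "m s y \<noteq> 0" if "y \<in> {y1, y2, y3, y4}" for y
    using s_mult[of y] that yW by (auto simp: of_bool_def split: if_splits)
  have "21 \<le> cut V m (A \<inter> B \<inter> C)"
    by (rule cell_large[of _ y1 y2 y3]) (use A B C dist yWs nz in auto)
  moreover have "21 \<le> cut V m (A - B - C)"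
    by (rule cell_large[of _ y2 y1 y3]) (use A B C dist yWs nz in auto)
  moreover have "21 \<le> cut V m (B - A - C)"
    by (rule cell_large[of _ y3 y1 y2]) (use A B C dist yWs nz in auto)
  moreover have "21 \<le> cut V m (C - A - B)"
    by (rule cell_large[of _ y4 y1 y2]) (use A B C dist yWs nz in auto)
  ultimately show False using three_sets[of A B C] A B C WV by force
qed

lemma reinsert_vertex:
  assumes abcd: "a \<in> W" "b \<in> W" "c \<in> W" "d \<in> W"
    and ms': "\<And>u. u \<in> W \<Longrightarrow> m s u = of_bool (u = a) + of_bool (u = b) + of_bool (u = c) + of_bool (u = d)"
    and sol: "orientable W (split_mult a b c d) (\<lambda>_. 0)"
  shows "orientable V m (\<lambda>_. 0)"
proof -
  obtain p where p: "p = 1 \<or> p = -1" "orientable W (\<lambda>u v. m u v + lifted_edge a b u v) (\<lambda>v. 0 - p *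
      arc c d v)"
    using orientable_remove_lifted_edge[OF finW mult_lifted_edge[OF m] abcd(3,4) sol[unfolded
        split_mult_def]] by blast
  obtain q where q: "q = 1 \<or> q = -1" "orientable W m (\<lambda>v. 0 - p * arc c d v - q * arc a b v)"
    using orientable_remove_lifted_edge[OF finW m abcd(1,2) p(2)] by blast
  define g where "g v = p * arc c d v + q * arc a b v" for v
  have "orientable (insert s W) m (\<lambda>_. 0)"
  proof (rule orientable_add_vertex[OF finW sW m, where g = g])
    show "orientable W m (\<lambda>v. 0 - g v)" using q(2) by (simp add: g_def diff_diff_eq)
    show "3 dvd sum g W + 0"
      using abcd finW by (simp add: g_def sum.distrib sum_distrib_left[symmetric] sum_arc)
    fix v assume v: "v \<in> W"
    have one: "attainable (of_bool P) (r * of_bool P)" if "r = 1 \<or> r = -1" for r :: int and P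
      using that by (auto simp: attainable_def)
    have "attainable (((of_bool (v = a) + of_bool (v = b)) + of_bool (v = c)) + of_bool (v = d))
      (((q * of_bool (v = a) + (- q) * of_bool (v = b)) + p * of_bool (v = c)) + (- p) * of_bool (v
          = d))"
      using p(1) q(1) by (intro attainable_plus one) auto
    then show "attainable (m v s) (g v)"
      using ms'[OF v] multD(1)[OF m, of v s] by (simp add: g_def arc_def algebra_simps)
  qed
  moreover have "insert s W = V" using s by (auto simp: W_def)
  ultimately show ?thesis by simp
qed

end

theorem orientable_if_essential_cuts:
  assumes "finite V" "mult m" "essential_cuts V m"
  shows "orientable V m (\<lambda>_. 0)"
  using assms
proof (induction "card V" arbitrary: V m rule: less_induct)
  case less
  note fin = less.prems(1) and m = less.prems(2) and ess = less.prems(3)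
  show ?case
  proof (cases "\<exists>s\<in>V. cut V m {s} = 4")
    case False
    show ?thesis
    proof (cases "\<exists>x. V \<subseteq> {x}")
      case True
      then show ?thesis using orientable_empty_or_single[of V _ m "\<lambda>_. 0"] m by auto
    next
      case nt: False
      have "5 \<le> cut V m {x}" if x: "x \<in> V" for x
      proof -
        have "4 \<le> cut V m {x}" by (rule essential_cutsD(1)[OF ess]) (use x nt in auto)
        then show ?thesis using False x by force
      qed
      then have "tree_rich V m" by (rule tree_rich_if_min_degree_5[OF fin m ess])
      then show ?thesis using orientable_if_tree_rich[OF fin m] by simp
    qed
  next
    case True
    then obtain s where s: "s \<in> V" "cut V m {s} = 4" by blast
    have "(\<Sum>u\<in>V - {s}. m s u) = int 4" using s by (simp add: cut_def)
    then obtain ys where ys: "length ys = 4" "set ys \<subseteq> V - {s}"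
        "\<forall>u\<in>V - {s}. m s u = int (count_list ys u)"
      using neighbour_list[of "V - {s}" "m s" 4] fin multD(2)[OF m] by auto
    then obtain y1 y2 y3 y4 where y: "ys = [y1, y2, y3, y4]"
      by (auto simp: length_Suc_conv eval_nat_numeral)
    interpret degree_four_vertex V m s y1 y2 y3 y4
    proof
      show "m s u = of_bool (u = y1) + of_bool (u = y2) + of_bool (u = y3) + of_bool (u = y4)"
        if "u \<in> V - {s}" for u using ys(3) that y by auto
    qed (use fin m ess s ys y in auto)
    have IH: "orientable W (split_mult a b c d) (\<lambda>_. 0)"
        if "essential_cuts W (split_mult a b c d)" for a b c d
    proof (rule less.hyps[OF _ finW _ that])
      show "card W < card V" unfolding W_def using fin s by (intro psubset_card_mono) auto
      show "mult (split_mult a b c d)" unfolding split_mult_def by (intro mult_lifted_edge m)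
    qed
    have ms': "m s u = of_bool (u = y1) + of_bool (u = y2) + of_bool (u = y3) + of_bool (u = y4)"
        if "u \<in> W" for u
      using s_mult that by (simp add: W_def)
    from good_pairing show ?thesis
    proof (elim disjE)
      assume "essential_cuts W (split_mult y1 y2 y3 y4)"
      then show ?thesis by (intro reinsert_vertex[OF yWs _ IH]) (auto simp: ms')
    next
      assume "essential_cuts W (split_mult y1 y3 y2 y4)"
      then show ?thesis by (intro reinsert_vertex[OF yWs(1,3,2,4) _ IH]) (auto simp: ms')
    next
      assume "essential_cuts W (split_mult y1 y4 y2 y3)"
      then show ?thesis by (intro reinsert_vertex[OF yWs(1,4,2,3) _ IH]) (auto simp: ms')
    qed
  qed
qed

section \<open>Edge cuts of the multigraph\<close>

definition edge_mult :: "('v, 'e) pre_multigraph \<Rightarrow> 'v \<Rightarrow> 'v \<Rightarrow> int" where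
  "edge_mult G u v = int (card {e \<in> edges G. ends G e = {u, v}})"

definition boundary :: "('v, 'e) pre_multigraph \<Rightarrow> 'v set \<Rightarrow> 'e set" where
  "boundary G A = {e \<in> edges G. \<exists>u\<in>A. \<exists>v\<in>vertices G - A. ends G e = {u, v}}"

context loopless_multigraph
begin

abbreviation V where "V \<equiv> vertices G"
abbreviation E where "E \<equiv> edges G"

lemma edge_ends:
  assumes "e \<in> E"
  obtains x y where "ends G e = {x, y}" "x \<noteq> y" "x \<in> V" "y \<in> V"
  using card_ends[OF assms] ends_in_vertices[OF assms] by (auto simp: card_2_iff)

lemma mult_edge_mult: "mult (edge_mult G)"
proof -
  have "{e \<in> E. ends G e = {u}} = {}" for u using card_ends by fastforce
  then have "card {e \<in> E. ends G e = {u}} = 0" for u by (metis card.empty)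
  then show ?thesis unfolding mult_def edge_mult_def by (simp add: insert_commute)
qed

lemma edge_mult_nonzero: "edge_mult G u v \<noteq> 0 \<longleftrightarrow> (\<exists>e\<in>E. ends G e = {u, v})"
  using finite_edges by (auto simp: edge_mult_def)

lemma card_boundary:
  assumes A: "A \<subseteq> V"
  shows "int (card (boundary G A)) = cut V (edge_mult G) A"
proof -
  define I where "I = A \<times> (V - A)"
  define S where "S p = {e \<in> E. ends G e = {fst p, snd p}}" for p
  have fA: "finite A" using A finite_vertices finite_subset by blast
  have b: "boundary G A = (\<Union>p\<in>I. S p)" by (auto simp: boundary_def I_def S_def) blast
  have "card (\<Union>p\<in>I. S p) = (\<Sum>p\<in>I. card (S p))"
  proof (rule card_UN_disjoint)
    show "\<forall>p\<in>I. \<forall>q\<in>I. p \<noteq> q \<longrightarrow> S p \<inter> S q = {}"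
      by (auto simp: I_def S_def doubleton_eq_iff)
  qed (use fA finite_vertices finite_edges in \<open>auto simp: I_def S_def\<close>)
  also have "\<dots> = (\<Sum>u\<in>A. \<Sum>v\<in>V - A. card (S (u, v)))"
    unfolding I_def by (simp add: sum.cartesian_product split_def)
  finally show ?thesis unfolding b cut_def edge_mult_def S_def by simp
qed

lemma boundary_ends:
  assumes "e \<in> E" "ends G e = {x, y}" "x \<in> V" "y \<in> V" "x \<noteq> y"
  shows "e \<in> boundary G A \<longleftrightarrow> (x \<in> A) \<noteq> (y \<in> A)"
  using assms by (auto simp: boundary_def doubleton_eq_iff)

definition reach :: "'v rel" where "reach = rtrancl_on V (adjacency G)"

lemma reach_equiv: "equiv V reach"
proof (rule equivI)
  show "refl_on V reach" unfolding refl_on_def reach_def by auto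
  show "reach \<subseteq> V \<times> V" unfolding reach_def using in_rtrancl_on_in_F by fast
  have "adjacency G = (adjacency G)\<inverse>" by (auto simp: adjacency_def insert_commute)
  then show "sym reach" unfolding reach_def by (metis rtrancl_on_converseI symI)
  show "trans reach" unfolding reach_def by (rule transI) (rule rtrancl_on_trans)
qed

lemma components_reach: "components G = V // reach"
  by (simp add: components_def reach_def)

lemma finite_components: "finite (components G)"
  unfolding components_reach
  by (rule finite_quotient[OF finite_vertices]) (use reach_equiv in \<open>auto simp: equiv_def\<close>)

lemma reach_closed:
  assumes A: "boundary G A = {}" and xA: "x \<in> A" "A \<subseteq> V"
  shows "reach `` {x} \<subseteq> A"
proof
  fix y assume "y \<in> reach `` {x}"
  then have "(x, y) \<in> rtrancl_on V (adjacency G)" by (simp add: reach_def)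
  then show "y \<in> A"
  proof (induction rule: rtrancl_on_induct)
    case base
    then show ?case using xA by simp
  next
    case (step y z)
    then obtain e where "e \<in> E" "ends G e = {y, z}" by (auto simp: adjacency_def)
    then show ?case using A step by (auto simp: boundary_def)
  qed
qed

lemma reach_spans:
  assumes A: "A \<subseteq> V" and x: "x \<in> A"
    and conn: "\<And>C. C \<subseteq> A \<Longrightarrow> C \<noteq> {} \<Longrightarrow> C \<noteq> A \<Longrightarrow> \<exists>u\<in>C. \<exists>v\<in>A - C. edge_mult G u v \<noteq> 0"
  shows "A \<subseteq> reach `` {x}"
proof (rule ccontr)
  assume n: "\<not> A \<subseteq> reach `` {x}"
  have "x \<in> reach `` {x}" using A x by (auto simp: reach_def)
  then obtain u v where uv: "u \<in> reach `` {x} \<inter> A" "v \<in> A - (reach `` {x} \<inter> A)" "edge_mult G u v \<noteq> 0"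
    using conn[of "reach `` {x} \<inter> A"] n x by blast
  then have "(u, v) \<in> adjacency G" by (auto simp: edge_mult_nonzero adjacency_def)
  then have "(x, v) \<in> reach"
    using uv A unfolding reach_def by (auto intro: rtrancl_on_into_rtrancl_on)
  then show False using uv by auto
qed

lemma components_ge_2:
  assumes A: "A \<subseteq> V" "A \<noteq> {}" "A \<noteq> V" and b: "boundary G A = {}"
  shows "2 \<le> card (components G)"
proof -
  obtain x y where xy: "x \<in> A" "y \<in> V" "y \<notin> A" using A by blast
  have "reach `` {x} \<in> components G" "reach `` {y} \<in> components G"
    unfolding components_reach using xy A by (auto intro: quotientI)
  moreover have "y \<in> reach `` {y}" using xy by (auto simp: reach_def)
  then have "reach `` {x} \<noteq> reach `` {y}" using reach_closed[OF b xy(1) A(1)] xy by auto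
  moreover from this have "card {reach `` {x}, reach `` {y}} = 2" by simp
  ultimately have "card {reach `` {x}, reach `` {y}} \<le> card (components G)"
      "card {reach `` {x}, reach `` {y}} = 2"
    using finite_components by (blast intro: card_mono)+
  then show ?thesis by simp
qed

lemma components_connected:
  assumes "V \<noteq> {}" and "\<And>A. A \<subseteq> V \<Longrightarrow> A \<noteq> {} \<Longrightarrow> A \<noteq> V \<Longrightarrow> boundary G A \<noteq> {}"
  shows "card (components G) = 1"
proof -
  have "reach `` {x} = V" if x: "x \<in> V" for x
  proof (rule equalityI)
    show "reach `` {x} \<subseteq> V" using reach_equiv by (auto simp: equiv_def refl_on_def)
    show "V \<subseteq> reach `` {x}"
    proof (rule reach_spans[OF subset_refl x])
      fix C assume "C \<subseteq> V" "C \<noteq> {}" "C \<noteq> V"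
      then show "\<exists>u\<in>C. \<exists>v\<in>V - C. edge_mult G u v \<noteq> 0"
        using assms(2)[of C] unfolding edge_mult_nonzero boundary_def by blast
    qed
  qed
  then have "components G = {V}" using assms(1) unfolding components_reach quotient_def by auto
  then show ?thesis by simp
qed

text \<open>
  The hypotheses say that both sides are connected.
\<close>

lemma components_two:
  assumes A: "A \<subseteq> V" "A \<noteq> {}" "A \<noteq> V" and b: "boundary G A = {}"
    and c1: "\<And>C. C \<subseteq> A \<Longrightarrow> C \<noteq> {} \<Longrightarrow> C \<noteq> A \<Longrightarrow> \<exists>u\<in>C. \<exists>v\<in>A - C. edge_mult G u v \<noteq> 0"
    and c2: "\<And>C. C \<subseteq> V - A \<Longrightarrow> C \<noteq> {} \<Longrightarrow> C \<noteq> V - A \<Longrightarrow> \<exists>u\<in>C. \<exists>v\<in>V - A - C. edge_mult G u v \<noteq> 0"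
  shows "A \<in> components G" "V - A \<in> components G"
proof -
  have "e \<notin> boundary G (V - A)" if "e \<in> E" for e
  proof -
    obtain x y where "ends G e = {x, y}" "x \<noteq> y" "x \<in> V" "y \<in> V" using edge_ends \<open>e \<in> E\<close> .
    then show ?thesis using boundary_ends[OF \<open>e \<in> E\<close>, of x y] b by auto
  qed
  then have b2: "boundary G (V - A) = {}" by (auto simp: boundary_def)
  obtain x y where xy: "x \<in> A" "y \<in> V - A" using A by blast
  have "reach `` {x} = A" using reach_closed[OF b xy(1) A(1)] reach_spans[OF A(1) xy(1) c1] by blast
  moreover have "reach `` {y} = V - A"
    using reach_closed[OF b2 xy(2)] reach_spans[OF _ xy(2) c2] by blast
  ultimately show "A \<in> components G" "V - A \<in> components G"
    unfolding components_reach using xy A by (metis DiffD1 quotientI subsetD)+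
qed

lemma delete_multigraph: "loopless_multigraph (delete_edges G F)"
  using finite_vertices finite_edges ends_in_vertices card_ends
  by unfold_locales (auto simp: delete_edges_def)

lemma delete_simps [simp]: "vertices (delete_edges G F) = V" "edges (delete_edges G F) = E - F"
  "ends (delete_edges G F) = ends G"
  by (simp_all add: delete_edges_def)

lemma boundary_delete: "boundary (delete_edges G F) A = boundary G A - F"
  by (auto simp: boundary_def)

lemma boundary_subset: "boundary G A \<subseteq> E" by (auto simp: boundary_def)

lemma boundary_nonempty:
  assumes "connected_multigraph G" "A \<subseteq> V" "A \<noteq> {}" "A \<noteq> V"
  shows "boundary G A \<noteq> {}"
  using components_ge_2[OF assms(2-4)] assms(1) by (auto simp: connected_multigraph_def)

lemma boundary_separates:
  assumes "connected_multigraph G" "A \<subseteq> V" "A \<noteq> {}" "A \<noteq> V"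
  shows "separates G (boundary G A)"
proof -
  interpret D: loopless_multigraph "delete_edges G (boundary G A)" by (rule delete_multigraph)
  have "2 \<le> card (components (delete_edges G (boundary G A)))"
    by (rule D.components_ge_2[of A]) (use assms in \<open>auto simp: boundary_delete\<close>)
  then show ?thesis
    using assms(1) boundary_subset by (simp add: separates_def connected_multigraph_def)
qed

lemma cut_ge_if_edge_connected:
  assumes ec: "edge_connected t G" and A: "A \<subseteq> V" "A \<noteq> {}" "A \<noteq> V"
  shows "int t \<le> cut V (edge_mult G) A"
proof -
  have conn: "connected_multigraph G" using ec by (simp add: edge_connected_def)
  let ?P = "\<lambda>F. separates G F \<and> F \<subseteq> boundary G A"
  have "?P (boundary G A)" using boundary_separates[OF conn A] by simp
  then obtain F where F: "?P F" and min: "\<And>F'. ?P F' \<Longrightarrow> card F \<le> card F'"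
    using ex_has_least_nat[of ?P "boundary G A" card] by blast
  have finB: "finite (boundary G A)" using boundary_subset finite_edges finite_subset by blast
  then have finF: "finite F" using F finite_subset by blast
  have "\<not> separates G F'" if "F' \<subset> F" for F'
    using min[of F'] psubset_card_mono[OF finF that] F that by fastforce
  then have "edge_cut G F" using F by (simp add: edge_cut_def)
  then have "t \<le> card F" using ec by (meson edge_connected_def not_le)
  also have "\<dots> \<le> card (boundary G A)" using F finB by (simp add: card_mono)
  finally show ?thesis using card_boundary[OF A(1)] by linarith
qed

lemma has_edge_iff:
  assumes "A \<subseteq> V"
  shows "has_edge (edge_mult G) A \<longleftrightarrow> (\<exists>e\<in>E. ends G e \<subseteq> A)"
proof
  assume "has_edge (edge_mult G) A"
  then obtain x y e where e: "x \<in> A" "y \<in> A" "e \<in> E" "ends G e = {x, y}"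
    by (auto simp: has_edge_def edge_mult_nonzero)
  then have "ends G e \<subseteq> A" by simp
  then show "\<exists>e\<in>E. ends G e \<subseteq> A" using e(3) by blast
next
  assume "\<exists>e\<in>E. ends G e \<subseteq> A"
  then obtain e where e: "e \<in> E" "ends G e \<subseteq> A" by blast
  obtain x y where "ends G e = {x, y}" using edge_ends[OF e(1)] .
  then show "has_edge (edge_mult G) A" using e
      by (intro has_edgeI[of x _ y]) (auto simp: edge_mult_nonzero)
qed

text \<open>
  If \<open>A\<close> fell apart, the boundaries of its pieces would split the boundary of \<open>A\<close>, and
  a piece that contains an edge would be a smaller essential cut.
\<close>

lemma minimal_side_connected:
  assumes conn: "connected_multigraph G" and A: "A \<subseteq> V" "has_edge (edge_mult G) A"
      "has_edge (edge_mult G) (V - A)"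
    and min: "\<And>B. B \<subseteq> V \<Longrightarrow> has_edge (edge_mult G) B \<Longrightarrow> has_edge (edge_mult G) (V - B) \<Longrightarrow>
      cut V (edge_mult G) A \<le> cut V (edge_mult G) B"
    and C: "C \<subseteq> A" "C \<noteq> {}" "C \<noteq> A"
  shows "\<exists>u\<in>C. \<exists>v\<in>A - C. edge_mult G u v \<noteq> 0"
proof (rule ccontr)
  assume "\<not> ?thesis"
  then have z: "edge_mult G u v = 0" if "u \<in> C" "v \<in> A - C" for u v using that by blast
  have fin: "finite A" "finite C" using A(1) C(1) finite_vertices by (meson finite_subset)+
  have one: "cut V (edge_mult G) D = (\<Sum>u\<in>D. \<Sum>v\<in>V - A. edge_mult G u v)"
    if "D = C \<or> D = A - C" for D
    unfolding cut_def
  proof (rule sum.cong[OF refl], rule sum.mono_neutral_right)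
    fix u assume u: "u \<in> D"
    show "V - A \<subseteq> V - D" using that C by auto
    show "\<forall>i\<in>V - D - (V - A). edge_mult G u i = 0"
    proof
      fix i assume "i \<in> V - D - (V - A)"
      then have "u \<in> C \<and> i \<in> A - C \<or> i \<in> C \<and> u \<in> A - C" using that u C by auto
      then show "edge_mult G u i = 0" using z[of u i] z[of i u] multD(1)[OF mult_edge_mult, of u i]
          by auto
    qed
  qed (use finite_vertices in auto)
  have sum: "cut V (edge_mult G) A = cut V (edge_mult G) C + cut V (edge_mult G) (A - C)"
    using one[of C] one[of "A - C"] sum.subset_diff[OF C(1) fin(1), of "\<lambda>u. \<Sum>v\<in>V - A. edge_mult G u v"]
    by (simp add: cut_def)
  have pos: "0 < cut V (edge_mult G) D" if "D = C \<or> D = A - C" for D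
  proof -
    have D: "D \<subseteq> V" "D \<noteq> {}" "D \<noteq> V" using that A C by auto
    have "boundary G D \<noteq> {}" by (rule boundary_nonempty[OF conn D])
    moreover have "finite (boundary G D)" using boundary_subset finite_edges finite_subset by blast
    ultimately have "0 < int (card (boundary G D))" by (simp add: card_gt_0_iff)
    then show ?thesis using card_boundary[OF D(1)] by simp
  qed
  have "\<not> has_edge (edge_mult G) D" if "D = C \<or> D = A - C" for D
  proof
    assume e: "has_edge (edge_mult G) D"
    have "D \<subseteq> A" using that C by auto
    then have "has_edge (edge_mult G) (V - D)" by (intro has_edge_mono[OF A(3)]) auto
    then have "cut V (edge_mult G) A \<le> cut V (edge_mult G) D" using min e A(1) \<open>D \<subseteq> A\<close> by blast
    then show False using sum pos[of C] pos[of "A - C"] that by auto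
  qed
  then have no: "\<not> has_edge (edge_mult G) C" "\<not> has_edge (edge_mult G) (A - C)" by blast+
  obtain x y where "x \<in> A" "y \<in> A" "edge_mult G x y \<noteq> 0" using A(2) by (auto simp: has_edge_def)
  then show False
    using no z[of x y] z[of y x] multD(1)[OF mult_edge_mult, of x y] unfolding has_edge_def
    by (cases "x \<in> C"; cases "y \<in> C") auto
qed

text \<open>
  A smallest boundary separating two edges is a bond, because both of its sides are connected.
\<close>

lemma cut_ge_if_essentially_edge_connected:
  assumes ec: "essentially_edge_connected t G"
    and A: "A \<subseteq> V" "has_edge (edge_mult G) A" "has_edge (edge_mult G) (V - A)"
  shows "int t \<le> cut V (edge_mult G) A"
proof -
  have conn: "connected_multigraph G" using ec by (simp add: essentially_edge_connected_def)
  let ?P = "\<lambda>A. A \<subseteq> V \<and> has_edge (edge_mult G) A \<and> has_edge (edge_mult G) (V - A)"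
  obtain B where B: "?P B" and min: "\<And>C. ?P C \<Longrightarrow> card (boundary G B) \<le> card (boundary G C)"
    using ex_has_least_nat[of ?P A "\<lambda>A. card (boundary G A)"] A by blast
  have min': "cut V (edge_mult G) B \<le> cut V (edge_mult G) C" if "?P C" for C
    using min[OF that] card_boundary[of B] card_boundary[of C] B that by linarith
  have VB: "V - (V - B) = B" using B by auto
  have BV: "B \<noteq> {}" "B \<noteq> V" using B by (auto simp: has_edge_def)
  have in1: "\<exists>u\<in>C. \<exists>v\<in>B - C. edge_mult G u v \<noteq> 0" if "C \<subseteq> B" "C \<noteq> {}" "C \<noteq> B" for C
    using minimal_side_connected[of B C] conn B min' that by blast
  have in2: "\<exists>u\<in>C. \<exists>v\<in>V - B - C. edge_mult G u v \<noteq> 0" if "C \<subseteq> V - B" "C \<noteq> {}" "C \<noteq> V - B" for C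
  proof (rule minimal_side_connected[OF conn _ _ _ _ that])
    show "cut V (edge_mult G) (V - B) \<le> cut V (edge_mult G) C" if "C \<subseteq> V" "has_edge (edge_mult G) C"
        "has_edge (edge_mult G) (V - C)" for C
      using min'[of C] that cut_compl[OF mult_edge_mult, of B V] B by simp
  qed (use B VB in auto)
  define F where "F = boundary G B"
  interpret D: loopless_multigraph "delete_edges G F" by (rule delete_multigraph)
  have keep: "edge_mult (delete_edges G F') u v \<noteq> 0"
    if uv: "edge_mult G u v \<noteq> 0" "(u \<in> B) = (v \<in> B)" "F' \<subseteq> F" "u \<in> V" "v \<in> V" for u v F'
  proof -
    interpret D': loopless_multigraph "delete_edges G F'" by (rule delete_multigraph)
    obtain e where e: "e \<in> E" "ends G e = {u, v}" using uv(1) by (auto simp: edge_mult_nonzero)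
    have "u \<noteq> v" using card_ends[OF e(1)] e(2) by auto
    then have "e \<notin> F" unfolding F_def using boundary_ends[OF e uv(4,5)] uv(2) by simp
    then show ?thesis using e uv(3) by (auto simp: D'.edge_mult_nonzero)
  qed
  have "edge_cut G F"
    unfolding edge_cut_def
  proof (intro conjI allI impI)
    show "separates G F" unfolding F_def using boundary_separates[OF conn _ BV] B by blast
    fix F' assume F': "F' \<subset> F"
    interpret D': loopless_multigraph "delete_edges G F'" by (rule delete_multigraph)
    have "card (components (delete_edges G F')) = 1"
    proof (rule D'.components_connected)
      show "vertices (delete_edges G F') \<noteq> {}" using B BV by auto
      fix C assume C: "C \<subseteq> vertices (delete_edges G F')" "C \<noteq> {}" "C \<noteq> vertices (delete_edges G F')"
      then have CV: "C \<subseteq> V" "C \<noteq> V" by auto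
      have cross: "boundary (delete_edges G F') C \<noteq> {}"
        if uv: "u \<in> C" "v \<in> V - C" "edge_mult (delete_edges G F') u v \<noteq> 0" for u v
      proof -
        obtain e where "e \<in> E - F'" "ends G e = {u, v}" using uv(3) by (auto simp: D'.edge_mult_nonzero)
        then show ?thesis using uv(1,2) by (auto simp: boundary_def)
      qed
      consider "C \<inter> B \<noteq> {}" "C \<inter> B \<noteq> B" | "C - B \<noteq> {}" "C - B \<noteq> V - B" | "C = B" | "C = V - B"
        using CV C(2) B by blast
      then show "boundary (delete_edges G F') C \<noteq> {}"
      proof cases
        case 1
        then obtain u v where "u \<in> C \<inter> B" "v \<in> B - C \<inter> B"
            "edge_mult G u v \<noteq> 0" using in1[of "C \<inter> B"] by blast
        then show ?thesis using keep[of u v F'] cross[of u v] F' B by auto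
      next
        case 2
        then obtain u v where "u \<in> C - B" "v \<in> V - B - (C - B)" "edge_mult G u v \<noteq> 0"
          using in2[of "C - B"] CV by blast
        then show ?thesis using keep[of u v F'] cross[of u v] F' CV by auto
      next
        case 3
        then show ?thesis using F' unfolding boundary_delete F_def by auto
      next
        case 4
        obtain e where e: "e \<in> F" "e \<notin> F'" using F' by blast
        then have eE: "e \<in> E" using boundary_subset F_def by auto
        obtain x y where xy: "ends G e = {x, y}" "x \<noteq> y" "x \<in> V" "y \<in> V" using edge_ends[OF eE] .
        have "e \<in> boundary G C"
          using e(1) unfolding F_def 4 boundary_ends[OF eE xy(1,3,4,2)] using xy by auto
        then show ?thesis using e unfolding boundary_delete by auto
      qed
    qed
    then show "\<not> separates G F'" using conn by (simp add: separates_def connected_multigraph_def)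
  qed
  moreover have "2 \<le> card (nontrivial_components (delete_edges G F))"
  proof -
    have b: "boundary (delete_edges G F) B = {}" unfolding boundary_delete F_def by simp
    have d1: "\<exists>u\<in>C. \<exists>v\<in>B - C. edge_mult (delete_edges G F) u v \<noteq> 0" if C: "C \<subseteq> B" "C \<noteq> {}" "C \<noteq> B" for C
    proof -
      obtain u v where "u \<in> C" "v \<in> B - C" "edge_mult G u v \<noteq> 0" using in1[OF C] by blast
      then show ?thesis using keep[of u v F] C B by blast
    qed
    have d2: "\<exists>u\<in>C. \<exists>v\<in>vertices (delete_edges G F) - B - C. edge_mult (delete_edges G F) u v \<noteq> 0"
      if C: "C \<subseteq> vertices (delete_edges G F) - B" "C \<noteq> {}" "C \<noteq> vertices (delete_edges G F) - B" for C
    proof -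
      obtain u v where "u \<in> C" "v \<in> V - B - C" "edge_mult G u v \<noteq> 0" using in2[of C] C by auto
      then show ?thesis using keep[of u v F] C by auto
    qed
    have "B \<in> components (delete_edges G F)" "V - B \<in> components (delete_edges G F)"
      using D.components_two[of B, OF _ _ _ b d1 d2] B BV by auto
    moreover have "\<exists>e\<in>E - F. ends G e \<subseteq> X" if X: "X = B \<or> X = V - B" for X
    proof -
      have "has_edge (edge_mult G) X" "X \<subseteq> V" using B X by auto
      then obtain e where e: "e \<in> E" "ends G e \<subseteq> X" using has_edge_iff by blast
      obtain x y where xy: "ends G e = {x, y}" "x \<noteq> y" "x \<in> V" "y \<in> V" using edge_ends[OF e(1)] .
      have "e \<notin> F" unfolding F_def boundary_ends[OF e(1) xy(1,3,4,2)] using e(2) xy X by auto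
      then show ?thesis using e by blast
    qed
    ultimately have "{B, V - B} \<subseteq> nontrivial_components (delete_edges G F)"
      by (auto simp: nontrivial_components_def)
    moreover have "finite (nontrivial_components (delete_edges G F))"
      using D.finite_components by (simp add: nontrivial_components_def)
    ultimately have "card {B, V - B} \<le> card (nontrivial_components (delete_edges G F))"
        by (intro card_mono)
    moreover have "B \<noteq> V - B" using BV by blast
    ultimately show ?thesis by simp
  qed
  ultimately have "essential_edge_cut G F" by (simp add: essential_edge_cut_def)
  then have "t \<le> card F" using ec by (meson essentially_edge_connected_def not_le)
  then have "int t \<le> cut V (edge_mult G) B" using card_boundary[of B] B by (simp add: F_def)
  then show ?thesis using min'[of A] A by simp
qed

lemma essential_cuts_edge_mult:
  assumes "edge_connected 4 G" "essentially_edge_connected 23 G"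
  shows "essential_cuts V (edge_mult G)"
  using cut_ge_if_edge_connected[OF assms(1)] cut_ge_if_essentially_edge_connected[OF assms(2)]
  by (simp add: essential_cuts_def)

section \<open>From residues to an integer flow\<close>

lemma edge_mult_insert:
  assumes "finite F" "e \<notin> F" "ends G e = {x, y}"
  shows "int (card {d \<in> insert e F. ends G d = {u, v}})
    = int (card {d \<in> F. ends G d = {u, v}}) + edge x y u v"
proof (cases "{u, v} = {x, y}")
  case True
  then have eq: "{d \<in> insert e F. ends G d = {u, v}} = insert e {d \<in> F. ends G d = {u, v}}"
    using assms(3) by auto
  have "card (insert e {d \<in> F. ends G d = {u, v}}) = Suc (card {d \<in> F. ends G d = {u, v}})"
    using assms(1,2) by (intro card_insert_disjoint) auto
  moreover have "edge x y u v = 1" using True by (auto simp: edge_def doubleton_eq_iff)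
  ultimately show ?thesis unfolding eq by simp
next
  case False
  then have eq: "{d \<in> insert e F. ends G d = {u, v}} = {d \<in> F. ends G d = {u, v}}"
    using assms(3) by auto
  have "edge x y u v = 0" using False by (auto simp: edge_eq_0 doubleton_eq_iff)
  then show ?thesis unfolding eq by simp
qed

lemma orient_edges:
  assumes "finite F" "F \<subseteq> E" "orientable V (\<lambda>u v. int (card {e \<in> F. ends G e = {u, v}})) b"
  shows "\<exists>t h. (\<forall>e\<in>F. {t e, h e} = ends G e) \<and> (\<forall>v\<in>V. 3 dvd ((\<Sum>e\<in>F. arc (t e) (h e) v) - b v))"
  using assms
proof (induction F arbitrary: b)
  case empty
  then have "orientable V (\<lambda>u v. 0) b" by simp
  then obtain f where f: "\<And>u v. u \<in> V \<Longrightarrow> v \<in> V \<Longrightarrow> attainable 0 (f u v)"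
    "\<And>u. u \<in> V \<Longrightarrow> 3 dvd ((\<Sum>v\<in>V. f u v) - b u)"
    by (rule orientableE) blast
  have "3 dvd b u" if "u \<in> V" for u
  proof -
    have "3 dvd (\<Sum>v\<in>V. f u v)" using f(1)[OF that] by (intro dvd_sum) simp
    then show ?thesis using f(2)[OF that] by presburger
  qed
  then show ?case by simp
next
  case (insert e F)
  have eE: "e \<in> E" using insert.prems by simp
  obtain x y where xy: "ends G e = {x, y}" "x \<noteq> y" "x \<in> V" "y \<in> V" using edge_ends[OF eE] .
  define n where "n = (\<lambda>u v. int (card {e \<in> F. ends G e = {u, v}}))"
  have "{d \<in> F. ends G d = {u}} = {}" for u using card_ends insert.prems(1) by fastforce
  then have "card {d \<in> F. ends G d = {u}} = 0" for u by (metis card.empty)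
  then have mn: "mult n" by (simp add: mult_def n_def insert_commute)
  have "orientable V (\<lambda>u v. n u v + edge x y u v) b"
    using insert.prems(2) unfolding n_def edge_mult_insert[OF insert.hyps(1,2) xy(1)] .
  then obtain s where s: "s = 1 \<or> s = -1" "orientable V n (\<lambda>v. b v - s * arc x y v)"
    using orientable_remove_edge[OF finite_vertices mn xy(3,4,2)] by blast
  obtain t h where th: "\<forall>d\<in>F. {t d, h d} = ends G d"
    "\<forall>v\<in>V. 3 dvd ((\<Sum>d\<in>F. arc (t d) (h d) v) - (b v - s * arc x y v))"
    using insert.IH[OF _ s(2)[unfolded n_def]] insert.prems(1) by auto
  define p q where "p = (if s = 1 then x else y)" and "q = (if s = 1 then y else x)"
  have pq: "arc p q v = s * arc x y v" for v using s(1) by (auto simp: p_def q_def arc_def)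
  have "(\<Sum>d\<in>insert e F. arc ((t(e := p)) d) ((h(e := q)) d) v)
      = s * arc x y v + (\<Sum>d\<in>F. arc (t d) (h d) v)" for v
  proof -
    have "(\<Sum>d\<in>F. arc ((t(e := p)) d) ((h(e := q)) d) v) = (\<Sum>d\<in>F. arc (t d) (h d) v)"
      using insert.hyps(2) by (intro sum.cong) auto
    then show ?thesis using insert.hyps pq by simp
  qed
  moreover have "{p, q} = ends G e" using xy by (auto simp: p_def q_def)
  ultimately have "\<forall>v\<in>V. 3 dvd ((\<Sum>d\<in>insert e F. arc ((t(e := p)) d) ((h(e := q)) d) v) - b v)"
    "\<forall>d\<in>insert e F. {(t(e := p)) d, (h(e := q)) d} = ends G d"
    using th insert.hyps(2) by (simp_all add: algebra_simps)
  then show ?case by blast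
qed

end

locale mod3_orientation =
  fixes V :: "'v set" and E :: "'e set" and t h :: "'e \<Rightarrow> 'v"
  assumes finV: "finite V" and finE: "finite E"
    and th: "\<And>e. e \<in> E \<Longrightarrow> t e \<in> V" "\<And>e. e \<in> E \<Longrightarrow> h e \<in> V" "\<And>e. e \<in> E \<Longrightarrow> t e \<noteq> h e"
    and mod3: "\<And>v. v \<in> V \<Longrightarrow> 3 dvd (\<Sum>e\<in>E. arc (t e) (h e) v)"
begin

text \<open>
  The net outflow at \<open>v\<close> when the edges in \<open>S\<close> are reversed and carry 2, and the
  others carry 1.
\<close>

definition excess :: "'e set \<Rightarrow> 'v \<Rightarrow> int" where
  "excess S v = (\<Sum>e\<in>E. (if e \<in> S then -2 else 1) * arc (t e) (h e) v)"

text \<open>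
  Flipping a residual edge moves three units of excess from \<open>u\<close> to \<open>w\<close>.
\<close>

definition residual :: "'e set \<Rightarrow> 'v \<Rightarrow> 'v \<Rightarrow> bool" where
  "residual S u w \<longleftrightarrow> (\<exists>e\<in>E. (e \<notin> S \<and> t e = u \<and> h e = w) \<or> (e \<in> S \<and> h e = u \<and> t e = w))"

definition total :: "'e set \<Rightarrow> int" where "total S = (\<Sum>v\<in>V. \<bar>excess S v\<bar>)"

lemma excess_mod3: "v \<in> V \<Longrightarrow> 3 dvd excess S v"
proof -
  assume v: "v \<in> V"
  have "excess S v = (\<Sum>e\<in>E. arc (t e) (h e) v) + (\<Sum>e\<in>E. (if e \<in> S then -3 else 0) * arc (t e) (h e) v)"
    unfolding excess_def sum.distrib[symmetric] by (intro sum.cong) (auto simp: algebra_simps)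
  moreover have "3 dvd (\<Sum>e\<in>E. (if e \<in> S then -3 else 0) * arc (t e) (h e) v)"
    by (intro dvd_sum) auto
  ultimately show ?thesis using mod3[OF v] by simp
qed

lemma excess_sum:
  assumes "X \<subseteq> V"
  shows "(\<Sum>v\<in>X. excess S v) = (\<Sum>e\<in>E. (if e \<in> S then -2 else 1) * (of_bool (t e \<in> X) - of_bool (h e \<in>
      X)))"
proof -
  have "(\<Sum>v\<in>X. excess S v) = (\<Sum>e\<in>E. \<Sum>v\<in>X. (if e \<in> S then -2 else 1) * arc (t e) (h e) v)"
    unfolding excess_def by (rule sum.swap)
  also have "\<dots> = (\<Sum>e\<in>E. (if e \<in> S then -2 else 1) * (\<Sum>v\<in>X. arc (t e) (h e) v))"
    by (simp add: sum_distrib_left)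
  finally show ?thesis using finite_subset[OF assms finV] by (simp add: sum_arc)
qed

lemma flip:
  assumes e: "e \<in> E" and uw: "(e \<notin> S \<and> t e = u \<and> h e = w) \<or> (e \<in> S \<and> h e = u \<and> t e = w)"
  shows "excess (if e \<in> S then S - {e} else insert e S) v = excess S v - 3 * arc u w v"
proof -
  let ?S = "if e \<in> S then S - {e} else insert e S"
  have "(\<Sum>d\<in>E - {e}. (if d \<in> ?S then -2 else 1) * arc (t d) (h d) v)
    = (\<Sum>d\<in>E - {e}. (if d \<in> S then -2 else 1) * arc (t d) (h d) v)"
    by (intro sum.cong) auto
  then show ?thesis
    unfolding excess_def sum.remove[OF finE e] using uw by (auto simp: arc_def)
qed

text \<open>
  The excess is pushed along the path one edge at a time. The total does not grow, since an excess
  divisible by 3 is at least 3 when positive, and the rest of the path stays residual because it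
  avoids \<open>v\<close>.
\<close>

lemma augment:
  assumes "distinct (v # xs)" "set (v # xs) \<subseteq> V" "successively (residual S) (v # xs)"
    "0 < excess S v" "excess S (last (v # xs)) < 0"
  shows "\<exists>S'. total S' < total S"
  using assms
proof (induction xs arbitrary: S v)
  case Nil
  then show ?case by simp
next
  case (Cons w ys)
  have V: "v \<in> V" "w \<in> V" "v \<noteq> w" using Cons.prems by auto
  obtain e where e: "e \<in> E" "(e \<notin> S \<and> t e = v \<and> h e = w) \<or> (e \<in> S \<and> h e = v \<and> t e = w)"
    using Cons.prems(3) by (auto simp: residual_def)
  define S' where "S' = (if e \<in> S then S - {e} else insert e S)"
  have ex: "excess S' x = excess S x - 3 * arc v w x" for x
    unfolding S'_def by (rule flip[OF e])
  have rest: "excess S' x = excess S x" if "x \<noteq> v" "x \<noteq> w" for x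
    using ex[of x] that by (simp add: arc_def)
  have v': "excess S' v = excess S v - 3" and w': "excess S' w = excess S w + 3"
    using ex V by (auto simp: arc_def)
  have v3: "3 \<le> excess S v" using excess_mod3[OF V(1), of S] Cons.prems(4) by presburger
  have split: "total R = \<bar>excess R v\<bar> + \<bar>excess R w\<bar> + (\<Sum>x\<in>V - {v, w}. \<bar>excess R x\<bar>)" for R
    unfolding total_def using sum.subset_diff[of "{v, w}" V "\<lambda>x. \<bar>excess R x\<bar>"] V finV by simp
  have "(\<Sum>x\<in>V - {v, w}. \<bar>excess S' x\<bar>) = (\<Sum>x\<in>V - {v, w}. \<bar>excess S x\<bar>)"
    using rest by (intro sum.cong) auto
  then have tot: "total S' = total S - 3 + (\<bar>excess S w + 3\<bar> - \<bar>excess S w\<bar>)"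
    using split[of S] split[of S'] v' w' v3 by simp
  show ?case
  proof (cases "excess S w < 0")
    case True
    then have "excess S w \<le> -3" using excess_mod3[OF V(2), of S] by presburger
    then have "total S' < total S" using tot by simp
    then show ?thesis by blast
  next
    case False
    then have eq: "total S' = total S" using tot by simp
    have "ys \<noteq> []" using False Cons.prems(5) by auto
    then have l: "last (w # ys) \<in> set ys" by simp
    have "\<exists>S''. total S'' < total S'"
    proof (rule Cons.IH)
      have res: "residual S' a b" if "residual S a b" "a \<noteq> v" "b \<noteq> v" for a b
      proof -
        obtain d where d: "d \<in> E" "(d \<notin> S \<and> t d = a \<and> h d = b) \<or> (d \<in> S \<and> h d = a \<and> t d = b)"
          using \<open>residual S a b\<close> unfolding residual_def by blast
        have "d \<noteq> e" using d e that(2,3) by auto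
        then have "d \<in> S' \<longleftrightarrow> d \<in> S" by (auto simp: S'_def)
        then show ?thesis using d unfolding residual_def by blast
      qed
      have "successively (residual S) (w # ys)" using Cons.prems(3) by simp
      moreover have "v \<notin> set (w # ys)" using Cons.prems(1) by simp
      ultimately show "successively (residual S') (w # ys)"
        by (blast intro: successively_mono res)
      show "0 < excess S' w" using w' False by simp
      show "excess S' (last (w # ys)) < 0"
      proof -
        have "last (w # ys) \<noteq> v" "last (w # ys) \<noteq> w" using l Cons.prems(1) by auto
        then show ?thesis using rest[of "last (w # ys)"] Cons.prems(5) by simp
      qed
    qed (use Cons.prems in auto)
    then show ?thesis using eq by simp
  qed
qed

text \<open>
  In a choice of least total excess, the set reachable from a vertex of positive excess has no
  residual edge leaving it. So its excesses sum to at most 0, and it contains a vertex of negative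
  excess.
\<close>

lemma balanced_exists: "\<exists>S. \<forall>v\<in>V. excess S v = 0"
proof -
  obtain S where min: "\<And>S'. nat (total S) \<le> nat (total S')"
    using ex_has_least_nat[of "\<lambda>_. True" "{}" "\<lambda>S. nat (total S)"] by blast
  have "0 \<le> total R" for R unfolding total_def by (intro sum_nonneg) simp
  then have min': "\<not> total S' < total S" for S' using min[of S'] by (simp add: not_less nat_le_eq_zle)
  have nonpos: "excess S v \<le> 0" if v: "v \<in> V" for v
  proof (rule ccontr)
    assume pos: "\<not> excess S v \<le> 0"
    define path where "path xs \<longleftrightarrow> distinct (v # xs) \<and> set (v # xs) \<subseteq> V \<and>
        successively (residual S) (v # xs)" for xs
    define X where "X = {last (v # xs) | xs. path xs}"
    have vX: "v \<in> X" unfolding X_def path_def using v by (intro CollectI exI[of _ "[]"]) simp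
    have XV: "X \<subseteq> V"
    proof
      fix x assume "x \<in> X"
      then obtain xs where "x = last (v # xs)" "path xs" by (auto simp: X_def)
      then show "x \<in> V" unfolding path_def by (metis last_in_set list.distinct(1) subsetD)
    qed
    have closed: "w \<in> X" if u: "u \<in> X" and r: "residual S u w" for u w
    proof -
      obtain xs where xs: "u = last (v # xs)" "path xs" using u by (auto simp: X_def)
      show ?thesis
      proof (cases "w \<in> set (v # xs)")
        case True
        then obtain as bs where ab: "v # xs = as @ w # bs" by (metis split_list)
        show ?thesis
        proof (cases as)
          case Nil
          then show ?thesis using ab vX by simp
        next
          case (Cons a as')
          then have "v # xs = (v # as' @ [w]) @ bs" using ab by simp
          then have "path (as' @ [w])"
            using xs(2) unfolding path_def
                by (metis distinct_append le_sup_iff set_append successively_append_iff)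
          then have "last (v # as' @ [w]) \<in> X" unfolding X_def by blast
          then show ?thesis by simp
        qed
      next
        case False
        have wV: "w \<in> V" using r th by (auto simp: residual_def)
        have "successively (residual S) ((v # xs) @ [w])"
          using xs r unfolding path_def successively_append_iff by simp
        then have "path (xs @ [w])" using xs(2) False wV unfolding path_def by auto
        then have "last (v # xs @ [w]) \<in> X" unfolding X_def by blast
        then show ?thesis by simp
      qed
    qed
    have "(\<Sum>x\<in>X. excess S x) \<le> 0"
      unfolding excess_sum[OF XV]
    proof (rule sum_nonpos)
      fix e assume e: "e \<in> E"
      have "h e \<in> X" if "t e \<in> X" "e \<notin> S"
          using closed[OF that(1), of "h e"] e that(2) by (auto simp: residual_def)
      moreover have "t e \<in> X" if "h e \<in> X"
          "e \<in> S" using closed[OF that(1), of "t e"] e that(2) by (auto simp: residual_def)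
      ultimately show "(if e \<in> S then -2 else 1) * (of_bool (t e \<in> X) - of_bool (h e \<in> X)) \<le> (0::int)"
        by (auto simp: of_bool_def)
    qed
    have "\<exists>w\<in>X. excess S w < 0"
    proof (rule ccontr)
      assume "\<not> ?thesis"
      then have "0 < (\<Sum>x\<in>X. excess S x)"
        using vX pos finite_subset[OF XV finV] by (intro sum_pos2[of X v]) auto
      then show False using \<open>(\<Sum>x\<in>X. excess S x) \<le> 0\<close> by simp
    qed
    then obtain xs where "path xs" "excess S (last (v # xs)) < 0" by (auto simp: X_def)
    then have "\<exists>S'. total S' < total S" using pos unfolding path_def by (intro augment[of v xs]) auto
    then show False using min' by blast
  qed
  have "(\<Sum>v\<in>V. excess S v) = 0"
    unfolding excess_sum[OF subset_refl] using th by (intro sum.neutral) auto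
  then have "\<forall>v\<in>V. - excess S v = 0"
    using nonpos finV by (subst sum_nonneg_eq_0_iff[symmetric]) (auto simp: sum_negf)
  then show ?thesis by auto
qed

lemma integer_flow:
  "\<exists>t' h' f. (\<forall>e\<in>E. {t' e, h' e} = {t e, h e}) \<and> (\<forall>e\<in>E. f e \<in> {1..2 :: nat}) \<and>
    (\<forall>v\<in>V. (\<Sum>e | e \<in> E \<and> t' e = v. f e) = (\<Sum>e | e \<in> E \<and> h' e = v. f e))"
proof -
  obtain S where S: "\<forall>v\<in>V. excess S v = 0" using balanced_exists by blast
  define t' h' where "t' e = (if e \<in> S then h e else t e)" and "h' e = (if e \<in> S then t e else h e)"
      for e
  define f :: "'e \<Rightarrow> nat" where "f e = (if e \<in> S then 2 else 1)" for e
  have "(\<Sum>e | e \<in> E \<and> t' e = v. f e) = (\<Sum>e | e \<in> E \<and> h' e = v. f e)" if v: "v \<in> V" for v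
  proof -
    have c: "int (\<Sum>e | e \<in> E \<and> p e = v. f e) = (\<Sum>e\<in>E. int (f e) * of_bool (v = p e))" for p :: "'e \<Rightarrow> 'v"
      unfolding of_nat_sum sum.inter_filter[OF finE] by (intro sum.cong refl) simp
    have "int (\<Sum>e | e \<in> E \<and> t' e = v. f e) - int (\<Sum>e | e \<in> E \<and> h' e = v. f e) = excess S v"
      unfolding c excess_def sum_subtractf[symmetric]
      by (intro sum.cong) (auto simp: f_def t'_def h'_def arc_def)
    then have "int (\<Sum>e | e \<in> E \<and> t' e = v. f e) = int (\<Sum>e | e \<in> E \<and> h' e = v. f e)"
      using bspec[OF S v] by linarith
    then show ?thesis by (simp only: of_nat_eq_iff)
  qed
  moreover have "{t' e, h' e} = {t e, h e}" "f e \<in> {1..2}" for e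
    by (auto simp: t'_def h'_def f_def)
  ultimately show ?thesis by blast
qed

end

theorem theoremA1:
  fixes G :: "('v, 'e) pre_multigraph"
  assumes "loopless_multigraph G"
    and "edge_connected 4 G"
    and "essentially_edge_connected 23 G"
  shows "\<exists>D f. nowhere_zero_flow 3 G D f"
proof -
  interpret loopless_multigraph G by (rule assms(1))
  have "orientable (vertices G) (edge_mult G) (\<lambda>_. 0)"
    by (rule orientable_if_essential_cuts[OF finite_vertices mult_edge_mult essential_cuts_edge_mult[OF assms(2,3)]])
  then have "orientable (vertices G) (\<lambda>u v. int (card {e \<in> edges G. ends G e = {u, v}})) (\<lambda>_. 0)"
    unfolding edge_mult_def .
  from orient_edges[OF finite_edges subset_refl this] obtain t h
    where ends: "\<forall>e\<in>edges G. {t e, h e} = ends G e"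
      and mod3: "\<forall>v\<in>vertices G. 3 dvd ((\<Sum>e\<in>edges G. arc (t e) (h e) v) - 0)" by blast
  interpret mod3_orientation "vertices G" "edges G" t h
  proof
    fix e assume e: "e \<in> edges G"
    then have th: "{t e, h e} = ends G e" using ends by blast
    then have card2: "card {t e, h e} = 2" using card_ends[OF e] by simp
    show "t e \<in> vertices G" "h e \<in> vertices G" using ends_in_vertices[OF e] th by auto
    show "t e \<noteq> h e" using card2 by auto
  qed (use finite_vertices finite_edges mod3 in auto)
  obtain t' h' f where t': "\<forall>e\<in>edges G. {t' e, h' e} = {t e, h e}" "\<forall>e\<in>edges G. f e \<in> {1..2 :: nat}"
    "\<forall>v\<in>vertices G. (\<Sum>e | e \<in> edges G \<and> t' e = v. f e) = (\<Sum>e | e \<in> edges G \<and> h' e = v. f e)"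
    using integer_flow by blast
  define D where "D = \<lparr>verts = vertices G, arcs = edges G, tail = t', head = h'\<rparr>"
  have "nowhere_zero_flow 3 G D f"
    using t' ends by (simp add: nowhere_zero_flow_def orientation_def D_def out_arcs_def in_arcs_def)
  then show ?thesis by blast
qed

end
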